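(* Let $A_0\in\mathbb{R}^{n\times n}$ be Metzler and let $A_i\in\mathbb{R}^{n\times n}$ ($i=1,\ldots,N$), $C_i\in\mathbb{R}^{n_y\times n}$ ($i=0,\ldots,N$), $E_u\in\mathbb{R}^{n\times n_u}$, $F_u\in\mathbb{R}^{n_y\times n_u}$ be entrywise nonnegative (so the system below is internally positive). Let $\bar h_i\ge0$ and consider $$\dot x(t)=A_0x(t)+\sum_{i=1}^NA_i\int_{t-h_i(t)}^tx(s)ds+E_uu(t),\qquad y(t)=C_0x(t)+\sum_{i=1}^NC_i\int_{t-h_i(t)}^tx(s)ds+F_uu(t),$$ with delay functions $h_i:\mathbb{R}_{\ge0}\to[0,\bar h_i]$. Then: (i) The system is asymptotically stable and has $L_1$-gain smaller than $\gamma_1$ (for all such delay functions) if and only if there exists $\lambda\in\mathbb{R}^n_{>0}$ such that $$\begin{bmatrix}\lambda\\ \mathbf{1}_{n_y}\end{bmatrix}^T\begin{bmatrix}A_0+\sum_{i=1}^N\bar h_iA_i & E_u\\ C_0+\sum_{i=1}^N\bar h_iC_i & F_u\end{bmatrix}<\begin{bmatrix}0\\ \gamma_1\mathbf{1}_{n_u}\end{bmatrix}^T.$$ (ii) The system is asymptotically stable and has $L_2$-gain smaller than $\gamma_2$ (for all such delay functions) if and only if there exist diagonal positive definite $P,Q_1,\ldots,Q_N\in\mathbb{R}^{n\times n}$ such that $$\begin{bmatrix}A_0^TP+PA_0+\sum_{i=1}^NQ_i & [\bar h_1PA_1\ \cdots\ \bar h_NPA_N] & PE_u & C_0^T\\ \star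 & -\mathrm{diag}(Q_1,\ldots,Q_N) & 0 & \begin{bmatrix}\bar h_1C_1^T\\ \vdots\\ \bar h_NC_N^T\end{bmatrix}\\ \star & \star & -\gamma_2I & F_u^T\\ \star & \star & \star & -\gamma_2I\end{bmatrix}\prec0.$$ (iii) The system is asymptotically stable and has $L_\infty$-gain smaller than $\gamma_\infty$ (for all such delay functions) if and only if there exists $\lambda\in\mathbb{R}^n_{>0}$ such that $$\begin{bmatrix}A_0+\sum_{i=1}^N\bar h_iA_i & E_u\\ C_0+\sum_{i=1}^N\bar h_iC_i & F_u\end{bmatrix}\begin{bmatrix}\lambda\\ \mathbf{1}_{n_u}\end{bmatrix}<\begin{bmatrix}0\\ \gamma_\infty\mathbf{1}_{n_y}\end{bmatrix}.$$
   Context: A Metzler matrix has nonnegative off-diagonal entries. $\mathbf{1}_k$ is the vector of ones; vector inequalities are componentwise; $\star$ denotes the transpose of the symmetric block; $\prec0$ means negative definite. Asymptotic stability refers to the unforced system ($u=0$). The $L_p$-gain is the induced gain of $u\mapsto y$ with zero initial conditions, with $\|w\|_{L_p}=(\int_0^\infty\|w(t)\|_p^pdt)^{1/p}$ for $p=1,2$ and $\|w\|_{L_\infty}=\operatorname{ess\,sup}_t\|w(t)\|_\infty$. *)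

theory Defs
  imports "HOL-Analysis.Analysis"
begin

text \<open>Matrices are Cartesian: real^'c^'r is an r x c matrix (rows indexed by 'r).
  State dimension n = CARD('n), output dimension n_y = CARD('y), input dimension
  n_u = CARD('u).  Families A i, C i are indexed by i = 0..N.\<close>

definition metzler :: "real^'n^'n \<Rightarrow> bool" where
  "metzler M \<longleftrightarrow> (\<forall>i j. i \<noteq> j \<longrightarrow> 0 \<le> M$i$j)"

definition nonneg_mat :: "real^'c^'r \<Rightarrow> bool" where
  "nonneg_mat M \<longleftrightarrow> (\<forall>i j. 0 \<le> M$i$j)"

definition vnorm1 :: "real^'a \<Rightarrow> real" where
  "vnorm1 x = (\<Sum>i\<in>UNIV. \<bar>x$i\<bar>)"

definition vnorm_inf :: "real^'a \<Rightarrow> real" where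
  "vnorm_inf x = Max (range (\<lambda>i. \<bar>x$i\<bar>))"

text \<open>Maximal delay bound (0 if N = 0); initial data live on [-hmax, 0].\<close>
definition hmax :: "nat \<Rightarrow> (nat \<Rightarrow> real) \<Rightarrow> real" where
  "hmax N hbar = Max (insert 0 (hbar ` {1..N}))"

definition admissible_delays :: "nat \<Rightarrow> (nat \<Rightarrow> real) \<Rightarrow> (nat \<Rightarrow> real \<Rightarrow> real) \<Rightarrow> bool" where
  "admissible_delays N hbar h \<longleftrightarrow> (\<forall>i\<in>{1..N}. \<forall>t\<ge>0. 0 \<le> h i t \<and> h i t \<le> hbar i)"

definition sys_rhs :: "nat \<Rightarrow> (nat \<Rightarrow> real^'n^'n) \<Rightarrow> real^'u^'n \<Rightarrow> (nat \<Rightarrow> real \<Rightarrow> real)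
    \<Rightarrow> (real \<Rightarrow> real^'n) \<Rightarrow> (real \<Rightarrow> real^'u) \<Rightarrow> real \<Rightarrow> real^'n" where
  "sys_rhs N A Eu h x u t =
     A 0 *v x t + (\<Sum>i\<in>{1..N}. A i *v integral {t - h i t..t} x) + Eu *v u t"

definition sys_out :: "nat \<Rightarrow> (nat \<Rightarrow> real^'n^'y) \<Rightarrow> real^'u^'y \<Rightarrow> (nat \<Rightarrow> real \<Rightarrow> real)
    \<Rightarrow> (real \<Rightarrow> real^'n) \<Rightarrow> (real \<Rightarrow> real^'u) \<Rightarrow> real \<Rightarrow> real^'y" where
  "sys_out N C Fu h x u t =
     C 0 *v x t + (\<Sum>i\<in>{1..N}. C i *v integral {t - h i t..t} x) + Fu *v u t"

definition is_solution :: "nat \<Rightarrow> (nat \<Rightarrow> real) \<Rightarrow> (nat \<Rightarrow> real^'n^'n) \<Rightarrow> real^'u^'n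
    \<Rightarrow> (nat \<Rightarrow> real \<Rightarrow> real) \<Rightarrow> (real \<Rightarrow> real^'u) \<Rightarrow> (real \<Rightarrow> real^'n) \<Rightarrow> bool" where
  "is_solution N hbar A Eu h u x \<longleftrightarrow>
     continuous_on {- hmax N hbar..} x \<and>
     (\<forall>t\<ge>0. (sys_rhs N A Eu h x u has_integral (x t - x 0)) {0..t})"

definition asymp_stable :: "nat \<Rightarrow> (nat \<Rightarrow> real) \<Rightarrow> (nat \<Rightarrow> real^'n^'n) \<Rightarrow> real^'u^'n
    \<Rightarrow> (nat \<Rightarrow> real \<Rightarrow> real) \<Rightarrow> bool" where
  "asymp_stable N hbar A Eu h \<longleftrightarrow>
     (\<forall>\<epsilon>>0. \<exists>\<delta>>0. \<forall>x. is_solution N hbar A Eu h (\<lambda>_. 0) x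
        \<and> (\<forall>s\<in>{- hmax N hbar..0}. norm (x s) < \<delta>) \<longrightarrow> (\<forall>t\<ge>0. norm (x t) < \<epsilon>)) \<and>
     (\<forall>x. is_solution N hbar A Eu h (\<lambda>_. 0) x \<longrightarrow> (x \<longlongrightarrow> 0) at_top)"

definition L1_gain_lt :: "nat \<Rightarrow> (nat \<Rightarrow> real) \<Rightarrow> (nat \<Rightarrow> real^'n^'n) \<Rightarrow> real^'u^'n
    \<Rightarrow> (nat \<Rightarrow> real^'n^'y) \<Rightarrow> real^'u^'y \<Rightarrow> (nat \<Rightarrow> real \<Rightarrow> real) \<Rightarrow> real \<Rightarrow> bool" where
  "L1_gain_lt N hbar A Eu C Fu h \<gamma> \<longleftrightarrow> (\<exists>g. 0 \<le> g \<and> g < \<gamma> \<and>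
     (\<forall>u x. u \<in> borel_measurable lborel
        \<and> (\<integral>\<^sup>+t\<in>{0..}. ennreal (vnorm1 (u t)) \<partial>lborel) < \<infinity>
        \<and> is_solution N hbar A Eu h u x \<and> (\<forall>s\<in>{- hmax N hbar..0}. x s = 0) \<longrightarrow>
        (\<integral>\<^sup>+t\<in>{0..}. ennreal (vnorm1 (sys_out N C Fu h x u t)) \<partial>lborel)
          \<le> ennreal g * (\<integral>\<^sup>+t\<in>{0..}. ennreal (vnorm1 (u t)) \<partial>lborel)))"

definition L2_gain_lt :: "nat \<Rightarrow> (nat \<Rightarrow> real) \<Rightarrow> (nat \<Rightarrow> real^'n^'n) \<Rightarrow> real^'u^'n
    \<Rightarrow> (nat \<Rightarrow> real^'n^'y) \<Rightarrow> real^'u^'y \<Rightarrow> (nat \<Rightarrow> real \<Rightarrow> real) \<Rightarrow> real \<Rightarrow> bool" where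
  "L2_gain_lt N hbar A Eu C Fu h \<gamma> \<longleftrightarrow> (\<exists>g. 0 \<le> g \<and> g < \<gamma> \<and>
     (\<forall>u x. u \<in> borel_measurable lborel
        \<and> (\<integral>\<^sup>+t\<in>{0..}. ennreal ((norm (u t))\<^sup>2) \<partial>lborel) < \<infinity>
        \<and> is_solution N hbar A Eu h u x \<and> (\<forall>s\<in>{- hmax N hbar..0}. x s = 0) \<longrightarrow>
        (\<integral>\<^sup>+t\<in>{0..}. ennreal ((norm (sys_out N C Fu h x u t))\<^sup>2) \<partial>lborel)
          \<le> ennreal (g\<^sup>2) * (\<integral>\<^sup>+t\<in>{0..}. ennreal ((norm (u t))\<^sup>2) \<partial>lborel)))"

definition Linf_gain_lt :: "nat \<Rightarrow> (nat \<Rightarrow> real) \<Rightarrow> (nat \<Rightarrow> real^'n^'n) \<Rightarrow> real^'u^'n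
    \<Rightarrow> (nat \<Rightarrow> real^'n^'y) \<Rightarrow> real^'u^'y \<Rightarrow> (nat \<Rightarrow> real \<Rightarrow> real) \<Rightarrow> real \<Rightarrow> bool" where
  "Linf_gain_lt N hbar A Eu C Fu h \<gamma> \<longleftrightarrow> (\<exists>g. 0 \<le> g \<and> g < \<gamma> \<and>
     (\<forall>u x c. u \<in> borel_measurable lborel
        \<and> (AE t in lborel. t \<ge> 0 \<longrightarrow> vnorm_inf (u t) \<le> c)
        \<and> is_solution N hbar A Eu h u x \<and> (\<forall>s\<in>{- hmax N hbar..0}. x s = 0) \<longrightarrow>
        (AE t in lborel. t \<ge> 0 \<longrightarrow> vnorm_inf (sys_out N C Fu h x u t) \<le> g * c)))"

definition diag_pd :: "real^'n^'n \<Rightarrow> bool" where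
  "diag_pd P \<longleftrightarrow> (\<forall>i j. i \<noteq> j \<longrightarrow> P$i$j = 0) \<and> (\<forall>x. x \<noteq> 0 \<longrightarrow> x \<bullet> (P *v x) > 0)"

text \<open>Quadratic form of the symmetric block matrix of condition (ii), evaluated at the
  block vector (x, z_1, ..., z_N, w, v).\<close>
definition lmi2_form :: "nat \<Rightarrow> (nat \<Rightarrow> real) \<Rightarrow> (nat \<Rightarrow> real^'n^'n) \<Rightarrow> real^'u^'n
    \<Rightarrow> (nat \<Rightarrow> real^'n^'y) \<Rightarrow> real^'u^'y \<Rightarrow> real^'n^'n \<Rightarrow> (nat \<Rightarrow> real^'n^'n) \<Rightarrow> real
    \<Rightarrow> real^'n \<Rightarrow> (nat \<Rightarrow> real^'n) \<Rightarrow> real^'u \<Rightarrow> real^'y \<Rightarrow> real" where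
  "lmi2_form N hbar A Eu C Fu P Q \<gamma> x z w v =
       x \<bullet> ((transpose (A 0) ** P + P ** A 0 + (\<Sum>i\<in>{1..N}. Q i)) *v x)
     + 2 * (\<Sum>i\<in>{1..N}. x \<bullet> ((hbar i *\<^sub>R (P ** A i)) *v z i))
     + 2 * (x \<bullet> ((P ** Eu) *v w))
     + 2 * (x \<bullet> (transpose (C 0) *v v))
     - (\<Sum>i\<in>{1..N}. z i \<bullet> (Q i *v z i))
     + 2 * (\<Sum>i\<in>{1..N}. z i \<bullet> ((hbar i *\<^sub>R transpose (C i)) *v v))
     + 2 * (w \<bullet> (transpose Fu *v v))
     - \<gamma> * (w \<bullet> w) - \<gamma> * (v \<bullet> v)"

definition lmi2_neg_def :: "nat \<Rightarrow> (nat \<Rightarrow> real) \<Rightarrow> (nat \<Rightarrow> real^'n^'n) \<Rightarrow> real^'u^'n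
    \<Rightarrow> (nat \<Rightarrow> real^'n^'y) \<Rightarrow> real^'u^'y \<Rightarrow> real^'n^'n \<Rightarrow> (nat \<Rightarrow> real^'n^'n) \<Rightarrow> real \<Rightarrow> bool" where
  "lmi2_neg_def N hbar A Eu C Fu P Q \<gamma> \<longleftrightarrow>
     (\<forall>x z w v. (x \<noteq> 0 \<or> (\<exists>i\<in>{1..N}. z i \<noteq> 0) \<or> w \<noteq> 0 \<or> v \<noteq> 0) \<longrightarrow>
        lmi2_form N hbar A Eu C Fu P Q \<gamma> x z w v < 0)"

definition Abar :: "nat \<Rightarrow> (nat \<Rightarrow> real) \<Rightarrow> (nat \<Rightarrow> real^'c^'r) \<Rightarrow> real^'c^'r" where
  "Abar N hbar A = A 0 + (\<Sum>i\<in>{1..N}. hbar i *\<^sub>R A i)"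

end

theory Submission
  imports Defs
begin

text \<open>Let \<open>v = \<bar>x\<bar>\<close> componentwise for a solution \<open>x\<close>. Since the system is internally positive, \<open>v\<close>
  satisfies the differential inequality of the same system with every delay \<open>h\<^sub>i(t)\<close> replaced by the
  constant \<open>hbar i\<close>, whatever the (possibly nonmeasurable) delay functions are. Sufficiency then
  follows from copositive Lyapunov functionals: linear with weight \<open>\<lambda>\<close> for (i) and for stability, diagonal
  quadratic for (ii), and comparison with the constant supersolution \<open>c \<lambda>\<close> for (iii).

  For necessity it is enough to take \<open>h\<^sub>i = hbar i\<close>. If the Metzler matrix \<open>Abar A\<close> admits no
  \<open>\<lambda> > 0\<close> with \<open>\<lambda>\<^sup>T Abar A < 0\<close>, Ville's theorem of the alternative gives \<open>p \<ge> 0\<close>, \<open>p \<noteq> 0\<close> with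
  \<open>Abar A p \<ge> 0\<close>, and the solution starting at \<open>p\<close> stays above \<open>p\<close>. Otherwise \<open>B = - (Abar A)\<^sup>-\<^sup>1\<close> is
  nonnegative, and inputs that are constant on a long interval show that each gain bounds the
  corresponding norm of the static gain \<open>G = Abar C B Eu + Fu\<close>. Finally, a bound on \<open>G\<close> yields the
  certificates explicitly; for (ii) one uses that a symmetric Metzler matrix \<open>M\<close> with \<open>M \<zeta> < 0\<close> for some
  \<open>\<zeta> > 0\<close> is negative definite.\<close>

section \<open>Linear algebra\<close>

text \<open>The window integral of a nonnegative function grows with the window, so the largest
  constant delays are the worst case; on constant functions a window of length \<open>hbar i\<close>
  acts as multiplication by \<open>hbar i\<close>. This is why the delay problem collapses to the
  matrices \<open>Abar N hbar A\<close> and \<open>Abar N hbar C\<close>. A solution is given only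
  by its integral equation, with an integrable but possibly irregular right-hand side, so moduli,
  positive parts and squares cannot be differentiated; they are controlled by increments over short
  intervals. A gain below \<open>\<gamma>\<close> means one \<open>g < \<gamma>\<close> for all
  inputs, while the certificates are strict inequalities: each certificate is the static gain's
  equilibrium data plus a small multiple of the ones vector. Conversely, the block inequality at
  level \<open>\<gamma>\<close> bounds the static gain strictly below \<open>\<gamma>\<close>, from
  which a new block inequality at a smaller level is built, and that one bounds the gain.\<close>

lemma nonneg_if_affine_bounded_below:
  fixes a b c :: real
  assumes "\<And>K. 0 < K \<Longrightarrow> b \<le> K * a + c"
  shows "0 \<le> a"
proof (rule ccontr)
  assume "\<not> 0 \<le> a"
  then have a: "a < 0" by simp
  define K where "K = (\<bar>c - b\<bar> + 1) / (- a)"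
  have K: "0 < K" unfolding K_def using a by (intro divide_pos_pos) auto
  have "K * a = - (\<bar>c - b\<bar> + 1)" using a by (simp add: K_def field_simps)
  with assms[OF K] show False by linarith
qed

text \<open>If no \<open>l\<close> exists, the image under \<open>M\<close> of the open positive
  orthant and the open negative orthant are disjoint convex sets; the normal of a separating
  hyperplane is the required \<open>p\<close>.\<close>

lemma ville_alternative:
  fixes M :: "real^'n^'m"
  shows "(\<exists>l. (\<forall>j. 0 < l$j) \<and> (\<forall>i. (M *v l)$i < 0)) \<or>
         (\<exists>p. p \<noteq> 0 \<and> (\<forall>i. 0 \<le> p$i) \<and> (\<forall>j. 0 \<le> (p v* M)$j))"
proof (rule disj_imp[THEN iffD2], rule impI)
  assume no: "\<not> (\<exists>l. (\<forall>j. 0 < l$j) \<and> (\<forall>i. (M *v l)$i < 0))"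
  define Pos where "Pos = {l::real^'n. \<forall>j. 0 < l$j}"
  define Neg where "Neg = {y::real^'m. \<forall>i. y$i < 0}"
  have "convex Pos"
    using convexD[OF convex_real_interval(3)[of "0::real"]] by (auto simp: Pos_def intro!: convexI)
  then have cS: "convex ((*v) M ` Pos)"
    by (intro convex_linear_image) (simp add: matrix_vector_mul_linear)
  have cT: "convex Neg"
    using convexD[OF convex_real_interval(4)[of "0::real"]] by (auto simp: Neg_def intro!: convexI)
  have "1 \<in> Pos" by (simp add: Pos_def)
  then have nS: "(*v) M ` Pos \<noteq> {}" by blast
  have "-1 \<in> Neg" by (simp add: Neg_def)
  then have nT: "Neg \<noteq> {}" by blast
  have "Neg \<inter> (*v) M ` Pos = {}" using no by (auto simp: Neg_def Pos_def)
  from separating_hyperplane_sets[OF cT cS nT nS this] obtain a b where a: "a \<noteq> 0"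
    and T: "\<And>y. y \<in> Neg \<Longrightarrow> a \<bullet> y \<le> b" and S: "\<And>l. l \<in> Pos \<Longrightarrow> b \<le> a \<bullet> (M *v l)"
    by (auto simp: image_iff)
  \<comment> \<open>Moving arbitrarily far along a coordinate direction inside the orthant keeps the
    functional on its side of \<open>b\<close>, which fixes the sign of that coefficient. The shift
    by the ones vector keeps the point in the open cone.\<close>
  have "0 \<le> a$i" for i
  proof (rule nonneg_if_affine_bounded_below)
    fix K :: real assume "0 < K"
    then have "- (K *\<^sub>R axis i 1) - 1 \<in> Neg" by (auto simp: Neg_def axis_def)
    from T[OF this] show "- b \<le> K * a$i + a \<bullet> 1"
      by (simp add: inner_diff_right inner_minus_right inner_axis)
  qed
  moreover have "0 \<le> (a v* M)$j" for j
  proof (rule nonneg_if_affine_bounded_below)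
    fix K :: real assume "0 < K"
    then have "K *\<^sub>R axis j 1 + 1 \<in> Pos" by (auto simp: Pos_def axis_def add_pos_pos)
    from S[OF this] have "b \<le> (a v* M) \<bullet> (K *\<^sub>R axis j 1 + 1)"
      by (simp only: dot_lmul_matrix)
    then show "b \<le> K * (a v* M)$j + (a v* M) \<bullet> 1"
      by (simp add: inner_add_right inner_axis)
  qed
  ultimately show "\<exists>p. p \<noteq> 0 \<and> (\<forall>i. 0 \<le> p$i) \<and> (\<forall>j. 0 \<le> (p v* M)$j)" using a by blast
qed

lemma ville_alternative_left:
  fixes M :: "real^'n^'m"
  shows "(\<exists>l. (\<forall>j. 0 < l$j) \<and> (\<forall>i. (l v* M)$i < 0)) \<or>
         (\<exists>p. p \<noteq> 0 \<and> (\<forall>i. 0 \<le> p$i) \<and> (\<forall>j. 0 \<le> (M *v p)$j))"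
  using ville_alternative[of "transpose M"] by simp

section \<open>Nonnegative matrices and inverses of stable Metzler matrices\<close>

lemma nonneg_mat_mv: "nonneg_mat M \<Longrightarrow> (\<forall>j. 0 \<le> x$j) \<Longrightarrow> 0 \<le> (M *v x)$i"
  by (auto simp: nonneg_mat_def matrix_vector_mult_def intro!: sum_nonneg)

lemma nonneg_mat_vm: "nonneg_mat M \<Longrightarrow> (\<forall>j. 0 \<le> x$j) \<Longrightarrow> 0 \<le> (x v* M)$i"
  by (auto simp: nonneg_mat_def vector_matrix_mult_def intro!: sum_nonneg)

lemma nonneg_mat_mult: "nonneg_mat M \<Longrightarrow> nonneg_mat L \<Longrightarrow> nonneg_mat (M ** L)"
  by (auto simp: nonneg_mat_def matrix_matrix_mult_def intro!: sum_nonneg)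

lemma nonneg_mat_add: "nonneg_mat M \<Longrightarrow> nonneg_mat L \<Longrightarrow> nonneg_mat (M + L)"
  by (auto simp: nonneg_mat_def)

text \<open>For Metzler \<open>M\<close> this is the inverse of the M-matrix \<open>- M\<close>; in
  the system it sends a constant forcing to the equilibrium state.\<close>

definition neg_inverse :: "real^'n^'n \<Rightarrow> real^'n^'n \<Rightarrow> bool" where
  "neg_inverse M B \<longleftrightarrow> nonneg_mat B \<and> M ** B = - mat 1 \<and> B ** M = - mat 1"

text \<open>A minimum principle. At the index \<open>k\<close> minimizing \<open>y$j / l$j\<close>,
  subtracting \<open>c\<close> times \<open>l\<close> leaves a nonnegative vector that vanishes at
  \<open>k\<close>, so only off-diagonal entries of \<open>M\<close> enter component
  \<open>k\<close> of its product with \<open>M\<close>. A negative \<open>c\<close> would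
  contradict the sign of that component.\<close>

lemma metzler_left_monotone:
  fixes M :: "real^'n^'n"
  assumes M: "metzler M" and l: "\<forall>j. 0 < l$j" "\<forall>j. (l v* M)$j < 0"
    and y: "\<forall>j. (y v* M)$j \<le> 0"
  shows "0 \<le> y$i"
proof -
  obtain k where k: "\<And>j. y$k / l$k \<le> y$j / l$j"
    using ex_is_arg_min_if_finite[of UNIV "\<lambda>j. y$j / l$j"] by (auto simp: is_arg_min_linorder)
  define c where "c = y$k / l$k"
  have "0 \<le> c"
  proof (rule ccontr)
    assume "\<not> 0 \<le> c"
    then have c: "c < 0" by simp
    define z where "z = y - c *\<^sub>R l"
    have z0: "0 \<le> z$j" for j
      using k[of j] l(1) by (simp add: z_def c_def[symmetric] pos_le_divide_eq)
    have zk: "z$k = 0"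
      using l(1)[rule_format, of k] by (simp add: z_def c_def)
    have "(z v* M)$k = (\<Sum>j\<in>UNIV. M$j$k * z$j)" by (simp add: vector_matrix_mult_def mult.commute)
    also have "\<dots> \<ge> 0"
    proof (rule sum_nonneg)
      fix j show "0 \<le> M$j$k * z$j"
        using M z0[of j] zk by (cases "j = k") (auto simp: metzler_def)
    qed
    finally have "0 \<le> (z v* M)$k" .
    moreover have "(z v* M)$k = (y v* M)$k - c * (l v* M)$k"
      by (simp add: z_def vector_matrix_mult_def algebra_simps sum_subtractf sum_distrib_left)
    moreover have "0 < c * (l v* M)$k" using c l(2) by (simp add: mult_neg_neg)
    ultimately show False using y by (smt (verit))
  qed
  then have "0 \<le> y$i / l$i" using k[of i] by (simp add: c_def)
  then show ?thesis using l(1) by (smt (verit) divide_neg_pos)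
qed

text \<open>Monotonicity for \<open>y\<close> and \<open>- y\<close> together gives injectivity,
  hence invertibility; applied to the rows of \<open>B\<close>, whose products with \<open>M\<close>
  are the rows of \<open>- mat 1\<close>, it gives nonnegativity.\<close>

lemma metzler_neg_inverse:
  fixes M :: "real^'n^'n"
  assumes M: "metzler M" and l: "\<forall>j. 0 < l$j" "\<forall>j. (l v* M)$j < 0"
  shows "\<exists>B. neg_inverse M B"
proof -
  have "y = 0" if "transpose M *v y = 0" for y
  proof -
    have "y v* M = 0" using that by simp
    moreover have "(-y) v* M = - (y v* M)"
      by (simp add: vector_matrix_mult_def vec_eq_iff sum_negf)
    ultimately have "0 \<le> y$i" "0 \<le> (-y)$i" for i
      using metzler_left_monotone[OF M l, of y i] metzler_left_monotone[OF M l, of "-y" i] by simp_all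
    then show ?thesis by (simp add: vec_eq_iff) (metis antisym)
  qed
  then obtain L where L: "L ** transpose M = mat 1"
    using matrix_left_invertible_ker[of "transpose M"] by blast
  define B where "B = - transpose L"
  have "transpose (L ** transpose M) = mat 1" by (simp add: L transpose_mat)
  then have MT: "M ** transpose L = mat 1" by (simp add: matrix_transpose_mul transpose_transpose)
  then have TM: "transpose L ** M = mat 1" using matrix_left_right_inverse by blast
  have neg: "X ** (- Y) = - (X ** Y)" "(- X) ** Y = - (X ** Y)" for X Y :: "real^'n^'n"
    by (simp_all add: matrix_matrix_mult_def vec_eq_iff sum_negf)
  have MB: "M ** B = - mat 1" and BM: "B ** M = - mat 1" using MT TM by (simp_all add: B_def neg)
  have "0 \<le> B$i$j" for i j
  proof -
    have "(B$i v* M)$j = (B ** M)$i$j" for j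
      by (simp add: vector_matrix_mult_def matrix_matrix_mult_def mult.commute)
    then have "\<forall>j. (B$i v* M)$j \<le> 0" by (simp add: BM mat_def)
    from metzler_left_monotone[OF M l this] show ?thesis by blast
  qed
  with MB BM show ?thesis by (auto simp: neg_inverse_def nonneg_mat_def)
qed

text \<open>An invertible matrix has no zero row, so a nonnegative one preserves strict
  positivity.\<close>

lemma neg_inverse_mv_pos:
  assumes B: "neg_inverse M B" and f: "\<forall>j. 0 < f$j"
  shows "0 < (B *v f)$i"
proof -
  have nn: "0 \<le> B$i$j" for j using B by (simp add: neg_inverse_def nonneg_mat_def)
  have "\<exists>j. B$i$j \<noteq> 0"
  proof (rule ccontr)
    assume "\<not> (\<exists>j. B$i$j \<noteq> 0)"
    then have "(B ** M)$i$i = 0" by (simp add: matrix_matrix_mult_def)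
    then show False using B by (simp add: neg_inverse_def mat_def)
  qed
  then obtain j where "0 < B$i$j" using nn by (metis less_eq_real_def)
  then have "0 < B$i$j * f$j" using f by simp
  also have "\<dots> \<le> (\<Sum>j\<in>UNIV. B$i$j * f$j)"
    using nn f by (intro member_le_sum) (auto simp: less_imp_le)
  finally show ?thesis by (simp add: matrix_vector_mult_def)
qed

lemma neg_transpose: "transpose (- X) = - transpose (X::real^'n^'m)"
  by (simp add: transpose_def vec_eq_iff)

lemma neg_inverse_transpose:
  assumes "neg_inverse M B" shows "neg_inverse (transpose M) (transpose B)"
  using assms by (auto simp: neg_inverse_def nonneg_mat_def neg_transpose
      simp flip: matrix_transpose_mul) (auto simp: transpose_def neg_transpose mat_def vec_eq_iff)

lemma neg_inverse_vm_pos: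
  assumes B: "neg_inverse M B" and f: "\<forall>j. 0 < f$j"
  shows "0 < (f v* B)$i"
  using neg_inverse_mv_pos[OF neg_inverse_transpose[OF B] f] by simp

lemma matrix_vector_uminus: "(- X) *v v = - (X *v (v::real^'n))"
  by (simp add: matrix_vector_mult_def vec_eq_iff sum_negf)

lemma vector_matrix_uminus: "v v* (- X) = - ((v::real^'n) v* X)"
  by (simp add: vector_matrix_mult_def vec_eq_iff sum_negf)

lemma neg_inverse_mv:
  assumes "neg_inverse M B" shows "M *v (B *v f) = - f"
  using assms by (simp_all add: neg_inverse_def matrix_vector_mul_assoc matrix_vector_uminus)

lemma neg_inverse_vm:
  assumes "neg_inverse M B" shows "(f v* B) v* M = - f"
  using assms by (simp_all add: neg_inverse_def vector_matrix_mul_assoc vector_matrix_uminus vector_matrix_mul_rid)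

text \<open>Finitely many strict inequalities leave a common slack. The certificates spend this
  slack on the multiple of the ones vector that makes their other inequalities strict.\<close>

lemma small_perturbation:
  fixes a b c :: "real^'m"
  assumes "\<forall>i. a$i < b$i"
  shows "\<exists>e>0. \<forall>i. a$i + e * c$i < b$i"
proof -
  have "\<forall>\<^sub>F e in at_right 0. a$i + e * c$i < b$i" for i
  proof -
    have "((\<lambda>e. a$i + e * c$i) \<longlongrightarrow> a$i + 0 * c$i) (at_right 0)"
      by (intro tendsto_intros)
    with assms show ?thesis by (intro order_tendstoD(2)[where y = "a$i + 0 * c$i"]) auto
  qed
  then have "\<forall>\<^sub>F e in at_right 0. \<forall>i. a$i + e * c$i < b$i"
    by (simp add: eventually_all_finite)
  moreover have "\<forall>\<^sub>F e in at_right (0::real). 0 < e"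
    by (simp add: eventually_at_right_less)
  ultimately have "\<forall>\<^sub>F e in at_right 0. 0 < e \<and> (\<forall>i. a$i + e * c$i < b$i)"
    by eventually_elim simp
  then show ?thesis by (metis (mono_tags, lifting) eventually_happens' trivial_limit_at_right_real)
qed

section \<open>Diagonal matrices and weighted quadratic forms\<close>

lemma diag_pd_mv: "diag_pd P \<Longrightarrow> (P *v x)$i = P$i$i * x$i"
proof -
  assume P: "diag_pd P"
  have "(P *v x)$i = (\<Sum>j\<in>UNIV. if j = i then P$i$i * x$i else 0)"
    unfolding matrix_vector_mult_def vec_lambda_beta
    using P by (intro sum.cong) (auto simp: diag_pd_def)
  then show ?thesis by simp
qed

lemma diag_pd_pos:
  assumes P: "diag_pd P" shows "0 < P$i$i"
proof -
  have "0 < axis i 1 \<bullet> (P *v axis i 1)"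
    using P by (auto simp: diag_pd_def axis_eq_0_iff)
  then show ?thesis by (simp add: inner_axis' diag_pd_mv[OF P])
qed

lemma diag_pd_transpose: "diag_pd P \<Longrightarrow> transpose P = P"
  by (auto simp: diag_pd_def transpose_def vec_eq_iff) metis

lemma diag_pd_diag:
  fixes p :: "real^'n"
  assumes "\<forall>i. 0 < p$i" shows "diag_pd (\<chi> i j. if i = j then p$i else 0)"
proof -
  have mv: "(\<chi> i j. if i = j then p$i else 0) *v x = (\<chi> i. p$i * x$i)" for x
    by (simp add: matrix_vector_mult_def vec_eq_iff if_distrib[of "\<lambda>y. y * _"] cong: if_cong)
  have "0 < x \<bullet> (\<chi> i. p$i * x$i)" if "x \<noteq> 0" for x
  proof -
    have "\<exists>k. x$k \<noteq> 0" using that by (metis vec_eq_iff zero_index)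
    then obtain k where "x$k \<noteq> 0" by blast
    then have "0 < p$k * (x$k)\<^sup>2" using assms by simp
    also have "\<dots> \<le> (\<Sum>i\<in>UNIV. p$i * (x$i)\<^sup>2)"
      using assms by (intro member_le_sum) (auto simp: less_imp_le)
    finally show ?thesis by (simp add: inner_vec_def power2_eq_square mult_ac)
  qed
  then show ?thesis by (simp add: diag_pd_def mv)
qed

text \<open>In use, \<open>r\<close> is the residual of a matrix block at a positive test vector
  \<open>\<alpha>\<close>; the weights \<open>r$j / \<alpha>$j\<close> turn it into a diagonal
  quadratic form. Linearity in \<open>r\<close> lets the residuals of separate blocks be
  added.\<close>

definition wform :: "real^'k \<Rightarrow> real^'k \<Rightarrow> real^'k \<Rightarrow> real" where
  "wform \<alpha> a r = (\<Sum>j\<in>UNIV. r$j / \<alpha>$j * (a$j)\<^sup>2)"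

lemma wform_add: "wform \<alpha> a (r + s) = wform \<alpha> a r + wform \<alpha> a s"
  by (simp add: wform_def add_divide_distrib distrib_right sum.distrib)

lemma wform_diff: "wform \<alpha> a (r - s) = wform \<alpha> a r - wform \<alpha> a s"
  by (simp add: wform_def diff_divide_distrib left_diff_distrib sum_subtractf)

lemma wform_scaleR: "wform \<alpha> a (c *\<^sub>R r) = c * wform \<alpha> a r"
  by (simp add: wform_def sum_distrib_left mult_ac)

lemma wform_sum: "wform \<alpha> a (\<Sum>i\<in>S. r i) = (\<Sum>i\<in>S. wform \<alpha> a (r i))"
  by (induction S rule: infinite_finite_induct) (simp_all add: wform_add, simp_all add: wform_def)

lemma wform_self:
  assumes "\<forall>j. 0 < \<alpha>$j" shows "wform \<alpha> a \<alpha> = a \<bullet> a"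
proof -
  have "\<alpha>$j / \<alpha>$j = 1" for j using assms by (simp add: less_imp_neq[symmetric])
  then show ?thesis by (simp add: wform_def inner_vec_def power2_eq_square)
qed

lemma wform_diag:
  assumes "diag_pd Q" "\<forall>j. 0 < \<alpha>$j" shows "wform \<alpha> a (Q *v \<alpha>) = a \<bullet> (Q *v a)"
proof -
  have "\<alpha>$j \<noteq> 0" for j using assms(2) by (simp add: less_imp_neq[symmetric])
  then show ?thesis
    by (simp add: wform_def inner_vec_def diag_pd_mv[OF assms(1)] power2_eq_square mult_ac)
qed

lemma wform_nonpos:
  assumes "\<forall>j. 0 < \<alpha>$j" "\<forall>j. r$j < 0" shows "wform \<alpha> a r \<le> 0"
  unfolding wform_def using assms
  by (intro sum_nonpos mult_nonpos_nonneg divide_nonpos_pos) (auto simp: less_imp_le)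

lemma wform_neg:
  assumes "\<forall>j. 0 < \<alpha>$j" "\<forall>j. r$j < 0" "a \<noteq> 0" shows "wform \<alpha> a r < 0"
proof -
  have "\<exists>k. a$k \<noteq> 0" using assms(3) by (metis vec_eq_iff zero_index)
  then obtain k where "a$k \<noteq> 0" by blast
  then have "r$k / \<alpha>$k * (a$k)\<^sup>2 < 0"
    using assms(1,2) by (intro mult_neg_pos divide_neg_pos) auto
  moreover have "(\<Sum>j\<in>UNIV - {k}. r$j / \<alpha>$j * (a$j)\<^sup>2) \<le> 0"
    using assms(1,2) by (intro sum_nonpos mult_nonpos_nonneg divide_nonpos_pos) (auto simp: less_imp_le)
  ultimately show ?thesis by (simp add: wform_def sum.remove[of UNIV k])
qed

text \<open>Young's inequality for each entry, with weight \<open>\<beta>$j / \<alpha>$i\<close> on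
  \<open>(a$i)\<^sup>2\<close> and its reciprocal on \<open>(b$j)\<^sup>2\<close>: the row sums then
  collect to \<open>M *v \<beta>\<close> and the column sums to
  \<open>\<alpha> v* M\<close>.\<close>

lemma bilinear_weighted_bound:
  fixes M :: "real^'b^'a"
  assumes M: "nonneg_mat M" and al: "\<forall>i. 0 < \<alpha>$i" and be: "\<forall>j. 0 < \<beta>$j"
  shows "2 * (a \<bullet> (M *v b)) \<le> wform \<alpha> a (M *v \<beta>) + wform \<beta> b (\<alpha> v* M)"
proof -
  have *: "2 * (p * q) \<le> s / r * p\<^sup>2 + r / s * q\<^sup>2" if "0 < r" "0 < s" for p q r s :: real
  proof -
    have "s / r * p\<^sup>2 + r / s * q\<^sup>2 - 2 * (p * q) = (s * p - r * q)\<^sup>2 / (r * s)"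
      using that by (simp add: field_simps power2_eq_square)
    also have "\<dots> \<ge> 0" using that by simp
    finally show ?thesis by simp
  qed
  have "2 * (a \<bullet> (M *v b)) = (\<Sum>i\<in>UNIV. \<Sum>j\<in>UNIV. M$i$j * (2 * (a$i * b$j)))"
    by (simp add: inner_vec_def matrix_vector_mult_def sum_distrib_left mult_ac)
  also have "\<dots> \<le> (\<Sum>i\<in>UNIV. \<Sum>j\<in>UNIV. M$i$j * (\<beta>$j / \<alpha>$i * (a$i)\<^sup>2 + \<alpha>$i / \<beta>$j * (b$j)\<^sup>2))"
    using M al be by (intro sum_mono mult_left_mono *) (auto simp: nonneg_mat_def)
  also have "\<dots> = (\<Sum>i\<in>UNIV. \<Sum>j\<in>UNIV. M$i$j * \<beta>$j / \<alpha>$i * (a$i)\<^sup>2) + (\<Sum>i\<in>UNIV. \<Sum>j\<in>UNIV. \<alpha>$i * M$i$j / \<beta>$j * (b$j)\<^sup>2)"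
    by (simp add: distrib_left sum.distrib mult_ac)
  also have "(\<Sum>i\<in>UNIV. \<Sum>j\<in>UNIV. \<alpha>$i * M$i$j / \<beta>$j * (b$j)\<^sup>2) = (\<Sum>j\<in>UNIV. \<Sum>i\<in>UNIV. \<alpha>$i * M$i$j / \<beta>$j * (b$j)\<^sup>2)"
    by (rule sum.swap)
  finally show ?thesis
    unfolding wform_def matrix_vector_mult_def vector_matrix_mult_def vec_lambda_beta sum_divide_distrib sum_distrib_right
    by (simp add: mult_ac)
qed

text \<open>The diagonal part contributes with equality whatever its sign, so Young's inequality is
  applied to the off-diagonal entries only.\<close>

lemma quadratic_weighted_bound:
  fixes M :: "real^'n^'n"
  assumes M: "metzler M" and al: "\<forall>i. 0 < \<alpha>$i"
  shows "2 * (a \<bullet> (M *v a)) \<le> wform \<alpha> a (M *v \<alpha> + \<alpha> v* M)"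
proof -
  define D where "D = (\<chi> i j. if i = j then M$i$i else 0)"
  define R where "R = (\<chi> i j. if i = j then 0 else M$i$j)"
  have MDR: "M = D + R" by (simp add: D_def R_def vec_eq_iff)
  have R: "nonneg_mat R" using M by (simp add: R_def nonneg_mat_def metzler_def)
  have D: "D *v x = (\<chi> i. M$i$i * x$i)" "x v* D = (\<chi> i. x$i * M$i$i)" for x
    by (simp_all add: D_def matrix_vector_mult_def vector_matrix_mult_def vec_eq_iff
        if_distrib[of "\<lambda>y. y * _"] if_distrib[of "\<lambda>y. _ * y"] cong: if_cong)
  have "2 * (a \<bullet> (D *v a)) = wform \<alpha> a (D *v \<alpha> + \<alpha> v* D)"
    unfolding wform_def D inner_vec_def sum_distrib_left
    using al by (intro sum.cong refl) (simp add: less_imp_neq[symmetric] power2_eq_square field_simps)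
  moreover note bilinear_weighted_bound[OF R al al, of a a]
  ultimately show ?thesis
    unfolding MDR by (simp add: matrix_vector_mult_add_rdistrib vector_matrix_mult_add_rdistrib
        inner_add_right wform_add)
qed

lemma Abar_mv:
  "Abar N hbar A *v x = A 0 *v x + (\<Sum>i\<in>{1..N}. hbar i *\<^sub>R (A i *v (x::real^'c)))"
proof -
  have "(\<Sum>i\<in>S. M i) *v y = (\<Sum>i\<in>S. M i *v y)" for M :: "nat \<Rightarrow> real^'c^'r" and y S
    by (induction S rule: infinite_finite_induct) (auto simp: matrix_vector_mult_add_rdistrib)
  then show ?thesis
    by (simp add: Abar_def matrix_vector_mult_add_rdistrib scaleR_matrix_vector_assoc)
qed

lemma Abar_vm:
  "x v* Abar N hbar A = x v* A 0 + (\<Sum>i\<in>{1..N}. hbar i *\<^sub>R ((x::real^'r) v* A i))"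
proof -
  have 1: "y v* (\<Sum>i\<in>S. M i) = (\<Sum>i\<in>S. y v* M i)" for M :: "nat \<Rightarrow> real^'c^'r" and y S
    by (induction S rule: infinite_finite_induct) (auto simp: vector_matrix_mult_add_rdistrib)
  have 2: "y v* (k *\<^sub>R M) = k *\<^sub>R (y v* M)" for k and M :: "real^'c^'r" and y
    by (simp add: vector_matrix_mult_def vec_eq_iff sum_distrib_left mult_ac)
  show ?thesis
    by (simp only: Abar_def vector_matrix_mult_add_rdistrib 1 2)
qed

lemma vm_add_smult: "((x::real^'n) + e *\<^sub>R y) v* M = x v* M + e *\<^sub>R (y v* M)"
  by (simp add: vector_matrix_mult_def vec_eq_iff sum_distrib_left sum.distrib algebra_simps)

lemma vm_smult: "(e *\<^sub>R (y::real^'n)) v* M = e *\<^sub>R (y v* M)"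
  by (simp add: vector_matrix_mult_def vec_eq_iff sum_distrib_left algebra_simps)

lemma mv_add_smult: "M *v ((x::real^'n) + e *\<^sub>R y) = M *v x + e *\<^sub>R (M *v y)"
  by (simp add: matrix_vector_mult_def vec_eq_iff sum_distrib_left sum.distrib algebra_simps)

text \<open>The pair replaces positive singular vectors: \<open>\<omega>\<close> satisfies
  \<open>G\<^sup>T G \<omega> < \<gamma>\<^sup>2 \<omega>\<close>, and \<open>\<eta>\<close> is
  essentially \<open>G \<omega> / \<gamma>\<close>. Such an \<open>\<omega>\<close> exists by
  Ville's alternative, because for the symmetric \<open>H\<close> the alternative \<open>p\<close>
  would give \<open>p \<bullet> (H *v p) \<ge> 0\<close> against the norm bound.\<close>

lemma gain_vectors:
  fixes G :: "real^'u^'y"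
  assumes G: "nonneg_mat G" and g: "0 \<le> g" "g < \<gamma>" and norm: "\<forall>u. norm (G *v u) \<le> g * norm u"
  shows "\<exists>\<omega> \<eta>. (\<forall>j. 0 < \<omega>$j) \<and> (\<forall>j. 0 < \<eta>$j) \<and> (\<forall>i. (G *v \<omega>)$i < \<gamma> * \<eta>$i) \<and> (\<forall>j. (\<eta> v* G)$j < \<gamma> * \<omega>$j)"
proof -
  define H where "H = transpose G ** G - \<gamma>\<^sup>2 *\<^sub>R mat 1"
  have Hv: "H *v x = (G *v x) v* G - \<gamma>\<^sup>2 *\<^sub>R x" for x
    by (simp add: H_def matrix_vector_mult_diff_rdistrib scaleR_matrix_vector_assoc[symmetric] matrix_vector_mul_assoc[symmetric])
  have "transpose H = H"
    by (simp add: H_def vec_eq_iff transpose_def matrix_matrix_mult_def mat_def mult.commute)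
  have "\<exists>l. (\<forall>j. 0 < l$j) \<and> (\<forall>i. (H *v l)$i < 0)"
  proof (rule ccontr)
    assume "\<not> ?thesis"
    then obtain p where p: "p \<noteq> 0" "\<forall>i. 0 \<le> p$i" "\<forall>j. 0 \<le> (p v* H)$j"
      using ville_alternative[of H] by blast
    have "0 \<le> p \<bullet> (p v* H)" unfolding inner_vec_def using p by (intro sum_nonneg) simp
    also have "p \<bullet> (p v* H) = p \<bullet> (H *v p)"
      using arg_cong[OF \<open>transpose H = H\<close>, of "\<lambda>M. p \<bullet> (M *v p)"] by simp
    also have "\<dots> = (norm (G *v p))\<^sup>2 - (\<gamma> * norm p)\<^sup>2"
      by (simp add: Hv inner_diff_right power_mult_distrib power2_norm_eq_inner dot_lmul_matrix
          inner_commute[of p "_ v* _"])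
    also have "\<dots> < 0"
    proof -
      have "norm (G *v p) \<le> g * norm p" using norm by blast
      also have "\<dots> < \<gamma> * norm p" using g p(1) by simp
      finally show ?thesis by (simp add: power_strict_mono)
    qed
    finally show False by simp
  qed
  then obtain \<omega> where om: "\<forall>j. 0 < \<omega>$j" and H: "\<forall>j. (H *v \<omega>)$j < 0" by blast
  have "\<forall>j. ((G *v \<omega>) v* G)$j < (\<gamma>\<^sup>2 *\<^sub>R \<omega>)$j" using H by (simp add: Hv)
  from small_perturbation[OF this, of "1 v* G"] obtain e where e: "0 < e"
    "\<forall>j. ((G *v \<omega>) v* G)$j + e * (1 v* G)$j < \<gamma>\<^sup>2 * \<omega>$j" by auto
  \<comment> \<open>\<open>G *v \<omega>\<close> may have zero entries; adding \<open>e\<close>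
    makes \<open>\<eta>\<close> positive and the first inequality strict, and \<open>e\<close> is
    small enough to keep the second.\<close>
  define \<eta> where "\<eta> = (1/\<gamma>) *\<^sub>R (G *v \<omega> + e *\<^sub>R 1)"
  have gp: "0 < \<gamma>" using g by simp
  have et: "\<gamma> *\<^sub>R \<eta> = G *v \<omega> + e *\<^sub>R 1" using gp by (simp add: \<eta>_def)
  have 1: "\<gamma> * \<eta>$j = (G *v \<omega>)$j + e" for j using arg_cong[OF et, of "\<lambda>v. v$j"] by simp
  have nn: "0 \<le> (G *v \<omega>)$i" for i using om by (intro nonneg_mat_mv G) (simp add: less_imp_le)
  have 2: "\<gamma> * (\<eta> v* G)$j = ((G *v \<omega>) v* G)$j + e * (1 v* G)$j" for j
    using arg_cong[OF et, of "\<lambda>v. (v v* G)$j"] by (simp add: vm_add_smult vm_smult)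
  have "0 < \<gamma> * \<eta>$j" for j using 1[of j] nn[of j] e(1) by simp
  then have "\<forall>j. 0 < \<eta>$j" using gp by (simp add: zero_less_mult_iff)
  moreover have "(\<eta> v* G)$j < \<gamma> * \<omega>$j" for j
  proof -
    have "\<gamma> * (\<eta> v* G)$j < \<gamma> * (\<gamma> * \<omega>$j)" using e(2) 2 by (simp add: power2_eq_square mult.assoc)
    then show ?thesis using gp by simp
  qed
  ultimately show ?thesis using om 1 e(1) by (intro exI[of _ \<omega>] exI[of _ \<eta>]) auto
qed

text \<open>Compactness of the unit sphere: the maximum of \<open>norm (G *v u)\<close> there is
  attained, hence below \<open>\<gamma>\<close>.\<close>

lemma strict_norm_bound_uniform:
  fixes G :: "real^'u^'y"
  assumes "\<And>u. u \<noteq> 0 \<Longrightarrow> norm (G *v u) < \<gamma> * norm u"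
  shows "\<exists>g. 0 \<le> g \<and> g < \<gamma> \<and> (\<forall>u. norm (G *v u) \<le> g * norm u)"
proof -
  have "continuous_on (sphere 0 1) (\<lambda>u. norm (G *v u))"
    by (intro continuous_on_norm linear_continuous_on matrix_vector_mul_bounded_linear)
  moreover have "sphere (0::real^'u) 1 \<noteq> {}" by simp
  ultimately obtain s where s: "s \<in> sphere 0 1" "\<And>u. u \<in> sphere 0 1 \<Longrightarrow> norm (G *v u) \<le> norm (G *v s)"
    using continuous_attains_sup[OF compact_sphere] by metis
  have "norm (G *v s) < \<gamma>" using assms[of s] s(1) by force
  moreover have "norm (G *v u) \<le> norm (G *v s) * norm u" for u
  proof (cases "u = 0")
    case False
    have "(1 / norm u) *\<^sub>R u \<in> sphere 0 1" using False by simp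
    from s(2)[OF this] have "norm (G *v u) / norm u \<le> norm (G *v s)"
      by (simp add: matrix_vector_mult_scaleR)
    with False show ?thesis by (simp add: field_simps)
  qed simp
  ultimately show ?thesis by (intro exI[of _ "norm (G *v s)"]) simp
qed

section \<open>Integral inequalities\<close>

abbreviation "cts \<equiv> continuous_on UNIV"

text \<open>Telescoping over a uniform partition adds the errors up to
  \<open>\<epsilon> * (\<mu> b - \<mu> a)\<close>, which vanishes with \<open>\<epsilon>\<close>. A
  general \<open>\<mu>\<close> allows errors to be measured by an integral instead of by elapsed
  time.\<close>

lemma le_if_locally_small_increase:
  fixes F \<mu> :: "real \<Rightarrow> real"
  assumes ab: "a \<le> b"
    and loc: "\<And>\<epsilon>. 0 < \<epsilon> \<Longrightarrow> \<exists>\<delta>>0. \<forall>s t. a \<le> s \<longrightarrow> s \<le> t \<longrightarrow> t \<le> b \<longrightarrow> t - s < \<delta> \<longrightarrow> F t - F s \<le> \<epsilon> * (\<mu> t - \<mu> s)"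
  shows "F b \<le> F a"
proof -
  have est: "F b \<le> F a + \<epsilon> * (\<mu> b - \<mu> a)" if e: "0 < \<epsilon>" for \<epsilon>
  proof -
    obtain \<delta> where d: "0 < \<delta>"
      "\<And>s t. a \<le> s \<Longrightarrow> s \<le> t \<Longrightarrow> t \<le> b \<Longrightarrow> t - s < \<delta> \<Longrightarrow> F t - F s \<le> \<epsilon> * (\<mu> t - \<mu> s)"
      using loc[OF e] by blast
    obtain n where n: "(b - a) / \<delta> < real n" using reals_Archimedean2 by blast
    then have n0: "0 < real n" using ab d(1) by (meson divide_nonneg_pos diff_ge_0_iff_ge le_less_trans)
    define w where "w = (b - a) / real n"
    have w: "0 \<le> w" "w < \<delta>" "real n * w = b - a"
      using n n0 ab d(1) by (simp_all add: w_def field_simps)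
    have "k \<le> n \<Longrightarrow> F (a + real k * w) \<le> F a + \<epsilon> * (\<mu> (a + real k * w) - \<mu> a)" for k
    proof (induction k)
      case (Suc k)
      have "real (Suc k) * w \<le> real n * w" using Suc.prems w(1) by (intro mult_right_mono) auto
      then have "F (a + real (Suc k) * w) - F (a + real k * w) \<le> \<epsilon> * (\<mu> (a + real (Suc k) * w) - \<mu> (a + real k * w))"
        using w by (intro d(2)) (auto simp: distrib_right)
      with Suc show ?case by (simp add: right_diff_distrib)
    qed simp
    from this[of n] show ?thesis using w(3) by simp
  qed
  show ?thesis
  proof (rule field_le_epsilon)
    fix e :: real assume e: "0 < e"
    define \<epsilon> where "\<epsilon> = e / (\<bar>\<mu> b - \<mu> a\<bar> + 1)"
    have "0 < \<epsilon>" using e by (simp add: \<epsilon>_def)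
    have "\<epsilon> * (\<mu> b - \<mu> a) \<le> \<epsilon> * (\<bar>\<mu> b - \<mu> a\<bar> + 1)" using \<open>0 < \<epsilon>\<close> by (intro mult_left_mono) auto
    also have "\<dots> = e" by (simp add: \<epsilon>_def)
    finally show "F b \<le> F a + e" using est[OF \<open>0 < \<epsilon>\<close>] by linarith
  qed
qed

lemma uniform_modulus:
  fixes f :: "real \<Rightarrow> real"
  assumes "continuous_on {a..b} f" "0 < e"
  obtains d where "0 < d" "\<And>s t. a \<le> s \<Longrightarrow> s \<le> b \<Longrightarrow> a \<le> t \<Longrightarrow> t \<le> b \<Longrightarrow> \<bar>t - s\<bar> < d \<Longrightarrow> \<bar>f t - f s\<bar> < e"
proof -
  have "uniformly_continuous_on {a..b} f"
    using assms(1) by (intro compact_uniformly_continuous) auto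
  then show ?thesis using assms(2) that
    unfolding uniformly_continuous_on_def dist_real_def by (metis atLeastAtMost_iff)
qed

lemma integrable_subinterval_Icc:
  fixes f :: "real \<Rightarrow> 'a::banach"
  shows "f integrable_on {a..b} \<Longrightarrow> a \<le> c \<Longrightarrow> d \<le> b \<Longrightarrow> f integrable_on {c..d}"
  by (rule integrable_on_subinterval) auto

lemma integral_increment:
  fixes f :: "real \<Rightarrow> 'a::banach"
  assumes "f integrable_on {a..b}" "a \<le> s" "s \<le> t" "t \<le> b"
  shows "integral {a..t} f - integral {a..s} f = integral {s..t} f"
  using Henstock_Kurzweil_Integration.integral_combine[of a s t f] assms
    integrable_subinterval_Icc[of f a b a t] by (simp add: algebra_simps)

text \<open>The weight \<open>1 + \<alpha> (t - s)\<close> multiplying \<open>f s\<close> over a short step is nonnegative, which makes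
  the step monotone in \<open>f s\<close> even for \<open>\<alpha> < 0\<close>.\<close>

lemma max_differential_inequality:
  fixes p q G :: "real \<Rightarrow> real"
  assumes ab: "a \<le> b" and cp: "continuous_on {a..b} p" and cq: "continuous_on {a..b} q"
    and G: "G integrable_on {a..b}"
    and p: "\<And>s t. a \<le> s \<Longrightarrow> s \<le> t \<Longrightarrow> t \<le> b \<Longrightarrow> p t - p s \<le> integral {s..t} (\<lambda>r. \<alpha> * p r + G r)"
    and q: "\<And>s t. a \<le> s \<Longrightarrow> s \<le> t \<Longrightarrow> t \<le> b \<Longrightarrow> q t - q s \<le> integral {s..t} (\<lambda>r. \<alpha> * q r + G r)"
  shows "max (p b) (q b) - max (p a) (q a) \<le> integral {a..b} (\<lambda>r. \<alpha> * max (p r) (q r) + G r)"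
proof -
  define m where "m = (\<lambda>r. max (p r) (q r))"
  have cm: "continuous_on {a..b} m" unfolding m_def by (intro continuous_on_max cp cq)
  have int: "(\<lambda>r. \<alpha> * f r) integrable_on {s..t}" if "continuous_on {a..b} f" "a \<le> s" "t \<le> b" for f s t
    using that by (intro integrable_continuous_interval continuous_intros) (auto intro: continuous_on_subset)
  have Gi: "G integrable_on {s..t}" if "a \<le> s" "t \<le> b" for s t
    using integrable_subinterval_Icc[OF G that] .
  have mGi: "(\<lambda>r. \<alpha> * m r + G r) integrable_on {a..b}"
    by (intro integrable_add int cm G) auto
  define F where "F = (\<lambda>t. m t - integral {a..t} (\<lambda>r. \<alpha> * m r + G r))"
  have "F b \<le> F a"
  proof (rule le_if_locally_small_increase[OF ab, where \<mu> = "\<lambda>t. t"])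
    fix \<epsilon> :: real assume e: "0 < \<epsilon>"
    \<comment> \<open>Each step freezes first the branch and then the maximum at its left endpoint;
      both errors are at most \<open>\<bar>\<alpha>\<bar> * e'\<close> times the step length, and
      this choice keeps their sum within \<open>\<epsilon>\<close>.\<close>
    define e' where "e' = \<epsilon> / (2 * (\<bar>\<alpha>\<bar> + 1))"
    have e': "0 < e'" using e by (simp add: e'_def)
    have "2 * (\<bar>\<alpha>\<bar> * e') \<le> 2 * ((\<bar>\<alpha>\<bar> + 1) * e')" using e' by simp
    also have "\<dots> = \<epsilon>" by (simp add: e'_def field_simps)
    finally have ae: "2 * (\<bar>\<alpha>\<bar> * e') \<le> \<epsilon>" .
    obtain d1 where d1: "0 < d1" "\<And>s t. a \<le> s \<Longrightarrow> s \<le> b \<Longrightarrow> a \<le> t \<Longrightarrow> t \<le> b \<Longrightarrow> \<bar>t - s\<bar> < d1 \<Longrightarrow> \<bar>p t - p s\<bar> < e'"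
      using uniform_modulus[OF cp e'] by metis
    obtain d2 where d2: "0 < d2" "\<And>s t. a \<le> s \<Longrightarrow> s \<le> b \<Longrightarrow> a \<le> t \<Longrightarrow> t \<le> b \<Longrightarrow> \<bar>t - s\<bar> < d2 \<Longrightarrow> \<bar>q t - q s\<bar> < e'"
      using uniform_modulus[OF cq e'] by metis
    obtain d3 where d3: "0 < d3" "\<And>s t. a \<le> s \<Longrightarrow> s \<le> b \<Longrightarrow> a \<le> t \<Longrightarrow> t \<le> b \<Longrightarrow> \<bar>t - s\<bar> < d3 \<Longrightarrow> \<bar>m t - m s\<bar> < e'"
      using uniform_modulus[OF cm e'] by metis
    \<comment> \<open>The last bound on the step length is the one that keeps
      \<open>1 + \<alpha> * (t - s)\<close> nonnegative.\<close>
    define d where "d = min (min d1 d2) (min d3 (1 / (\<bar>\<alpha>\<bar> + 1)))"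
    have d: "0 < d" using d1 d2 d3 by (simp add: d_def)
    show "\<exists>\<delta>>0. \<forall>s t. a \<le> s \<longrightarrow> s \<le> t \<longrightarrow> t \<le> b \<longrightarrow> t - s < \<delta> \<longrightarrow> F t - F s \<le> \<epsilon> * (t - s)"
    proof (intro exI[of _ d] conjI allI impI d)
      fix s t assume st: "a \<le> s" "s \<le> t" "t \<le> b" "t - s < d"
      have w: "0 \<le> 1 + \<alpha> * (t - s)"
      proof -
        have "\<bar>\<alpha>\<bar> * (t - s) \<le> \<bar>\<alpha>\<bar> * (1 / (\<bar>\<alpha>\<bar> + 1))" using st by (intro mult_left_mono) (auto simp: d_def)
        also have "\<dots> \<le> 1" by simp
        finally have "\<bar>\<alpha> * (t - s)\<bar> \<le> 1" using st by (simp add: abs_mult)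
        then show ?thesis by linarith
      qed
      have near: "\<bar>integral {s..t} (\<lambda>r. \<alpha> * f r) - \<alpha> * f s * (t - s)\<bar> \<le> \<bar>\<alpha>\<bar> * e' * (t - s)"
        if cf: "continuous_on {a..b} f" and mf: "\<And>r. s \<le> r \<Longrightarrow> r \<le> t \<Longrightarrow> \<bar>f r - f s\<bar> < e'" for f
      proof -
        have i: "(\<lambda>r. \<alpha> * f r - \<alpha> * f s) integrable_on {s..t}"
          using int[OF cf st(1,3)] by (intro integrable_diff) auto
        have "integral {s..t} (\<lambda>r. \<alpha> * f r - \<alpha> * f s) = integral {s..t} (\<lambda>r. \<alpha> * f r) - \<alpha> * f s * (t - s)"
          using int[OF cf st(1,3)] st(2) by (subst integral_diff) (auto simp: mult_ac)
        moreover have "norm (integral {s..t} (\<lambda>r. \<alpha> * f r - \<alpha> * f s)) \<le> integral {s..t} (\<lambda>r. \<bar>\<alpha>\<bar> * e')"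
        proof (rule integral_norm_bound_integral[OF i])
          fix r assume "r \<in> {s..t}"
          then have "\<bar>\<alpha>\<bar> * \<bar>f r - f s\<bar> \<le> \<bar>\<alpha>\<bar> * e'" using mf[of r] by (intro mult_left_mono) auto
          then show "norm (\<alpha> * f r - \<alpha> * f s) \<le> \<bar>\<alpha>\<bar> * e'" unfolding right_diff_distrib[symmetric] real_norm_def abs_mult .
        qed auto
        ultimately show ?thesis using st(2) by (simp add: mult_ac)
      qed
      have mnear: "\<alpha> * m s * (t - s) \<le> integral {s..t} (\<lambda>r. \<alpha> * m r) + \<bar>\<alpha>\<bar> * e' * (t - s)"
        using near[OF cm] st d3(2)[of s] by (smt (verit) d_def min_less_iff_conj)
      have step: "f t - m s \<le> integral {s..t} (\<lambda>r. \<alpha> * m r) + integral {s..t} G + \<epsilon> * (t - s)"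
        if cf: "continuous_on {a..b} f" and mf: "\<And>r. s \<le> r \<Longrightarrow> r \<le> t \<Longrightarrow> \<bar>f r - f s\<bar> < e'"
          and f: "f t - f s \<le> integral {s..t} (\<lambda>r. \<alpha> * f r + G r)" and fm: "f s \<le> m s" for f
      proof -
        have "f t \<le> f s + integral {s..t} (\<lambda>r. \<alpha> * f r) + integral {s..t} G"
          using f integral_add[OF int[OF cf st(1,3)] Gi[OF st(1,3)]] by simp
        also have "integral {s..t} (\<lambda>r. \<alpha> * f r) \<le> \<alpha> * f s * (t - s) + \<bar>\<alpha>\<bar> * e' * (t - s)"
          using near[OF cf mf] by linarith
        finally have "f t \<le> f s * (1 + \<alpha> * (t - s)) + \<bar>\<alpha>\<bar> * e' * (t - s) + integral {s..t} G"
          by (simp add: algebra_simps)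
        also have "f s * (1 + \<alpha> * (t - s)) \<le> m s * (1 + \<alpha> * (t - s))" using fm w by (rule mult_right_mono)
        finally have "f t - m s \<le> \<alpha> * m s * (t - s) + \<bar>\<alpha>\<bar> * e' * (t - s) + integral {s..t} G"
          by (simp add: algebra_simps)
        also have "\<dots> \<le> integral {s..t} (\<lambda>r. \<alpha> * m r) + 2 * (\<bar>\<alpha>\<bar> * e') * (t - s) + integral {s..t} G"
          using mnear by (simp add: algebra_simps)
        also have "2 * (\<bar>\<alpha>\<bar> * e') * (t - s) \<le> \<epsilon> * (t - s)" using ae st(2) by (intro mult_right_mono) auto
        finally show ?thesis by simp
      qed
      have "p t - m s \<le> integral {s..t} (\<lambda>r. \<alpha> * m r) + integral {s..t} G + \<epsilon> * (t - s)"
        using st by (intro step cp p d1(2)) (auto simp: m_def d_def)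
      moreover have "q t - m s \<le> integral {s..t} (\<lambda>r. \<alpha> * m r) + integral {s..t} G + \<epsilon> * (t - s)"
        using st by (intro step cq q d2(2)) (auto simp: m_def d_def)
      ultimately have "m t - m s \<le> integral {s..t} (\<lambda>r. \<alpha> * m r + G r) + \<epsilon> * (t - s)"
        using integral_add[OF int[OF cm st(1,3)] Gi[OF st(1,3)]] by (simp add: m_def)
      moreover have "F t - F s = m t - m s - integral {s..t} (\<lambda>r. \<alpha> * m r + G r)"
        using integral_increment[OF mGi st(1-3)] by (simp add: F_def)
      ultimately show "F t - F s \<le> \<epsilon> * (t - s)" by simp
    qed
  qed
  then show ?thesis by (simp add: F_def m_def)
qed

text \<open>In place of the chain rule, the difference of squares factors as
  \<open>(v t + v s) * (v t - v s)\<close>; the first factor is nonnegative and close to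
  \<open>2 * v r\<close> on a short step. As \<open>G\<close> may be unbounded, the error is charged
  to the integral of \<open>\<bar>G r\<bar>\<close>, whence the absolute integrability.\<close>

lemma square_differential_inequality:
  fixes v G :: "real \<Rightarrow> real"
  assumes ab: "a \<le> b" and cv: "continuous_on {a..b} v" and v0: "\<And>t. a \<le> t \<Longrightarrow> t \<le> b \<Longrightarrow> 0 \<le> v t"
    and G: "G absolutely_integrable_on {a..b}"
    and v: "\<And>s t. a \<le> s \<Longrightarrow> s \<le> t \<Longrightarrow> t \<le> b \<Longrightarrow> v t - v s \<le> integral {s..t} G"
  shows "(\<lambda>r. 2 * v r * G r) integrable_on {a..b}"
    "(v b)\<^sup>2 - (v a)\<^sup>2 \<le> integral {a..b} (\<lambda>r. 2 * v r * G r)"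
proof -
  have "(\<lambda>r. (2 * v r) * G r) absolutely_integrable_on {a..b}"
  proof (rule absolutely_integrable_bounded_measurable_product_real[OF _ _ _ G])
    have c2: "continuous_on {a..b} (\<lambda>r. 2 * v r)" by (intro continuous_intros cv)
    show "(\<lambda>r. 2 * v r) \<in> borel_measurable (lebesgue_on {a..b})"
      using c2 by (intro continuous_imp_measurable_on_sets_lebesgue) auto
    show "bounded ((\<lambda>r. 2 * v r) ` {a..b})"
      by (intro compact_imp_bounded compact_continuous_image c2) auto
  qed auto
  then show vG: "(\<lambda>r. 2 * v r * G r) integrable_on {a..b}"
    by (rule set_lebesgue_integral_eq_integral)
  have Gi: "G integrable_on {a..b}" and Gn: "(\<lambda>r. \<bar>G r\<bar>) integrable_on {a..b}"
    using G by (auto simp: absolutely_integrable_on_def)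
  define F where "F = (\<lambda>t. (v t)\<^sup>2 - integral {a..t} (\<lambda>r. 2 * v r * G r))"
  have "F b \<le> F a"
  proof (rule le_if_locally_small_increase[OF ab, where \<mu> = "\<lambda>t. integral {a..t} (\<lambda>r. \<bar>G r\<bar>)"])
    fix \<epsilon> :: real assume e: "0 < \<epsilon>"
    then have "0 < \<epsilon> / 2" by simp
    then obtain d where d: "0 < d" "\<And>s t. a \<le> s \<Longrightarrow> s \<le> b \<Longrightarrow> a \<le> t \<Longrightarrow> t \<le> b \<Longrightarrow> \<bar>t - s\<bar> < d \<Longrightarrow> \<bar>v t - v s\<bar> < \<epsilon> / 2"
      using uniform_modulus[OF cv] by metis
    show "\<exists>\<delta>>0. \<forall>s t. a \<le> s \<longrightarrow> s \<le> t \<longrightarrow> t \<le> b \<longrightarrow> t - s < \<delta> \<longrightarrow>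
        F t - F s \<le> \<epsilon> * (integral {a..t} (\<lambda>r. \<bar>G r\<bar>) - integral {a..s} (\<lambda>r. \<bar>G r\<bar>))"
    proof (intro exI[of _ d] conjI allI impI d(1))
      fix s t assume st: "a \<le> s" "s \<le> t" "t \<le> b" "t - s < d"
      note sub = integrable_subinterval_Icc[OF _ st(1,3)]
      have "(v t)\<^sup>2 - (v s)\<^sup>2 = (v t + v s) * (v t - v s)" by (simp add: power2_eq_square algebra_simps)
      also have "\<dots> \<le> (v t + v s) * integral {s..t} G"
        using st v0[of t] v0[of s] v by (intro mult_left_mono) auto
      also have "\<dots> = integral {s..t} (\<lambda>r. (v t + v s) * G r)" by simp
      also have "\<dots> \<le> integral {s..t} (\<lambda>r. 2 * v r * G r + \<epsilon> * \<bar>G r\<bar>)"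
      proof (rule integral_le)
        show "(\<lambda>r. (v t + v s) * G r) integrable_on {s..t}" using sub[OF Gi] by (rule integrable_on_mult_right)
        show "(\<lambda>r. 2 * v r * G r + \<epsilon> * \<bar>G r\<bar>) integrable_on {s..t}"
          using sub[OF vG] sub[OF Gn] by (intro integrable_add integrable_on_mult_right)
        fix r assume r: "r \<in> {s..t}"
        have "\<bar>v t - v r\<bar> < \<epsilon> / 2" "\<bar>v s - v r\<bar> < \<epsilon> / 2"
          using r st d(2)[of r t] d(2)[of r s] by auto
        then have "\<bar>v t + v s - 2 * v r\<bar> \<le> \<epsilon>" by linarith
        then have "\<bar>(v t + v s - 2 * v r) * G r\<bar> \<le> \<epsilon> * \<bar>G r\<bar>"
          unfolding abs_mult by (intro mult_right_mono) auto
        then have "(v t + v s - 2 * v r) * G r \<le> \<epsilon> * \<bar>G r\<bar>" by linarith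
        then show "(v t + v s) * G r \<le> 2 * v r * G r + \<epsilon> * \<bar>G r\<bar>" by (simp add: algebra_simps)
      qed
      also have "\<dots> = integral {s..t} (\<lambda>r. 2 * v r * G r) + \<epsilon> * integral {s..t} (\<lambda>r. \<bar>G r\<bar>)"
        using sub[OF vG] integrable_on_mult_right[OF sub[OF Gn], of \<epsilon>] by (subst integral_add) auto
      finally show "F t - F s \<le> \<epsilon> * (integral {a..t} (\<lambda>r. \<bar>G r\<bar>) - integral {a..s} (\<lambda>r. \<bar>G r\<bar>))"
        using integral_increment[OF vG st(1-3)] integral_increment[OF Gn st(1-3)] by (simp add: F_def)
    qed
  qed
  then show "(v b)\<^sup>2 - (v a)\<^sup>2 \<le> integral {a..b} (\<lambda>r. 2 * v r * G r)" by (simp add: F_def)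
qed

lemma gronwall_zero:
  fixes f :: "real \<Rightarrow> real"
  assumes cf: "continuous_on {0..T} f" and f0: "\<And>t. 0 \<le> t \<Longrightarrow> t \<le> T \<Longrightarrow> 0 \<le> f t"
    and f: "\<And>t. 0 \<le> t \<Longrightarrow> t \<le> T \<Longrightarrow> f t \<le> K * integral {0..t} f" and T: "0 \<le> T"
  shows "f T = 0"
proof (cases "T = 0")
  case True then show ?thesis using f[of 0] f0[of 0] by simp
next
  case False
  then have Tp: "0 < T" using T by simp
  define H where "H = (\<lambda>t. exp (- K * t) * integral {0..t} f)"
  have fi: "f integrable_on {0..T}" using cf by (rule integrable_continuous_interval)
  have "H T \<le> H 0"
  proof (rule DERIV_nonpos_imp_decreasing_open[OF T])
    fix t assume t: "0 < t" "t < T"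
    have "((\<lambda>x. integral {0..x} f) has_real_derivative f t) (at t within {0..T})"
      using t by (intro integral_has_real_derivative cf) auto
    then have "((\<lambda>x. integral {0..x} f) has_real_derivative f t) (at t)"
      using t by (simp add: at_within_Icc_at)
    then have "(H has_real_derivative (exp (- K * t) * (f t - K * integral {0..t} f))) (at t)"
      unfolding H_def by (auto intro!: derivative_eq_intros simp: algebra_simps)
    moreover have "exp (- K * t) * (f t - K * integral {0..t} f) \<le> 0"
      using f[of t] t by (intro mult_nonneg_nonpos) auto
    ultimately show "\<exists>y. (H has_real_derivative y) (at t) \<and> y \<le> 0" by blast
  next
    show "continuous_on {0..T} H"
      unfolding H_def by (intro continuous_intros indefinite_integral_continuous_1 fi)
  qed
  then have "integral {0..T} f \<le> 0" by (simp add: H_def mult_le_0_iff)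
  moreover have "0 \<le> integral {0..T} f" using f0 fi by (intro integral_nonneg) auto
  ultimately show ?thesis using f[of T] f0[of T] T by simp
qed

section \<open>Integrals over sliding windows\<close>

lemma window_integral_continuous:
  fixes v :: "real \<Rightarrow> 'a::banach"
  assumes v: "cts v"
  shows "cts (\<lambda>t. integral {t - h..t} v)"
proof -
  have "cts (\<lambda>t. integral (cbox (-h) 0) (\<lambda>r. v (r + t)))"
    by (rule integral_continuous_on_param)
       (auto intro!: continuous_on_compose2[OF v] continuous_intros simp: split_beta)
  moreover have "integral (cbox (-h) 0) (\<lambda>r. v (r + t)) = integral {t - h..t} v" for t
    using integral_shift_real_ivl[where f = v and a = "t - h" and b = t and c = t] by simp
  ultimately show ?thesis by simp
qed

context
  fixes v :: "real \<Rightarrow> real" and h T :: real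
  assumes v: "cts v" and v0: "\<And>t. - h \<le> t \<Longrightarrow> 0 \<le> v t" and h: "0 \<le> h" and T: "0 \<le> T"
begin

private definition "W t = integral {-h..t} v"

private lemma vi: "v integrable_on {a..b}"
  using v by (intro integrable_continuous_interval) (auto intro: continuous_on_subset)

private lemma Wi: "- h \<le> a \<Longrightarrow> W integrable_on {a..b}"
  unfolding W_def
  by (intro integrable_continuous_interval continuous_on_subset[OF indefinite_integral_continuous_1[OF vi[of "-h" b]]]) auto

private lemma W_diff: "- h \<le> s \<Longrightarrow> s \<le> t \<Longrightarrow> W t - W s = integral {s..t} v"
  unfolding W_def using integral_increment[OF vi, of "-h" s t t] by simp

text \<open>A window is a difference of two values of the primitive \<open>W\<close>. Shifting the
  second one by \<open>h\<close> cancels the common part of the time integral and leaves two strips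
  of width \<open>h\<close>.\<close>

private lemma double: "integral {0..T} (\<lambda>t. integral {t - h..t} v) = integral {T - h..T} W - integral {-h..0} W"
proof -
  have shift: "((\<lambda>t. W (t + (- h))) has_integral integral {-h..T-h} W) {0..T}"
    using has_integral_shift_real_ivl[OF integrable_integral[OF Wi[of "-h" "T-h"]], of "-h"] by simp
  have "integral {0..T} (\<lambda>t. integral {t - h..t} v) = integral {0..T} (\<lambda>t. W t - W (t + (- h)))"
    using h by (intro integral_cong) (auto simp: W_diff)
  also have "\<dots> = integral {0..T} W - integral {-h..T-h} W"
    using shift h by (intro integral_unique has_integral_diff integrable_integral Wi) auto
  also have "\<dots> = integral {T - h..T} W - integral {-h..0} W"
    using Henstock_Kurzweil_Integration.integral_combine[of "-h" 0 T W]
      Henstock_Kurzweil_Integration.integral_combine[of "-h" "T-h" T W] Wi[of "-h" T] h T by simp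
  finally show ?thesis .
qed

private lemma W_nonneg: "0 \<le> W t"
  unfolding W_def using v0 by (intro integral_nonneg vi) auto

text \<open>On the last strip \<open>W\<close> is at most \<open>W T\<close>, and the first strip
  only helps. Integrated over time, a window thus costs the factor \<open>h\<close> plus a
  contribution of the history.\<close>

lemma window_double_integral_le:
  "integral {0..T} (\<lambda>t. integral {t - h..t} v) \<le> h * (integral {-h..0} v + integral {0..T} v)"
proof -
  have "integral {T - h..T} W \<le> integral {T - h..T} (\<lambda>_. W T)"
  proof (rule integral_le)
    fix t assume t: "t \<in> {T - h..T}"
    have "0 \<le> integral {t..T} v" using v0 t T h by (intro integral_nonneg vi) auto
    then show "W t \<le> W T" using W_diff[of t T] t T by simp
  qed (use T in \<open>auto intro!: Wi\<close>)
  moreover have "0 \<le> integral {-h..0} W" by (intro integral_nonneg Wi W_nonneg) auto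
  moreover have "W T = integral {-h..0} v + integral {0..T} v"
    unfolding W_def using h T vi by (intro Henstock_Kurzweil_Integration.integral_combine[symmetric]) auto
  ultimately show ?thesis using h by (simp add: double)
qed

text \<open>On the last strip \<open>W\<close> falls short of \<open>W T\<close> by at most
  \<open>h * M\<close>, so the loss against the factor \<open>h\<close> does not depend on
  \<open>T\<close>.\<close>

lemma window_double_integral_ge:
  assumes z: "\<And>t. - h \<le> t \<Longrightarrow> t \<le> 0 \<Longrightarrow> v t = 0" and M: "\<And>t. 0 \<le> t \<Longrightarrow> t \<le> T \<Longrightarrow> v t \<le> M" and M0: "0 \<le> M"
  shows "h * integral {0..T} v - h * (h * M) \<le> integral {0..T} (\<lambda>t. integral {t - h..t} v)"
proof -
  have "integral {T - h..T} (\<lambda>_. W T - h * M) \<le> integral {T - h..T} W"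
  proof (rule integral_le)
    fix t assume t: "t \<in> {T - h..T}"
    have "integral {t..T} v \<le> integral {t..T} (\<lambda>_. M)"
    proof (rule integral_le)
      fix x assume "x \<in> {t..T}"
      then show "v x \<le> M" using z[of x] M[of x] M0 t T by (cases "x \<le> 0") auto
    qed (auto intro: vi)
    also have "\<dots> \<le> h * M" using t M0 by (auto intro!: mult_right_mono)
    finally show "W T - h * M \<le> W t" using W_diff[of t T] t T by simp
  qed (use T in \<open>auto intro!: Wi\<close>)
  moreover have "W t = 0" if "t \<in> {-h..0}" for t
  proof -
    have "integral {-h..t} v = integral {-h..t} (\<lambda>_. 0)"
      using that by (intro integral_cong z) auto
    then show ?thesis by (simp add: W_def)
  qed
  then have "integral {-h..0} W = integral {-h..0} (\<lambda>_. 0)" by (intro integral_cong)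
  moreover have "W T = integral {-h..0} v + integral {0..T} v"
    unfolding W_def using h T vi by (intro Henstock_Kurzweil_Integration.integral_combine[symmetric]) auto
  moreover have "integral {-h..0} v = integral {-h..0} (\<lambda>_. 0)"
    using z by (intro integral_cong) auto
  ultimately show ?thesis using h by (simp add: double algebra_simps)
qed

end

text \<open>The variance of \<open>v\<close> about its window mean \<open>c\<close> is
  nonnegative.\<close>

lemma window_jensen:
  fixes v :: "real \<Rightarrow> real"
  assumes v: "cts v" and h: "0 < h"
  shows "(integral {t - h..t} v / h)\<^sup>2 \<le> integral {t - h..t} (\<lambda>s. (v s)\<^sup>2) / h"
proof -
  define c where "c = integral {t - h..t} v / h"
  have vi: "v integrable_on {t-h..t}" and v2: "(\<lambda>s. (v s)\<^sup>2) integrable_on {t-h..t}"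
    using v by (auto intro!: integrable_continuous_interval continuous_intros intro: continuous_on_subset)
  have "0 \<le> integral {t-h..t} (\<lambda>s. (v s - c)\<^sup>2)"
    using v by (intro integral_nonneg integrable_continuous_interval continuous_intros) (auto intro: continuous_on_subset)
  also have "integral {t-h..t} (\<lambda>s. (v s - c)\<^sup>2) = integral {t-h..t} (\<lambda>s. (v s)\<^sup>2 - 2 * c * v s + c\<^sup>2)"
    by (intro integral_cong) (simp add: power2_eq_square algebra_simps)
  also have "\<dots> = integral {t-h..t} (\<lambda>s. (v s)\<^sup>2) - 2 * c * integral {t-h..t} v + c\<^sup>2 * h"
  proof -
    have cv: "(\<lambda>s. 2 * c * v s) integrable_on {t-h..t}" using vi by (rule integrable_on_mult_right)
    have "((\<lambda>s. (v s)\<^sup>2 - 2 * c * v s + c\<^sup>2) has_integral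
        integral {t-h..t} (\<lambda>s. (v s)\<^sup>2) - 2 * c * integral {t-h..t} v + (t - (t - h)) *\<^sub>R c\<^sup>2) {t-h..t}"
      using h v2 vi by (intro has_integral_add has_integral_diff has_integral_mult_right
          integrable_integral has_integral_const_real[of "c\<^sup>2" "t-h" t, simplified, THEN has_integral_eq_rhs]) auto
    then show ?thesis by (simp add: integral_unique mult.commute)
  qed
  also have "integral {t-h..t} v = c * h" using h by (simp add: c_def)
  finally have "c\<^sup>2 * h \<le> integral {t-h..t} (\<lambda>s. (v s)\<^sup>2)" by (simp add: power2_eq_square algebra_simps)
  then show ?thesis using h by (simp add: c_def[symmetric] field_simps)
qed

text \<open>A bound on upward speed suffices: if \<open>v t \<ge> \<eta>\<close>, then
  \<open>v \<ge> \<eta> / 2\<close> on the interval of length \<open>\<delta>\<close> before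
  \<open>t\<close>, which adds \<open>\<delta> * (\<eta> / 2)\<close> to the integral. A bounded
  increasing integral has no room for this at late times. Subsolutions provide only such one-sided
  bounds.\<close>

lemma barbalat_onesided:
  fixes v :: "real \<Rightarrow> real"
  assumes v: "continuous_on {0..} v" and v0: "\<And>t. 0 \<le> t \<Longrightarrow> 0 \<le> v t" and M: "0 < M"
    and lip: "\<And>s t. 0 \<le> s \<Longrightarrow> s \<le> t \<Longrightarrow> v t - v s \<le> M * (t - s)"
    and c: "\<And>T. 0 \<le> T \<Longrightarrow> integral {0..T} v \<le> c"
  shows "(v \<longlongrightarrow> 0) at_top"
proof (rule tendstoI)
  fix \<eta> :: real assume eta: "0 < \<eta>"
  have vi: "v integrable_on {a..b}" if "0 \<le> a" for a b
    using v that by (intro integrable_continuous_interval) (auto intro: continuous_on_subset)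
  define I where "I = (\<lambda>T. integral {0..T} v)"
  have I_diff: "I t - I s = integral {s..t} v" if "0 \<le> s" "s \<le> t" for s t
    unfolding I_def using that vi by (intro integral_increment) auto
  have bdd: "bdd_above (I ` {0..})" using c by (intro bdd_aboveI2[of _ _ c]) (simp add: I_def)
  define L where "L = (SUP T\<in>{0..}. I T)"
  define \<delta> where "\<delta> = \<eta> / (2 * M)"
  have d: "0 < \<delta>" "M * \<delta> = \<eta> / 2" using eta M by (simp_all add: \<delta>_def)
  have "\<exists>T\<in>{0..}. L - \<delta> * (\<eta> / 2) < I T"
    unfolding L_def using bdd d eta by (subst less_cSUP_iff[symmetric]) auto
  then obtain T1 where T1: "0 \<le> T1" "L - \<delta> * (\<eta> / 2) < I T1" by auto
  have "v t < \<eta>" if t: "T1 + \<delta> \<le> t" for t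
  proof (rule ccontr)
    assume "\<not> v t < \<eta>"
    then have vt: "\<eta> \<le> v t" by simp
    have "\<delta> * (\<eta> / 2) = integral {t - \<delta>..t} (\<lambda>_. \<eta> / 2)" using d by simp
    also have "\<dots> \<le> integral {t - \<delta>..t} v"
    proof (rule integral_le)
      fix s assume s: "s \<in> {t - \<delta>..t}"
      have "v t - v s \<le> M * (t - s)" using s t T1 by (intro lip) auto
      also have "\<dots> \<le> M * \<delta>" using s M by (intro mult_left_mono) auto
      finally show "\<eta> / 2 \<le> v s" using vt d by simp
    qed (use t T1 in \<open>auto intro!: vi\<close>)
    also have "\<dots> = I t - I (t - \<delta>)" using t T1 d by (intro I_diff[symmetric]) auto
    finally have "\<delta> * (\<eta> / 2) \<le> I t - I (t - \<delta>)" .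
    moreover have "I t \<le> L" unfolding L_def using bdd t T1 d by (intro cSUP_upper) auto
    moreover have "I T1 \<le> I (t - \<delta>)"
    proof -
      have "0 \<le> integral {T1..t - \<delta>} v" using T1 by (intro integral_nonneg vi v0) auto
      then show ?thesis using I_diff[of T1 "t - \<delta>"] T1 t by simp
    qed
    ultimately show False using T1(2) by simp
  qed
  moreover have "0 \<le> v t" if "T1 + \<delta> \<le> t" for t using that T1 d by (intro v0) auto
  ultimately show "\<forall>\<^sub>F t in at_top. dist (v t) 0 < \<eta>"
    unfolding eventually_at_top_linorder by (intro exI[of _ "T1 + \<delta>"]) auto
qed

section \<open>Integrals over the half line and measurability\<close>

lemma nn_integral_Icc:
  fixes f :: "real \<Rightarrow> real"
  assumes f: "f \<in> borel_measurable borel" "\<And>t. a \<le> t \<Longrightarrow> t \<le> b \<Longrightarrow> 0 \<le> f t" and i: "f integrable_on {a..b}"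
  shows "(\<integral>\<^sup>+t\<in>{a..b}. ennreal (f t) \<partial>lborel) = ennreal (integral {a..b} f)"
proof -
  have m: "(\<lambda>t. if t \<in> {a..b} then f t else 0) \<in> borel_measurable borel"
    using f(1) by (intro measurable_If_set) auto
  have hi: "((\<lambda>t. if t \<in> {a..b} then f t else 0) has_integral integral {a..b} f) UNIV"
    unfolding has_integral_restrict_UNIV using i by (rule integrable_integral)
  have "(\<integral>\<^sup>+t. ennreal (if t \<in> {a..b} then f t else 0) \<partial>lborel) = ennreal (integral {a..b} f)"
    using f(2) by (intro nn_integral_has_integral_lborel m hi) auto
  also have "(\<integral>\<^sup>+t. ennreal (if t \<in> {a..b} then f t else 0) \<partial>lborel) = (\<integral>\<^sup>+t\<in>{a..b}. ennreal (f t) \<partial>lborel)"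
    by (intro nn_integral_cong) (auto simp: indicator_def)
  finally show ?thesis .
qed

abbreviation ray_integral :: "(real \<Rightarrow> real) \<Rightarrow> ennreal" where
  "ray_integral f \<equiv> \<integral>\<^sup>+t\<in>{0..}. ennreal (f t) \<partial>lborel"

lemma nn_integral_Ici_le:
  fixes f :: "real \<Rightarrow> real"
  assumes f: "f \<in> borel_measurable borel" "\<And>t. 0 \<le> t \<Longrightarrow> 0 \<le> f t"
    and i: "\<And>T. 0 \<le> T \<Longrightarrow> f integrable_on {0..T}" and c: "\<And>T. 0 \<le> T \<Longrightarrow> ennreal (integral {0..T} f) \<le> c"
  shows "ray_integral f \<le> c"
proof -
  \<comment> \<open>The half line is exhausted by \<open>{0..real n}\<close>, and continuity from
    below of the measure with density \<open>f\<close> passes the bound to the limit.\<close>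
  let ?D = "density lborel (\<lambda>t. ennreal (f t))"
  have em: "emeasure ?D S = (\<integral>\<^sup>+t\<in>S. ennreal (f t) \<partial>lborel)" if "S \<in> sets borel" for S
    using that f(1) by (simp add: emeasure_density)
  have "(\<Union>n. {0..real n}) = {0..}"
    by (auto intro: real_arch_simple)
  then have "emeasure ?D {0..} = (SUP n. emeasure ?D {0..real n})"
    by (subst SUP_emeasure_incseq) (auto simp: incseq_def)
  also have "\<dots> \<le> c"
  proof (rule SUP_least)
    fix n
    have "emeasure ?D {0..real n} = ennreal (integral {0..real n} f)"
      using f i by (simp add: em nn_integral_Icc)
    then show "emeasure ?D {0..real n} \<le> c" using c[of "real n"] by simp
  qed
  finally show ?thesis by (simp add: em)
qed

lemma nn_integral_Ici_finite:
  fixes f :: "real \<Rightarrow> real"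
  assumes f: "f \<in> borel_measurable borel" "\<And>t. 0 \<le> f t" and fin: "ray_integral f < \<infinity>"
  shows "f integrable_on {0..T}" "ennreal (integral {0..T} f) \<le> ray_integral f"
proof -
  have m: "(\<lambda>t. if t \<in> {0..T} then f t else 0) \<in> borel_measurable borel"
    using f(1) by (intro measurable_If_set) auto
  have le: "(\<integral>\<^sup>+t\<in>{0..T}. ennreal (f t) \<partial>lborel) \<le> ray_integral f"
    by (intro nn_integral_mono) (auto simp: indicator_def)
  have "(\<lambda>t. if t \<in> {0..T} then f t else 0) integrable_on UNIV"
  proof (rule nn_integral_integrable_on[OF m])
    have "(\<integral>\<^sup>+t. ennreal (if t \<in> {0..T} then f t else 0) \<partial>lborel) = (\<integral>\<^sup>+t\<in>{0..T}. ennreal (f t) \<partial>lborel)"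
      by (intro nn_integral_cong) (auto simp: indicator_def)
    then show "(\<integral>\<^sup>+t. ennreal (if t \<in> {0..T} then f t else 0) \<partial>lborel) < \<infinity>"
      using le fin by simp
  qed (use f(2) in auto)
  then show i: "f integrable_on {0..T}" unfolding integrable_restrict_UNIV .
  show "ennreal (integral {0..T} f) \<le> ray_integral f"
    using le nn_integral_Icc[OF f(1) _ i] f(2) by simp
qed

text \<open>Passage from finite-horizon estimates to gains. \<open>y\<close> is the output, about
  whose measurability nothing is known for arbitrary delay functions; it enters only through the
  pointwise comparison with the measurable majorant \<open>f\<close>.\<close>

lemma ray_integral_gain_le:
  fixes f w y :: "real \<Rightarrow> real"
  assumes f: "f \<in> borel_measurable borel" "\<And>t. 0 \<le> f t" and w: "w \<in> borel_measurable borel" "\<And>t. 0 \<le> w t"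
    and fin: "ray_integral w < \<infinity>" and c: "0 \<le> c" and y: "\<And>t. 0 \<le> t \<Longrightarrow> y t \<le> f t"
    and fi: "\<And>T. 0 \<le> T \<Longrightarrow> f integrable_on {0..T}"
    and fw: "\<And>T. 0 \<le> T \<Longrightarrow> integral {0..T} f \<le> c * integral {0..T} w"
  shows "ray_integral y \<le> ennreal c * ray_integral w"
proof -
  have "ray_integral y \<le> ray_integral f"
    using y by (intro nn_integral_mono) (auto simp: indicator_def intro: ennreal_leI)
  also have "\<dots> \<le> ennreal c * ray_integral w"
  proof (rule nn_integral_Ici_le[OF f(1)])
    fix T :: real assume T: "0 \<le> T"
    have "ennreal (integral {0..T} f) \<le> ennreal (c * integral {0..T} w)"
      by (intro ennreal_leI fw T)
    also have "\<dots> = ennreal c * ennreal (integral {0..T} w)" using c by (rule ennreal_mult')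
    also have "\<dots> \<le> ennreal c * ray_integral w"
      by (intro mult_left_mono nn_integral_Ici_finite w fin) auto
    finally show "ennreal (integral {0..T} f) \<le> ennreal c * ray_integral w" .
  qed (use f fi in auto)
  finally show ?thesis .
qed

section \<open>Vector-valued integrals, moduli and growth bounds\<close>

lemma continuous_on_mv: "continuous_on S f \<Longrightarrow> continuous_on S (\<lambda>t. (M::real^'c^'r) *v f t)"
  by (rule bounded_linear.continuous_on[OF matrix_vector_mul_bounded_linear])

lemma cts_integrable:
  fixes f :: "real \<Rightarrow> 'a::banach"
  shows "cts f \<Longrightarrow> f integrable_on {a..b}"
  by (rule integrable_continuous_interval, rule continuous_on_subset[of UNIV]) auto

lemmas cts_intros = cts_integrable continuous_intros

lemma integral_nth: "cts (v::real \<Rightarrow> real^'c) \<Longrightarrow> integral {a..b} v $ j = integral {a..b} (\<lambda>s. v s $ j)"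
  by (simp add: cts_integrable)

lemma window_le_const:
  fixes v :: "real \<Rightarrow> real^'c"
  assumes v: "cts v" and H: "0 \<le> H" and w: "\<And>s. s \<le> t \<Longrightarrow> v s $ j \<le> w $ j"
  shows "integral {t - H..t} v $ j \<le> (H *\<^sub>R w) $ j"
proof -
  have "integral {t - H..t} (\<lambda>s. v s $ j) \<le> integral {t - H..t} (\<lambda>_. w $ j)"
    using w by (intro integral_le cts_intros v) auto
  then show ?thesis using H by (simp add: integral_nth[OF v])
qed

lemma borel_bounded_integrable:
  fixes f :: "real \<Rightarrow> real"
  assumes "f \<in> borel_measurable borel" "g integrable_on {a..b}" "\<And>x. x \<in> {a..b} \<Longrightarrow> \<bar>f x\<bar> \<le> g x"
  shows "f integrable_on {a..b}"
proof (rule measurable_bounded_by_integrable_imp_integrable_real[OF _ assms(2,3)])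
  show "f \<in> borel_measurable (lebesgue_on {a..b})"
    using assms(1) by (intro measurable_restrict_space1 measurable_completion) simp
qed auto

lemma borel_measurable_nth:
  assumes "f \<in> borel_measurable M" shows "(\<lambda>t. (f t :: real^'k) $ j) \<in> borel_measurable M"
  by (rule measurable_compose[OF assms borel_measurable_continuous_onI]) (intro continuous_intros)

definition vabs :: "real^'k \<Rightarrow> real^'k" where "vabs x = (\<chi> j. \<bar>x $ j\<bar>)"

lemma vabs_nth [simp]: "vabs x $ j = \<bar>x $ j\<bar>" by (simp add: vabs_def)

lemma abs_mv_le:
  assumes "nonneg_mat M" "\<And>j. \<bar>x $ j\<bar> \<le> y $ j" shows "\<bar>(M *v x) $ i\<bar> \<le> (M *v y) $ i"
proof -
  have "\<bar>(M *v x) $ i\<bar> \<le> (\<Sum>j\<in>UNIV. \<bar>M$i$j * x$j\<bar>)" unfolding matrix_vector_mult_def vec_lambda_beta by (rule sum_abs)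
  also have "\<dots> \<le> (\<Sum>j\<in>UNIV. M$i$j * y$j)"
    using assms by (intro sum_mono) (auto simp: abs_mult nonneg_mat_def intro!: mult_mono)
  finally show ?thesis by (simp add: matrix_vector_mult_def)
qed

lemma mv_mono:
  assumes "nonneg_mat M" "\<And>j. x $ j \<le> y $ j" shows "(M *v x) $ i \<le> (M *v y) $ i"
  unfolding matrix_vector_mult_def vec_lambda_beta
  using assms by (intro sum_mono mult_left_mono) (auto simp: nonneg_mat_def)

lemma vabs_continuous: "continuous_on S X \<Longrightarrow> continuous_on S (\<lambda>t. vabs (X t))"
  unfolding vabs_def by (intro continuous_intros)

lemma abs_window_le:
  fixes X :: "real \<Rightarrow> real^'k"
  assumes X: "cts X" and h: "h \<le> H"
  shows "\<bar>integral {t - h..t} X $ j\<bar> \<le> integral {t - H..t} (\<lambda>s. vabs (X s)) $ j"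
proof -
  note i = cts_integrable
  have aj: "cts (\<lambda>s. \<bar>X s $ j\<bar>)" using X by (intro continuous_intros)
  have "\<bar>integral {t - h..t} (\<lambda>s. X s $ j)\<bar> \<le> integral {t - h..t} (\<lambda>s. \<bar>X s $ j\<bar>)"
    using X integral_norm_bound_integral[of "\<lambda>s. X s $ j" "{t-h..t}" "\<lambda>s. \<bar>X s $ j\<bar>"] i[OF aj]
    by (auto intro!: i continuous_intros)
  also have "\<dots> \<le> integral {t - H..t} (\<lambda>s. \<bar>X s $ j\<bar>)"
    using h by (intro integral_subset_le i aj) auto
  finally show ?thesis by (simp add: integral_nth[OF X] integral_nth[OF vabs_continuous[OF X]])
qed

text \<open>Integration against the exponential weight gains the factor \<open>1 / \<kappa>\<close>,
  the source of the contraction constant in the Picard iteration.\<close>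

lemma integral_exp_growth_bound:
  fixes g :: "real \<Rightarrow> real^'n"
  assumes k: "0 < \<kappa>" and M: "0 \<le> M" and t: "0 \<le> t" and g: "cts g"
    and b: "\<And>s. 0 \<le> s \<Longrightarrow> norm (g s) \<le> M * exp (\<kappa> * s)"
  shows "norm (integral {0..t} g) \<le> M / \<kappa> * exp (\<kappa> * t)"
proof -
  have i: "((\<lambda>s. M * exp (\<kappa> * s)) has_integral M / \<kappa> * exp (\<kappa> * t) - M / \<kappa> * exp (\<kappa> * 0)) {0..t}"
    using k t by (intro fundamental_theorem_of_calculus)
      (auto intro!: derivative_eq_intros simp: has_real_derivative_iff_has_vector_derivative[symmetric])
  have "norm (integral {0..t} g) \<le> integral {0..t} (\<lambda>s. M * exp (\<kappa> * s))"
    using b by (intro integral_norm_bound_integral cts_integrable[OF g] has_integral_integrable[OF i]) auto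
  also have "\<dots> \<le> M / \<kappa> * exp (\<kappa> * t)" unfolding integral_unique[OF i] using k M by simp
  finally show ?thesis .
qed

section \<open>Static gain and certificates\<close>

locale positive_delay_system =
  fixes N :: nat and hbar :: "nat \<Rightarrow> real"
    and A :: "nat \<Rightarrow> real^'n^'n" and C :: "nat \<Rightarrow> real^'n^'y"
    and Eu :: "real^'u^'n" and Fu :: "real^'u^'y"
  assumes A0: "metzler (A 0)"
    and A: "\<forall>i\<in>{1..N}. nonneg_mat (A i)"
    and C: "\<forall>i\<in>{0..N}. nonneg_mat (C i)"
    and E: "nonneg_mat Eu" and F: "nonneg_mat Fu"
    and h: "\<forall>i\<in>{1..N}. 0 \<le> hbar i"
begin

abbreviation "Ab \<equiv> Abar N hbar A"
abbreviation "Cb \<equiv> Abar N hbar C"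
abbreviation "form2 \<equiv> lmi2_form N hbar A Eu C Fu"
abbreviation "lmi2 \<equiv> lmi2_neg_def N hbar A Eu C Fu"
abbreviation "hconst \<equiv> (\<lambda>i (_::real). hbar i)"
abbreviation "hm \<equiv> hmax N hbar"
abbreviation "admissible \<equiv> admissible_delays N hbar"
abbreviation "solves \<equiv> is_solution N hbar A Eu"
abbreviation "starts_at_0 (x::real \<Rightarrow> real^'n) \<equiv> \<forall>s\<in>{- hm..0}. x s = 0"
abbreviation "output \<equiv> sys_out N C Fu"
abbreviation "stable_for \<equiv> asymp_stable N hbar A Eu"

lemma Cb_nonneg: "nonneg_mat Cb"
  using C h unfolding Abar_def nonneg_mat_def by (auto intro!: add_nonneg_nonneg sum_nonneg)

lemma Ab_metzler: "metzler Ab"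
  using A0 A h unfolding Abar_def nonneg_mat_def metzler_def by (auto intro!: add_nonneg_nonneg sum_nonneg)

text \<open>The transfer matrix at frequency zero of the constant-delay system: constant input to
  equilibrium output.\<close>

definition static_gain :: "real^'n^'n \<Rightarrow> real^'u^'y" where
  "static_gain B = Cb ** B ** Eu + Fu"

lemma static_gain_nonneg: "neg_inverse Ab B \<Longrightarrow> nonneg_mat (static_gain B)"
  unfolding static_gain_def neg_inverse_def
  by (intro nonneg_mat_add nonneg_mat_mult E F Cb_nonneg) auto

text \<open>With \<open>z i\<close> the mean of the state over the window of length
  \<open>hbar i\<close>, the vector \<open>hbar i *\<^sub>R z i\<close> is the window integral. The
  first bracket is then the right-hand side of the dynamics and the one paired with \<open>v\<close>
  is the output.\<close>

lemma lmi2_form_eq: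
  assumes P: "transpose P = P"
  shows "form2 P Q \<gamma> x z w v =
      2 * ((P *v x) \<bullet> (A 0 *v x + (\<Sum>i\<in>{1..N}. hbar i *\<^sub>R (A i *v z i)) + Eu *v w))
    + (\<Sum>i\<in>{1..N}. x \<bullet> (Q i *v x) - z i \<bullet> (Q i *v z i))
    + 2 * (v \<bullet> (C 0 *v x + (\<Sum>i\<in>{1..N}. hbar i *\<^sub>R (C i *v z i)) + Fu *v w))
    - \<gamma> * (w \<bullet> w) - \<gamma> * (v \<bullet> v)"
proof -
  have Pi: "x \<bullet> ((P ** M) *v y) = (P *v x) \<bullet> (M *v y)" for M :: "real^'m^'n" and y
    by (metis P dot_lmul_matrix matrix_vector_mul_assoc transpose_matrix_vector)
  have t: "a \<bullet> (transpose M *v b) = b \<bullet> (M *v a)" for M :: "real^'m^'k" and a b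
    by (simp add: inner_commute[of a] dot_lmul_matrix)
  have 1: "x \<bullet> ((transpose (A 0) ** P) *v x) = (P *v x) \<bullet> (A 0 *v x)"
    by (simp flip: matrix_vector_mul_assoc add: t[unfolded transpose_matrix_vector])
  have s: "(\<Sum>i\<in>S. M i) *v y = (\<Sum>i\<in>S. M i *v y)" for M :: "nat \<Rightarrow> real^'n^'n" and y S
    by (induction S rule: infinite_finite_induct) (auto simp: matrix_vector_mult_add_rdistrib)
  have c: "(k *\<^sub>R M) *v y = k *\<^sub>R (M *v y)" for k and M :: "real^'k^'m" and y
    by (simp add: scaleR_matrix_vector_assoc)
  show ?thesis
    unfolding lmi2_form_def matrix_vector_mult_add_rdistrib s c t inner_add_right inner_sum_right
      inner_scaleR_right Pi 1 sum_subtractf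
    by (simp add: algebra_simps sum_distrib_left dot_lmul_matrix inner_commute[of "z _"])
qed

text \<open>At a constant state every window mean is the state itself, so the terms with
  \<open>Q i\<close> cancel.\<close>

lemma lmi2_form_diagonal_arg:
  assumes P: "transpose P = P"
  shows "form2 P Q \<gamma> x (\<lambda>_. x) w v =
      2 * ((P *v x) \<bullet> (Ab *v x + Eu *v w))
    + 2 * (v \<bullet> (Cb *v x + Fu *v w)) - \<gamma> * (w \<bullet> w) - \<gamma> * (v \<bullet> v)"
  by (simp add: lmi2_form_eq[OF P] Abar_mv)

text \<open>The alternative to stability is a nonnegative direction \<open>p\<close> with
  \<open>Ab *v p\<close> nonnegative. A positive diagonal \<open>P\<close> preserves signs, so the
  form would be nonnegative at the constant state \<open>p\<close>.\<close>

lemma lmi2_imp_stable: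
  assumes P: "diag_pd P" and L: "lmi2 P Q \<gamma>"
  shows "\<exists>l. (\<forall>j. 0 < l$j) \<and> (\<forall>i. (l v* Ab)$i < 0)"
proof (rule ccontr)
  assume "\<not> ?thesis"
  then obtain p where p: "p \<noteq> 0" "\<forall>i. 0 \<le> p$i" "\<forall>j. 0 \<le> (Ab *v p)$j"
    using ville_alternative_left[of Ab] by blast
  have "0 \<le> (P *v p) \<bullet> (Ab *v p)"
    unfolding inner_vec_def
    using p diag_pd_pos[OF P] by (intro sum_nonneg) (simp add: diag_pd_mv[OF P] less_imp_le)
  then have "0 \<le> form2 P Q \<gamma> p (\<lambda>_. p) 0 0"
    by (simp add: lmi2_form_diagonal_arg[OF diag_pd_transpose[OF P]])
  with L p(1) show False unfolding lmi2_neg_def_def by (smt (verit))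
qed

text \<open>At the equilibrium for the constant input \<open>u\<close> the dynamics term vanishes;
  \<open>v = y / \<gamma>\<close> maximizes the form over \<open>v\<close> and leaves
  \<open>(y \<bullet> y) / \<gamma> - \<gamma> * (u \<bullet> u)\<close>.\<close>

lemma lmi2_imp_static_gain:
  assumes P: "diag_pd P" and L: "lmi2 P Q \<gamma>"
    and B: "neg_inverse Ab B" and u: "u \<noteq> 0" and g: "0 < \<gamma>"
  shows "norm (static_gain B *v u) < \<gamma> * norm u"
proof -
  define x where "x = B *v (Eu *v u)"
  define y where "y = Cb *v x + Fu *v u"
  have "Ab *v x + Eu *v u = 0"
    by (simp add: x_def neg_inverse_mv[OF B])
  then have "form2 P Q \<gamma> x (\<lambda>_. x) u ((1/\<gamma>) *\<^sub>R y) = (y \<bullet> y) / \<gamma> - \<gamma> * (u \<bullet> u)"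
    using g by (simp add: lmi2_form_diagonal_arg[OF diag_pd_transpose[OF P]] flip: y_def)
  moreover have "\<dots> < 0" using L u calculation unfolding lmi2_neg_def_def by metis
  ultimately have "(norm y)\<^sup>2 < (\<gamma> * norm u)\<^sup>2"
    using g by (simp add: power_mult_distrib power2_norm_eq_inner) (simp add: field_simps power2_eq_square)
  then have "norm y < \<gamma> * norm u" by (rule power_less_imp_less_base) (use g in simp)
  then show ?thesis
    by (simp add: y_def x_def static_gain_def matrix_vector_mult_add_rdistrib matrix_vector_mul_assoc matrix_mul_assoc)
qed

text \<open>The residuals are the block rows of the symmetric Metzler block matrix applied to the
  positive vector \<open>(\<xi>, \<xi>, ..., \<xi>, \<omega>, \<eta>)\<close>. The matrix is never
  assembled: each block is bounded by \<open>wform\<close> terms, and the terms sharing a variable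
  add up to the form with that row's residual.\<close>

lemma symmetric_metzler_form_neg:
  assumes P: "diag_pd P" and Q: "\<forall>i\<in>{1..N}. diag_pd (Q i)"
    and pos: "\<forall>j. 0 < \<xi>$j" "\<forall>j. 0 < \<omega>$j" "\<forall>j. 0 < \<eta>$j"
    and rx: "\<forall>j. (P *v (Ab *v \<xi> + Eu *v \<omega>) + (P *v \<xi>) v* A 0 + (\<Sum>i\<in>{1..N}. Q i *v \<xi>) + \<eta> v* C 0)$j < 0"
    and rz: "\<forall>i\<in>{1..N}. \<forall>j. (hbar i *\<^sub>R ((P *v \<xi>) v* A i + \<eta> v* C i) - Q i *v \<xi>)$j < 0"
    and rw: "\<forall>j. ((P *v \<xi>) v* Eu + \<eta> v* Fu - \<gamma> *\<^sub>R \<omega>)$j < 0"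
    and rv: "\<forall>j. (Cb *v \<xi> + Fu *v \<omega> - \<gamma> *\<^sub>R \<eta>)$j < 0"
  shows "lmi2 P Q \<gamma>"
  unfolding lmi2_neg_def_def
proof (intro allI impI)
  fix x :: "real^'n" and z :: "nat \<Rightarrow> real^'n" and w :: "real^'u" and v :: "real^'y"
  assume nz: "x \<noteq> 0 \<or> (\<exists>i\<in>{1..N}. z i \<noteq> 0) \<or> w \<noteq> 0 \<or> v \<noteq> 0"
  let ?I = "{1..N}"
  note Pt = diag_pd_transpose[OF P]
  have PM: "(P ** M)$i$j = P$i$i * M$i$j" for M :: "real^'k^'n" and i j
  proof -
    have "(P ** M)$i$j = (P *v column j M)$i"
      by (simp add: matrix_matrix_mult_def matrix_vector_mult_def column_def)
    then show ?thesis by (simp add: diag_pd_mv[OF P] column_def)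
  qed
  have Pv: "\<xi> v* (P ** M) = (P *v \<xi>) v* M" for M :: "real^'k^'n"
    by (metis Pt vector_matrix_mul_assoc transpose_matrix_vector)
  have Pi: "x \<bullet> ((P ** M) *v b) = (P *v x) \<bullet> (M *v b)" for M :: "real^'k^'n" and b
    by (metis Pt dot_lmul_matrix matrix_vector_mul_assoc transpose_matrix_vector)
  have bilinP: "2 * ((P *v x) \<bullet> (M *v b)) \<le> wform \<xi> x (P *v (M *v \<beta>)) + wform \<beta> b ((P *v \<xi>) v* M)"
    if M: "nonneg_mat M" and be: "\<forall>i. 0 < \<beta>$i" for M :: "real^'k^'n" and b \<beta>
  proof -
    have "nonneg_mat (P ** M)" using M diag_pd_pos[OF P] by (auto simp: nonneg_mat_def PM less_imp_le)
    from bilinear_weighted_bound[OF this pos(1) be, of x b] show ?thesis by (simp add: Pi Pv matrix_vector_mul_assoc)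
  qed
  have "metzler (P ** A 0)" using A0 diag_pd_pos[OF P] by (auto simp: metzler_def PM less_imp_le)
  from quadratic_weighted_bound[OF this pos(1), of x]
  have tA0: "2 * ((P *v x) \<bullet> (A 0 *v x)) \<le> wform \<xi> x (P *v (A 0 *v \<xi>)) + wform \<xi> x ((P *v \<xi>) v* A 0)"
    by (simp add: Pi Pv matrix_vector_mul_assoc wform_add)
  have tA: "2 * ((P *v x) \<bullet> (\<Sum>i\<in>?I. hbar i *\<^sub>R (A i *v z i)))
      \<le> (\<Sum>i\<in>?I. wform \<xi> x (P *v (hbar i *\<^sub>R (A i *v \<xi>)))) + (\<Sum>i\<in>?I. hbar i * wform \<xi> (z i) ((P *v \<xi>) v* A i))"
    unfolding sum.distrib[symmetric] inner_sum_right sum_distrib_left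
  proof (intro sum_mono)
    fix i assume i: "i \<in> ?I"
    have "hbar i * (2 * ((P *v x) \<bullet> (A i *v z i))) \<le> hbar i * (wform \<xi> x (P *v (A i *v \<xi>)) + wform \<xi> (z i) ((P *v \<xi>) v* A i))"
      using i A h by (intro mult_left_mono bilinP pos) auto
    then show "2 * ((P *v x) \<bullet> (hbar i *\<^sub>R (A i *v z i))) \<le> wform \<xi> x (P *v (hbar i *\<^sub>R (A i *v \<xi>))) + hbar i * wform \<xi> (z i) ((P *v \<xi>) v* A i)"
      by (simp add: algebra_simps matrix_vector_mult_scaleR wform_scaleR)
  qed
  have tC: "2 * (v \<bullet> (\<Sum>i\<in>?I. hbar i *\<^sub>R (C i *v z i)))
      \<le> (\<Sum>i\<in>?I. wform \<eta> v (hbar i *\<^sub>R (C i *v \<xi>))) + (\<Sum>i\<in>?I. hbar i * wform \<xi> (z i) (\<eta> v* C i))"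
    unfolding sum.distrib[symmetric] inner_sum_right sum_distrib_left
  proof (intro sum_mono)
    fix i assume i: "i \<in> ?I"
    have "hbar i * (2 * (v \<bullet> (C i *v z i))) \<le> hbar i * (wform \<eta> v (C i *v \<xi>) + wform \<xi> (z i) (\<eta> v* C i))"
      using i C h by (intro mult_left_mono bilinear_weighted_bound pos) auto
    then show "2 * (v \<bullet> (hbar i *\<^sub>R (C i *v z i))) \<le> wform \<eta> v (hbar i *\<^sub>R (C i *v \<xi>)) + hbar i * wform \<xi> (z i) (\<eta> v* C i)"
      by (simp add: algebra_simps wform_scaleR)
  qed
  have tE: "2 * ((P *v x) \<bullet> (Eu *v w)) \<le> wform \<xi> x (P *v (Eu *v \<omega>)) + wform \<omega> w ((P *v \<xi>) v* Eu)"
    by (intro bilinP E pos)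
  have tC0: "2 * (v \<bullet> (C 0 *v x)) \<le> wform \<eta> v (C 0 *v \<xi>) + wform \<xi> x (\<eta> v* C 0)"
    using C by (intro bilinear_weighted_bound pos) auto
  have tF: "2 * (v \<bullet> (Fu *v w)) \<le> wform \<eta> v (Fu *v \<omega>) + wform \<omega> w (\<eta> v* Fu)"
    by (intro bilinear_weighted_bound F pos)
  have tQ: "(\<Sum>i\<in>?I. x \<bullet> (Q i *v x) - z i \<bullet> (Q i *v z i)) =
      (\<Sum>i\<in>?I. wform \<xi> x (Q i *v \<xi>)) - (\<Sum>i\<in>?I. wform \<xi> (z i) (Q i *v \<xi>))"
    unfolding sum_subtractf[symmetric] using Q pos by (intro sum.cong) (auto simp: wform_diag)
  have "form2 P Q \<gamma> x z w v
    \<le> wform \<xi> x (P *v (Ab *v \<xi> + Eu *v \<omega>) + (P *v \<xi>) v* A 0 + (\<Sum>i\<in>?I. Q i *v \<xi>) + \<eta> v* C 0)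
      + (\<Sum>i\<in>?I. wform \<xi> (z i) (hbar i *\<^sub>R ((P *v \<xi>) v* A i + \<eta> v* C i) - Q i *v \<xi>))
      + wform \<omega> w ((P *v \<xi>) v* Eu + \<eta> v* Fu - \<gamma> *\<^sub>R \<omega>)
      + wform \<eta> v (Cb *v \<xi> + Fu *v \<omega> - \<gamma> *\<^sub>R \<eta>)"
  proof -
    have 1: "P *v (\<Sum>i\<in>?I. hbar i *\<^sub>R (A i *v \<xi>)) = (\<Sum>i\<in>?I. P *v (hbar i *\<^sub>R (A i *v \<xi>)))"
      by (rule linear_sum) (simp add: matrix_vector_mul_linear)
    show ?thesis
      using tA0 tA tC tE tC0 tF tQ
      unfolding lmi2_form_eq[OF Pt] Abar_mv inner_add_right matrix_vector_right_distrib 1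
        wform_add wform_diff wform_sum wform_scaleR sum_subtractf
        wform_self[OF pos(2)] wform_self[OF pos(3)] distrib_left sum.distrib
      by linarith
  qed
  also have "\<dots> < 0"
  proof -
    have a: "wform \<xi> x (P *v (Ab *v \<xi> + Eu *v \<omega>) + (P *v \<xi>) v* A 0 + (\<Sum>i\<in>?I. Q i *v \<xi>) + \<eta> v* C 0) \<le> 0"
      by (intro wform_nonpos pos rx)
    have b: "(\<Sum>i\<in>?I. wform \<xi> (z i) (hbar i *\<^sub>R ((P *v \<xi>) v* A i + \<eta> v* C i) - Q i *v \<xi>)) \<le> 0"
      using rz by (intro sum_nonpos wform_nonpos pos) auto
    have c: "wform \<omega> w ((P *v \<xi>) v* Eu + \<eta> v* Fu - \<gamma> *\<^sub>R \<omega>) \<le> 0"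
      by (intro wform_nonpos pos rw)
    have d: "wform \<eta> v (Cb *v \<xi> + Fu *v \<omega> - \<gamma> *\<^sub>R \<eta>) \<le> 0"
      by (intro wform_nonpos pos rv)
    \<comment> \<open>All four contributions are nonpositive, and the one belonging to a nonzero
      block is strictly negative.\<close>
    from nz consider "x \<noteq> 0" | i where "i \<in> ?I" "z i \<noteq> 0" | "w \<noteq> 0" | "v \<noteq> 0" by blast
    then show ?thesis
    proof cases
      case 1
      from wform_neg[OF pos(1) rx this] b c d show ?thesis by linarith
    next
      case (2 i)
      have "(\<Sum>i\<in>?I. wform \<xi> (z i) (hbar i *\<^sub>R ((P *v \<xi>) v* A i + \<eta> v* C i) - Q i *v \<xi>)) < 0"
        unfolding sum.remove[OF finite_atLeastAtMost 2(1)]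
        using 2 rz by (intro add_neg_nonpos wform_neg sum_nonpos wform_nonpos pos) auto
      with a c d show ?thesis by linarith
    next
      case 3
      from wform_neg[OF pos(2) rw this] a b d show ?thesis by linarith
    next
      case 4
      from wform_neg[OF pos(3) rv this] a b c show ?thesis by linarith
    qed
  qed
  finally show "form2 P Q \<gamma> x z w v < 0" .
qed

text \<open>Diagonal matrices can send \<open>\<xi>\<close> to any prescribed positive vectors, so
  it is enough to choose \<open>P *v \<xi> = \<pi>\<close> and
  \<open>Q i *v \<xi> = \<kappa> i\<close> such that the block rows at the test vector become
  negative.\<close>

lemma lmi2_exists:
  assumes B: "neg_inverse Ab B"
    and g: "0 \<le> g" "g < \<gamma>" and norm: "\<forall>u. norm (static_gain B *v u) \<le> g * norm u"
  shows "\<exists>P Q. diag_pd P \<and> (\<forall>i\<in>{1..N}. diag_pd (Q i)) \<and> lmi2 P Q \<gamma>"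
proof -
  let ?A = Ab and ?C = Cb and ?G = "static_gain B"
  from gain_vectors[OF static_gain_nonneg[OF B] g norm] obtain \<omega> \<eta> where om: "\<forall>j. 0 < \<omega>$j" and eta: "\<forall>j. 0 < \<eta>$j"
    and G1: "\<forall>i. (?G *v \<omega>)$i < (\<gamma> *\<^sub>R \<eta>)$i" and G2: "\<forall>j. (\<eta> v* ?G)$j < (\<gamma> *\<^sub>R \<omega>)$j" by auto
  from small_perturbation[OF G1, of "?C *v (B *v 1)"] obtain e1 where e1: "0 < e1"
    "\<forall>i. (?G *v \<omega>)$i + e1 * (?C *v (B *v 1))$i < (\<gamma> *\<^sub>R \<eta>)$i" by blast
  from small_perturbation[OF G2, of "(1 v* B) v* Eu"] obtain e2 where e2: "0 < e2"
    "\<forall>i. (\<eta> v* ?G)$i + e2 * ((1 v* B) v* Eu)$i < (\<gamma> *\<^sub>R \<omega>)$i" by blast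
  \<comment> \<open>\<open>\<xi>\<close> is the equilibrium state for the input
    \<open>\<omega>\<close>, and \<open>\<pi>\<close> its adjoint for the output weight
    \<open>\<eta>\<close>. The additions \<open>e1\<close> and \<open>e2\<close> make both positive
    and leave strictly negative residuals in the dynamics.\<close>
  define \<xi> where "\<xi> = B *v (Eu *v \<omega> + e1 *\<^sub>R 1)"
  define \<pi> where "\<pi> = (\<eta> v* ?C + e2 *\<^sub>R 1) v* B"
  have "0 \<le> (Eu *v \<omega>)$j" "0 \<le> (\<eta> v* ?C)$j" for j
    using om eta by (auto intro!: nonneg_mat_mv nonneg_mat_vm E Cb_nonneg simp: less_imp_le)
  then have xi: "\<forall>j. 0 < \<xi>$j" and pi: "\<forall>j. 0 < \<pi>$j"
    using e1(1) e2(1) unfolding \<xi>_def \<pi>_def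
    by (auto intro!: neg_inverse_mv_pos[OF B] neg_inverse_vm_pos[OF B] add_nonneg_pos)
  have Axi: "?A *v \<xi> + Eu *v \<omega> = - e1 *\<^sub>R 1" by (simp add: \<xi>_def neg_inverse_mv[OF B])
  have piA: "\<pi> v* ?A + \<eta> v* ?C = - e2 *\<^sub>R 1" by (simp add: \<pi>_def neg_inverse_vm[OF B])
  \<comment> \<open>Each delay row needs a surplus \<open>d\<close> in \<open>\<kappa> i\<close>,
    and all \<open>N\<close> surpluses reappear in the state row, where only the slack
    \<open>e2\<close> is available.\<close>
  define d where "d = e2 / (real N + 1)"
  have d: "0 < d" "real N * d < e2" using e2(1) by (simp_all add: d_def field_simps)
  define \<kappa> where "\<kappa> = (\<lambda>i. hbar i *\<^sub>R (\<pi> v* A i + \<eta> v* C i) + d *\<^sub>R 1)"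
  have kap: "0 < \<kappa> i $ j" if "i \<in> {1..N}" for i j
  proof -
    have "0 \<le> (\<pi> v* A i)$j" "0 \<le> (\<eta> v* C i)$j"
      using that pi eta A C by (auto intro!: nonneg_mat_vm simp: less_imp_le)
    then show ?thesis using that h d(1) by (auto simp: \<kappa>_def intro!: add_nonneg_pos mult_nonneg_nonneg)
  qed
  define P where "P = (\<chi> i j. if i = j then (\<chi> i. \<pi>$i / \<xi>$i)$i else 0)"
  define Q where "Q = (\<lambda>k. \<chi> i j. if i = j then (\<chi> i. \<kappa> k $i / \<xi>$i)$i else 0)"
  have P: "diag_pd P" unfolding P_def using xi pi by (intro diag_pd_diag) simp
  have Q: "\<forall>i\<in>{1..N}. diag_pd (Q i)" unfolding Q_def using xi kap by (intro ballI diag_pd_diag) simp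
  have nz: "\<xi>$j \<noteq> 0" for j using xi by (simp add: less_imp_neq[symmetric])
  have Pxi: "P *v \<xi> = \<pi>" using nz by (simp add: vec_eq_iff diag_pd_mv[OF P]) (simp add: P_def)
  have Qxi: "Q i *v \<xi> = \<kappa> i" if "i \<in> {1..N}" for i
    using nz Q that by (simp add: vec_eq_iff diag_pd_mv) (simp add: Q_def)
  have "lmi2 P Q \<gamma>"
  proof (rule symmetric_metzler_form_neg[OF P Q xi om eta]; intro allI ballI)
    fix j
    have "(\<Sum>i\<in>{1..N}. Q i *v \<xi>) = (\<Sum>i\<in>{1..N}. hbar i *\<^sub>R (\<pi> v* A i)) + (\<Sum>i\<in>{1..N}. hbar i *\<^sub>R (\<eta> v* C i)) + (real N * d) *\<^sub>R 1"
      by (simp add: Qxi \<kappa>_def sum.distrib scaleR_right_distrib) (simp add: vec_eq_iff of_nat_index)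
    then have "\<pi> v* A 0 + (\<Sum>i\<in>{1..N}. Q i *v \<xi>) + \<eta> v* C 0 = (\<pi> v* ?A + \<eta> v* ?C) + (real N * d) *\<^sub>R 1"
      by (simp add: Abar_vm)
    then have "(\<pi> v* A 0 + (\<Sum>i\<in>{1..N}. Q i *v \<xi>) + \<eta> v* C 0)$j = real N * d - e2" by (simp add: piA)
    moreover have "(P *v (?A *v \<xi> + Eu *v \<omega>))$j < 0"
      using e1(1) diag_pd_pos[OF P, of j] by (simp add: Axi diag_pd_mv[OF P])
    ultimately show "(P *v (?A *v \<xi> + Eu *v \<omega>) + (P *v \<xi>) v* A 0 + (\<Sum>i\<in>{1..N}. Q i *v \<xi>) + \<eta> v* C 0)$j < 0"
      using d(2) by (simp add: Pxi)
  next
    fix i j assume "i \<in> {1..N}"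
    then show "(hbar i *\<^sub>R ((P *v \<xi>) v* A i + \<eta> v* C i) - Q i *v \<xi>)$j < 0"
      using d(1) by (simp add: Pxi Qxi \<kappa>_def)
  next
    fix j
    have "\<pi> v* Eu + \<eta> v* Fu = \<eta> v* ?G + e2 *\<^sub>R ((1 v* B) v* Eu)"
      by (simp add: \<pi>_def static_gain_def vm_add_smult vector_matrix_mult_add_rdistrib vector_matrix_mul_assoc)
    then show "((P *v \<xi>) v* Eu + \<eta> v* Fu - \<gamma> *\<^sub>R \<omega>)$j < 0"
      using e2(2)[rule_format, of j] by (simp add: Pxi)
  next
    fix j
    have "?C *v \<xi> + Fu *v \<omega> = ?G *v \<omega> + e1 *\<^sub>R (?C *v (B *v 1))"
      by (simp add: \<xi>_def static_gain_def mv_add_smult matrix_vector_mult_add_rdistrib matrix_vector_mul_assoc matrix_mul_assoc)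
    then show "(?C *v \<xi> + Fu *v \<omega> - \<gamma> *\<^sub>R \<eta>)$j < 0"
      using e1(2)[rule_format, of j] by simp
  qed
  with P Q show ?thesis by blast
qed

text \<open>\<open>l\<close> is the adjoint equilibrium for the output weight \<open>1\<close>. The
  addition \<open>e\<close> makes the state inequality strict at the price
  \<open>e * ((1 v* B) v* Eu)$j\<close> in the input inequality, which the slack in the column sums
  of the static gain pays.\<close>

lemma left_lp_exists:
  assumes B: "neg_inverse Ab B" and g: "g < \<gamma>" "\<forall>j. (1 v* static_gain B)$j \<le> g"
  shows "\<exists>l. (\<forall>j. 0 < l$j) \<and>
            (\<forall>j. (l v* Ab + 1 v* Cb) $ j < 0) \<and>
            (\<forall>j. (l v* Eu + 1 v* Fu) $ j < \<gamma>)"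
proof -
  let ?G = "static_gain B"
  have "\<forall>j. (1 v* ?G)$j < (\<gamma> *\<^sub>R 1)$j" using g by (auto intro: le_less_trans)
  from small_perturbation[OF this, of "(1 v* B) v* Eu"] obtain e where e: "0 < e"
    "\<forall>j. (1 v* ?G)$j + e * ((1 v* B) v* Eu)$j < \<gamma>" by auto
  define l where "l = (1 v* Cb + e *\<^sub>R 1) v* B"
  have "0 \<le> (1 v* Cb)$j" for j by (intro nonneg_mat_vm Cb_nonneg) simp
  then have "0 < l$j" for j unfolding l_def using e(1) by (intro neg_inverse_vm_pos[OF B]) (simp add: add_nonneg_pos)
  moreover have "l v* Ab + 1 v* Cb = - e *\<^sub>R 1"
    by (simp add: l_def neg_inverse_vm[OF B])
  moreover have "l v* Eu + 1 v* Fu = 1 v* ?G + e *\<^sub>R ((1 v* B) v* Eu)"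
    by (simp add: l_def static_gain_def vm_add_smult vector_matrix_mult_add_rdistrib vector_matrix_mul_assoc)
  ultimately show ?thesis using e by (intro exI[of _ l]) simp
qed

text \<open>Dual construction: \<open>l\<close> is the equilibrium state under the constant input
  \<open>1\<close>, raised by \<open>e\<close>, and the slack is in the row sums.\<close>

lemma right_lp_exists:
  assumes B: "neg_inverse Ab B" and g: "g < \<gamma>" "\<forall>j. (static_gain B *v 1)$j \<le> g"
  shows "\<exists>l. (\<forall>j. 0 < l$j) \<and>
            (\<forall>j. (Ab *v l + Eu *v 1) $ j < 0) \<and>
            (\<forall>j. (Cb *v l + Fu *v 1) $ j < \<gamma>)"
proof -
  let ?G = "static_gain B"
  have "\<forall>j. (?G *v 1)$j < (\<gamma> *\<^sub>R 1)$j" using g by (auto intro: le_less_trans)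
  from small_perturbation[OF this, of "Cb *v (B *v 1)"] obtain e where e: "0 < e"
    "\<forall>j. (?G *v 1)$j + e * (Cb *v (B *v 1))$j < \<gamma>" by auto
  define l where "l = B *v (Eu *v 1 + e *\<^sub>R 1)"
  have "0 \<le> (Eu *v 1)$j" for j by (intro nonneg_mat_mv E) simp
  then have "0 < l$j" for j unfolding l_def using e(1) by (intro neg_inverse_mv_pos[OF B]) (simp add: add_nonneg_pos)
  moreover have "Ab *v l + Eu *v 1 = - e *\<^sub>R 1"
    by (simp add: l_def neg_inverse_mv[OF B])
  moreover have "Cb *v l + Fu *v 1 = ?G *v 1 + e *\<^sub>R (Cb *v (B *v 1))"
    by (simp add: l_def static_gain_def mv_add_smult matrix_vector_mult_add_rdistrib matrix_vector_mul_assoc matrix_mul_assoc)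
  ultimately show ?thesis using e by (intro exI[of _ l]) simp
qed

section \<open>Subsolutions of the majorizing constant-delay system\<close>

text \<open>Serves both the dynamics (\<open>M = A\<close>) and the output (\<open>M = C\<close>),
  without the input terms.\<close>

definition drift :: "(nat \<Rightarrow> real^'c^'r) \<Rightarrow> (real \<Rightarrow> real^'c) \<Rightarrow> real \<Rightarrow> real^'r" where
  "drift M v t = M 0 *v v t + (\<Sum>i\<in>{1..N}. M i *v integral {t - hbar i..t} v)"

lemma drift_continuous: "cts v \<Longrightarrow> cts (drift M v)"
  unfolding drift_def[abs_def]
  by (intro continuous_on_add continuous_on_sum continuous_on_mv window_integral_continuous)

lemma inner_drift:
  "l \<bullet> drift M v t = (l v* M 0) \<bullet> v t + (\<Sum>i\<in>{1..N}. (l v* M i) \<bullet> integral {t - hbar i..t} v)"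
  by (simp add: drift_def inner_add_right inner_sum_right dot_lmul_matrix)

lemma inner_drift_integral:
  fixes v :: "real \<Rightarrow> real^'c" and M :: "nat \<Rightarrow> real^'c^'r"
  assumes v: "cts v"
  shows "integral {0..T} (\<lambda>t. l \<bullet> drift M v t) =
    (l v* M 0) \<bullet> integral {0..T} v + (\<Sum>i\<in>{1..N}. (l v* M i) \<bullet> integral {0..T} (\<lambda>t. integral {t - hbar i..t} v))"
proof -
  have hi: "((\<lambda>t. a \<bullet> f t) has_integral a \<bullet> integral {0..T} f) {0..T}"
    if "cts f" for a :: "real^'c" and f :: "real \<Rightarrow> real^'c"
    using has_integral_linear[OF integrable_integral[OF cts_integrable[OF that]] bounded_linear_inner_right[of a]]
    by (simp add: o_def)
  show ?thesis
    unfolding inner_drift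
    by (intro integral_unique has_integral_add has_integral_sum hi v window_integral_continuous) simp
qed

lemma inner_sum_mono:
  fixes M :: "nat \<Rightarrow> real^'c^'r"
  assumes M: "\<forall>i\<in>{1..N}. nonneg_mat (M i)" and l: "\<forall>j. 0 \<le> l$j"
    and le: "\<And>i j. i \<in> {1..N} \<Longrightarrow> a i $ j \<le> b i $ j"
  shows "(\<Sum>i\<in>{1..N}. (l v* M i) \<bullet> a i) \<le> (\<Sum>i\<in>{1..N}. (l v* M i) \<bullet> b i)"
  unfolding inner_vec_def inner_real_def
  using M l by (intro sum_mono mult_left_mono le nonneg_mat_vm) auto

text \<open>Exchanging window and time integrals plays the role of the memory terms of a
  Lyapunov-Krasovskii functional: delays survive only as factors \<open>hbar i\<close> and as a
  history term.\<close>

lemma inner_drift_integral_le: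
  fixes v :: "real \<Rightarrow> real^'c" and M :: "nat \<Rightarrow> real^'c^'r"
  assumes v: "cts v" and v0: "\<And>t j. 0 \<le> v t $ j"
    and M: "\<forall>i\<in>{1..N}. nonneg_mat (M i)" and l: "\<forall>j. 0 \<le> l$j" and T: "0 \<le> T"
  shows "integral {0..T} (\<lambda>t. l \<bullet> drift M v t)
     \<le> (l v* Abar N hbar M) \<bullet> integral {0..T} v + (\<Sum>i\<in>{1..N}. hbar i * ((l v* M i) \<bullet> integral {- hbar i..0} v))"
proof -
  have vj: "cts (\<lambda>t. v t $ j)" for j using v by (intro continuous_intros)
  have w: "cts (\<lambda>t. integral {t - k..t} v)" for k by (rule window_integral_continuous[OF v])
  have "integral {0..T} (\<lambda>t. l \<bullet> drift M v t) =
      (l v* M 0) \<bullet> integral {0..T} v + (\<Sum>i\<in>{1..N}. (l v* M i) \<bullet> integral {0..T} (\<lambda>t. integral {t - hbar i..t} v))"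
    by (rule inner_drift_integral[OF v])
  also have "\<dots> \<le> (l v* M 0) \<bullet> integral {0..T} v + (\<Sum>i\<in>{1..N}. (l v* M i) \<bullet> (hbar i *\<^sub>R (integral {- hbar i..0} v + integral {0..T} v)))"
  proof (intro add_mono order_refl inner_sum_mono M l)
    fix i j assume i: "i \<in> {1..N}"
    have "integral {0..T} (\<lambda>t. integral {t - hbar i..t} v) $ j = integral {0..T} (\<lambda>t. integral {t - hbar i..t} (\<lambda>s. v s $ j))"
      by (simp add: integral_nth[OF w] integral_nth[OF v])
    also have "\<dots> \<le> hbar i * (integral {- hbar i..0} (\<lambda>s. v s $ j) + integral {0..T} (\<lambda>s. v s $ j))"
      using h i v0 T by (intro window_double_integral_le vj) auto
    finally show "integral {0..T} (\<lambda>t. integral {t - hbar i..t} v) $ j \<le> (hbar i *\<^sub>R (integral {- hbar i..0} v + integral {0..T} v)) $ j"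
      by (simp add: integral_nth[OF v])
  qed
  also have "\<dots> = (l v* Abar N hbar M) \<bullet> integral {0..T} v + (\<Sum>i\<in>{1..N}. hbar i * ((l v* M i) \<bullet> integral {- hbar i..0} v))"
    by (simp add: Abar_vm inner_add_left inner_sum_left inner_add_right sum.distrib algebra_simps)
  finally show ?thesis .
qed

text \<open>A subsolution of the positive system whose delays are frozen at their upper bounds. Moduli
  of solutions for arbitrary admissible delays are subsolutions, which removes the time-varying
  delays from the analysis.\<close>

definition subsolution :: "(real \<Rightarrow> real^'n) \<Rightarrow> (real \<Rightarrow> real^'n) \<Rightarrow> bool" where
  "subsolution r v \<longleftrightarrow> (\<forall>i s t. 0 \<le> s \<longrightarrow> s \<le> t \<longrightarrow>
     v t $ i - v s $ i \<le> integral {s..t} (\<lambda>\<tau>. drift A v \<tau> $ i + r \<tau> $ i))"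

text \<open>Isolates the diagonal entry, whose sign is unrestricted; the remainder is monotone in
  \<open>v\<close>.\<close>

lemma drift_nth_split:
  "drift A v t $ i = A 0 $ i $ i * v t $ i + ((\<Sum>j\<in>UNIV - {i}. A 0 $ i $ j * v t $ j) + (\<Sum>k\<in>{1..N}. (A k *v integral {t - hbar k..t} v) $ i))"
  by (simp add: drift_def matrix_vector_mult_def sum.remove[of UNIV i])

lemma subsolution_inner:
  assumes sub: "subsolution r v" and v: "cts v"
    and r: "\<And>i T. (\<lambda>t. r t $ i) integrable_on {0..T}" and l: "\<forall>j. 0 \<le> l$j" and T: "0 \<le> T"
  shows "l \<bullet> v T - l \<bullet> v 0 \<le> integral {0..T} (\<lambda>t. l \<bullet> drift A v t) + integral {0..T} (\<lambda>t. l \<bullet> r t)"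
proof -
  have d: "(\<lambda>t. drift A v t $ i) integrable_on {0..T}" for i
    by (intro cts_intros drift_continuous v)
  have "l \<bullet> v T - l \<bullet> v 0 = (\<Sum>i\<in>UNIV. l$i * (v T $ i - v 0 $ i))"
    by (simp add: inner_vec_def sum_subtractf right_diff_distrib)
  also have "\<dots> \<le> (\<Sum>i\<in>UNIV. l$i * integral {0..T} (\<lambda>t. drift A v t $ i + r t $ i))"
    using sub l T by (intro sum_mono mult_left_mono) (auto simp: subsolution_def)
  also have "\<dots> = (\<Sum>i\<in>UNIV. integral {0..T} (\<lambda>t. l$i * drift A v t $ i)) + (\<Sum>i\<in>UNIV. integral {0..T} (\<lambda>t. l$i * r t $ i))"
    using d r by (simp add: integral_add distrib_left sum.distrib)
  also have "\<dots> = integral {0..T} (\<lambda>t. l \<bullet> drift A v t) + integral {0..T} (\<lambda>t. l \<bullet> r t)"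
    unfolding inner_vec_def inner_real_def
    using d r by (intro arg_cong2[where f = "(+)"] integral_sum[symmetric] integrable_on_mult_right) auto
  finally show ?thesis .
qed

text \<open>Positive parts turn a subsolution starting in the nonpositive orthant into a nonnegative
  one starting at 0.\<close>

lemma subsolution_nonpos:
  assumes d: "cts d" and sub: "subsolution (\<lambda>_. 0) d"
    and init: "\<And>t j. t \<le> 0 \<Longrightarrow> d t $ j \<le> 0" and T: "0 \<le> T"
  shows "d T $ j \<le> 0"
proof -
  define e where "e = (\<lambda>t. \<chi> i. max (d t $ i) 0)"
  have e: "cts e" unfolding e_def using d by (intro continuous_intros)
  have e0: "0 \<le> e t $ j" for t j by (simp add: e_def)
  have de: "d t $ j \<le> e t $ j" for t j by (simp add: e_def)
  have ez: "e t = 0" if "t \<le> 0" for t using init[OF that] by (simp add: e_def vec_eq_iff max_def)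
  \<comment> \<open>The drift of \<open>e\<close> without its diagonal term. It dominates the
    forcing of \<open>d\<close> and is nonnegative, so both branches \<open>d\<close> and
    \<open>0\<close> of the maximum obey the inequality with the same \<open>G\<close>.\<close>
  define G where "G = (\<lambda>i t. (\<Sum>j\<in>UNIV - {i}. A 0 $ i $ j * e t $ j) + (\<Sum>k\<in>{1..N}. (A k *v integral {t - hbar k..t} e) $ i))"
  have Gc: "cts (G i)" for i
    unfolding G_def using e
    by (intro continuous_on_add continuous_on_sum continuous_on_mv window_integral_continuous
        continuous_on_mult_left continuous_on_component)
  have wnn: "0 \<le> integral {a..b} e $ j" for a b j
    unfolding integral_nth[OF e]
    by (intro integral_nonneg cts_intros e e0)
  have G0: "0 \<le> G i t" for i t
    unfolding G_def using A0 A e0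
    by (intro add_nonneg_nonneg sum_nonneg mult_nonneg_nonneg nonneg_mat_mv)
       (auto simp: metzler_def wnn)
  have le: "drift A d t $ i \<le> A 0 $ i $ i * d t $ i + G i t" for t i
    unfolding drift_nth_split G_def
  proof (intro add_mono order_refl sum_mono)
    fix j assume "j \<in> UNIV - {i}"
    then show "A 0 $ i $ j * d t $ j \<le> A 0 $ i $ j * e t $ j"
      using A0 de by (intro mult_left_mono) (auto simp: metzler_def)
  next
    fix k assume k: "k \<in> {1..N}"
    show "(A k *v integral {t - hbar k..t} d) $ i \<le> (A k *v integral {t - hbar k..t} e) $ i"
      unfolding matrix_vector_mult_def vec_lambda_beta
    proof (intro sum_mono mult_left_mono)
      fix j
      show "integral {t - hbar k..t} d $ j \<le> integral {t - hbar k..t} e $ j"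
        unfolding integral_nth[OF d] integral_nth[OF e]
        by (intro integral_le cts_intros d e de)
      show "0 \<le> A k $ i $ j" using A k by (auto simp: nonneg_mat_def)
    qed
  qed
  have sube: "subsolution (\<lambda>_. 0) e"
    unfolding subsolution_def
  proof (intro allI impI)
    fix i and s t :: real assume st: "0 \<le> s" "s \<le> t"
    have "max (d t $ i) 0 - max (d s $ i) 0 \<le> integral {s..t} (\<lambda>r. A 0 $ i $ i * max (d r $ i) 0 + G i r)"
    proof (rule max_differential_inequality[where q = "\<lambda>_. 0"])
      fix s' t' assume st': "s \<le> s'" "s' \<le> t'" "t' \<le> t"
      have "d t' $ i - d s' $ i \<le> integral {s'..t'} (\<lambda>\<tau>. drift A d \<tau> $ i + (0::real^'n) $ i)"
        using sub st st' by (auto simp: subsolution_def)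
      also have "\<dots> \<le> integral {s'..t'} (\<lambda>r. A 0 $ i $ i * d r $ i + G i r)"
        using le by (intro integral_le cts_intros drift_continuous d Gc) auto
      finally show "d t' $ i - d s' $ i \<le> integral {s'..t'} (\<lambda>r. A 0 $ i $ i * d r $ i + G i r)" .
      show "0 - 0 \<le> integral {s'..t'} (\<lambda>r. A 0 $ i $ i * 0 + G i r)"
        using G0 by (auto intro!: integral_nonneg cts_integrable Gc)
    qed (use st d in \<open>auto intro!: cts_integrable Gc continuous_intros intro: continuous_on_subset\<close>)
    also have "(\<lambda>r. A 0 $ i $ i * max (d r $ i) 0 + G i r) = (\<lambda>r. drift A e r $ i + (0::real^'n) $ i)"
      by (simp add: drift_nth_split G_def) (simp add: e_def)
    finally show "e t $ i - e s $ i \<le> integral {s..t} (\<lambda>\<tau>. drift A e \<tau> $ i + (0::real^'n) $ i)"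
      by (simp add: e_def)
  qed
  \<comment> \<open>Dominates every component of \<open>1 v* Ab\<close>, so the sum of the
    components of \<open>e\<close> satisfies a Gronwall inequality with zero initial value.\<close>
  define K where "K = (\<Sum>j\<in>UNIV. \<bar>(1 v* Ab) $ j\<bar>)"
  define f where "f = (\<lambda>t. 1 \<bullet> e t)"
  have fc: "cts f" unfolding f_def using e by (intro continuous_intros)
  have f0: "0 \<le> f t" for t using e0 by (auto simp: f_def inner_vec_def intro!: sum_nonneg)
  have "f t \<le> K * integral {0..t} f" if t: "0 \<le> t" for t
  proof -
    have "f t = 1 \<bullet> e t - 1 \<bullet> e 0" by (simp add: f_def ez)
    also have "\<dots> \<le> integral {0..t} (\<lambda>t. 1 \<bullet> drift A e t) + integral {0..t} (\<lambda>t. 1 \<bullet> (0::real^'n))"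
      using t by (intro subsolution_inner[OF sube e]) auto
    also have "\<dots> \<le> (1 v* Ab) \<bullet> integral {0..t} e + (\<Sum>i\<in>{1..N}. hbar i * ((1 v* A i) \<bullet> integral {- hbar i..0} e))"
      using inner_drift_integral_le[OF e e0 A _ t, of 1] by simp
    also have "(\<Sum>i\<in>{1..N}. hbar i * ((1 v* A i) \<bullet> integral {- hbar i..0} e)) = 0"
    proof (intro sum.neutral ballI)
      fix i
      have "integral {- hbar i..0} e = integral {- hbar i..0} (\<lambda>_. 0)" by (intro integral_cong) (auto simp: ez)
      then show "hbar i * ((1 v* A i) \<bullet> integral {- hbar i..0} e) = 0" by simp
    qed
    also have "(1 v* Ab) \<bullet> integral {0..t} e \<le> (\<Sum>j\<in>UNIV. K * integral {0..t} e $ j)"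
      unfolding inner_vec_def inner_real_def
    proof (intro sum_mono mult_right_mono)
      fix j
      have "(1 v* Ab) $ j \<le> \<bar>(1 v* Ab) $ j\<bar>" by simp
      also have "\<dots> \<le> K" unfolding K_def by (intro member_le_sum) auto
      finally show "(1 v* Ab) $ j \<le> K" .
      show "0 \<le> integral {0..t} e $ j" by (rule wnn)
    qed
    also have "\<dots> = K * integral {0..t} f"
    proof -
      have "integral {0..t} f = 1 \<bullet> integral {0..t} e"
        using integral_linear[OF cts_integrable[OF e] bounded_linear_inner_right[of 1]] by (simp add: f_def o_def)
      then show ?thesis by (simp add: inner_vec_def sum_distrib_left)
    qed
    finally show ?thesis by simp
  qed
  then have "f T = 0" using T f0 by (intro gronwall_zero[of T f K]) (auto intro: continuous_on_subset[OF fc])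
  then have "e T $ j = 0" using e0 unfolding f_def inner_vec_def by (simp add: sum_nonneg_eq_0_iff)
  then show ?thesis using de[of T j] by simp
qed

section \<open>Sufficiency: stability and gain bounds\<close>

lemma hmax_ge: "i \<in> {1..N} \<Longrightarrow> hbar i \<le> hm" and hmax_nonneg: "0 \<le> hm"
  unfolding hmax_def by (intro Max_ge; simp)+

text \<open>A solution is constrained only on \<open>{- hm..}\<close>; freezing it earlier gives a
  function continuous on the whole line with the same bounds on its history.\<close>

definition extend :: "(real \<Rightarrow> real^'n) \<Rightarrow> real \<Rightarrow> real^'n" where
  "extend x t = x (max t (- hm))"

definition modulus :: "(real \<Rightarrow> real^'n) \<Rightarrow> real \<Rightarrow> real^'n" where
  "modulus x t = vabs (extend x t)"

text \<open>A majorant of the moduli of the output that does not involve the actual delays, so it is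
  measurable for measurable inputs.\<close>

definition output_bound :: "(real \<Rightarrow> real^'n) \<Rightarrow> (real \<Rightarrow> real^'u) \<Rightarrow> real \<Rightarrow> real^'y" where
  "output_bound v u t = drift C v t + Fu *v vabs (u t)"

lemma extend_eq: "- hm \<le> t \<Longrightarrow> extend x t = x t"
  by (simp add: extend_def)

lemma modulus_nonneg: "0 \<le> modulus x t $ j"
  by (simp add: modulus_def)

context
  fixes dl u x
  assumes dl: "admissible dl" and sol: "solves dl u x"
begin

lemma extend_continuous: "cts (extend x)"
proof -
  have "continuous_on {- hm..} x" using sol by (simp add: is_solution_def)
  then show ?thesis unfolding extend_def
    by (rule continuous_on_compose2) (auto intro!: continuous_intros)
qed

lemma modulus_continuous: "cts (modulus x)"
  unfolding modulus_def by (intro vabs_continuous extend_continuous)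

lemma delay_bounds: "i \<in> {1..N} \<Longrightarrow> 0 \<le> t \<Longrightarrow> dl i t \<le> hbar i \<and> dl i t \<le> hm \<and> 0 \<le> dl i t"
  using dl hmax_ge[of i] by (force simp: admissible_delays_def)

lemma window_extend: "i \<in> {1..N} \<Longrightarrow> 0 \<le> t \<Longrightarrow> integral {t - dl i t..t} x = integral {t - dl i t..t} (extend x)"
  using delay_bounds[of i t] by (intro integral_cong) (auto simp: extend_eq)

lemma window_modulus:
  "i \<in> {1..N} \<Longrightarrow> 0 \<le> t \<Longrightarrow> \<bar>integral {t - dl i t..t} x $ j\<bar> \<le> integral {t - hbar i..t} (modulus x) $ j"
  unfolding window_extend modulus_def using delay_bounds[of i t]
  by (intro abs_window_le extend_continuous) simp

lemma output_le: 
  assumes t: "0 \<le> t" shows "\<bar>output dl x u t $ k\<bar> \<le> output_bound (modulus x) u t $ k"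
proof -
  have "\<bar>output dl x u t $ k\<bar>
     \<le> \<bar>(C 0 *v x t) $ k\<bar> + (\<Sum>i\<in>{1..N}. \<bar>(C i *v integral {t - dl i t..t} x) $ k\<bar>) + \<bar>(Fu *v u t) $ k\<bar>"
    unfolding sys_out_def vector_add_component sum_component
    by (intro order_trans[OF abs_triangle_ineq] add_mono sum_abs order_refl)
  also have "\<dots> \<le> (C 0 *v modulus x t) $ k + (\<Sum>i\<in>{1..N}. (C i *v integral {t - hbar i..t} (modulus x)) $ k) + (Fu *v vabs (u t)) $ k"
    using t C F hmax_nonneg
    by (intro add_mono sum_mono abs_mv_le window_modulus) (auto simp: modulus_def extend_eq)
  finally show ?thesis by (simp add: output_bound_def drift_def)
qed

lemma rhs_integral:
  assumes "0 \<le> s" "s \<le> t" shows "(sys_rhs N A Eu dl x u has_integral x t - x s) {s..t}"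
proof -
  have i: "(sys_rhs N A Eu dl x u has_integral x r - x 0) {0..r}" if "0 \<le> r" for r
    using sol that by (simp add: is_solution_def)
  from i[of t] assms have t: "sys_rhs N A Eu dl x u integrable_on {0..t}" by auto
  have "integral {s..t} (sys_rhs N A Eu dl x u) = x t - x s"
    using integral_increment[OF t, of s t] assms integral_unique[OF i[of t]] integral_unique[OF i[of s]] by simp
  then show ?thesis using integrable_subinterval_Icc[OF t, of s t] assms
    by (simp add: has_integral_integrable_integral)
qed

text \<open>The diagonal term keeps its sign and only the rest is estimated in modulus; otherwise
  the damping from a negative diagonal entry would be lost.\<close>

lemma rhs_nth_split:
  assumes t: "0 \<le> t"
  shows "\<bar>sys_rhs N A Eu dl x u t $ i - A 0 $ i $ i * extend x t $ i\<bar>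
    \<le> drift A (modulus x) t $ i - A 0 $ i $ i * modulus x t $ i + (Eu *v vabs (u t)) $ i"
proof -
  have "sys_rhs N A Eu dl x u t $ i - A 0 $ i $ i * extend x t $ i =
    (\<Sum>j\<in>UNIV - {i}. A 0 $ i $ j * x t $ j) + (\<Sum>k\<in>{1..N}. (A k *v integral {t - dl k t..t} x) $ i) + (Eu *v u t) $ i"
    using t hmax_nonneg by (simp add: sys_rhs_def matrix_vector_mult_def sum.remove[of UNIV i] extend_eq)
  also have "\<bar>\<dots>\<bar> \<le> (\<Sum>j\<in>UNIV - {i}. \<bar>A 0 $ i $ j * x t $ j\<bar>) + (\<Sum>k\<in>{1..N}. \<bar>(A k *v integral {t - dl k t..t} x) $ i\<bar>) + \<bar>(Eu *v u t) $ i\<bar>"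
    by (intro order_trans[OF abs_triangle_ineq] add_mono sum_abs order_refl)
  also have "\<dots> \<le> (\<Sum>j\<in>UNIV - {i}. A 0 $ i $ j * modulus x t $ j) + (\<Sum>k\<in>{1..N}. (A k *v integral {t - hbar k..t} (modulus x)) $ i) + (Eu *v vabs (u t)) $ i"
    using t A0 A E hmax_nonneg
    by (intro add_mono sum_mono abs_mv_le window_modulus)
       (auto simp: modulus_def extend_eq abs_mult metzler_def)
  finally show ?thesis by (simp add: drift_nth_split)
qed

text \<open>\<open>x\<close> and \<open>- x\<close> obey the same one-sided inequality with the same
  forcing \<open>G\<close>, and the modulus is their maximum.\<close>

lemma modulus_subsolution:
  assumes ui: "\<And>i T. (\<lambda>t. (Eu *v vabs (u t)) $ i) integrable_on {0..T}"
  shows "subsolution (\<lambda>t. Eu *v vabs (u t)) (modulus x)"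
  unfolding subsolution_def
proof (intro allI impI)
  fix i and s t :: real assume st: "0 \<le> s" "s \<le> t"
  define G where "G = (\<lambda>t. drift A (modulus x) t $ i - A 0 $ i $ i * modulus x t $ i + (Eu *v vabs (u t)) $ i)"
  have c: "cts (\<lambda>t. drift A (modulus x) t $ i - A 0 $ i $ i * modulus x t $ i)"
    by (intro continuous_intros drift_continuous modulus_continuous)
  have G: "G integrable_on {a..b}" if "0 \<le> a" for a b
    unfolding G_def using integrable_subinterval_Icc[OF ui[of i b] that order_refl]
    by (intro integrable_add cts_integrable[OF c])
  have cX: "cts (\<lambda>t. extend x t $ i)" by (intro continuous_intros extend_continuous)
  have inc: "((\<lambda>r. sys_rhs N A Eu dl x u r $ i) has_integral extend x b $ i - extend x a $ i) {a..b}"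
    if "0 \<le> a" "a \<le> b" for a b
    using has_integral_linear[OF rhs_integral[OF that] bounded_linear_vec_nth[of i]] that hmax_nonneg
    by (simp add: o_def extend_eq)
  have "max (extend x t $ i) (- extend x t $ i) - max (extend x s $ i) (- extend x s $ i)
     \<le> integral {s..t} (\<lambda>r. A 0 $ i $ i * max (extend x r $ i) (- extend x r $ i) + G r)"
  proof (rule max_differential_inequality)
    fix a b assume ab: "s \<le> a" "a \<le> b" "b \<le> t"
    then have a0: "0 \<le> a" using st by simp
    have int: "(\<lambda>r. A 0 $ i $ i * (k * extend x r $ i) + G r) integrable_on {a..b}" for k
      using a0 by (intro integrable_add G cts_intros cX)
    show "extend x b $ i - extend x a $ i \<le> integral {a..b} (\<lambda>r. A 0 $ i $ i * extend x r $ i + G r)"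
    proof (rule has_integral_le[OF inc[OF a0 ab(2)] integrable_integral])
      show "(\<lambda>r. A 0 $ i $ i * extend x r $ i + G r) integrable_on {a..b}" using int[of 1] by simp
      fix r assume "r \<in> {a..b}"
      then show "sys_rhs N A Eu dl x u r $ i \<le> A 0 $ i $ i * extend x r $ i + G r"
        using rhs_nth_split[of r i] a0 by (auto simp: G_def abs_le_iff)
    qed
    show "- extend x b $ i - - extend x a $ i \<le> integral {a..b} (\<lambda>r. A 0 $ i $ i * - extend x r $ i + G r)"
    proof (rule has_integral_le[OF _ integrable_integral])
      show "((\<lambda>r. - sys_rhs N A Eu dl x u r $ i) has_integral - extend x b $ i - - extend x a $ i) {a..b}"
        using has_integral_neg[OF inc[OF a0 ab(2)]] by simp
      show "(\<lambda>r. A 0 $ i $ i * - extend x r $ i + G r) integrable_on {a..b}" using int[of "-1"] by simp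
      fix r assume "r \<in> {a..b}"
      then show "- sys_rhs N A Eu dl x u r $ i \<le> A 0 $ i $ i * - extend x r $ i + G r"
        using rhs_nth_split[of r i] a0 by (auto simp: G_def abs_le_iff)
    qed
  qed (use st in \<open>auto intro!: G continuous_intros continuous_on_subset[OF extend_continuous]\<close>)
  moreover have "max (extend x r $ i) (- extend x r $ i) = modulus x r $ i" for r
    by (simp add: modulus_def abs_real_def max_def)
  ultimately show "modulus x t $ i - modulus x s $ i \<le> integral {s..t} (\<lambda>\<tau>. drift A (modulus x) \<tau> $ i + (Eu *v vabs (u \<tau>)) $ i)"
    by (simp add: G_def)
qed

end

section \<open>The L_1 gain\<close>

lemma modulus_zero:
  assumes "starts_at_0 x" "t \<le> 0" shows "modulus x t = 0"
  using assms hmax_nonneg by (simp add: modulus_def extend_def vec_eq_iff)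

lemma modulus_init_integral:
  assumes "starts_at_0 x" shows "integral {a..0} (modulus x) = 0"
proof -
  have "integral {a..0} (modulus x) = integral {a..0} (\<lambda>_. 0)"
    using modulus_zero[OF assms] by (intro integral_cong) auto
  then show ?thesis by simp
qed

lemma integral_modulus_nonneg: "cts (modulus x) \<Longrightarrow> 0 \<le> integral {a..b} (modulus x) $ j"
  unfolding integral_nth by (intro integral_nonneg cts_intros modulus_nonneg)

lemma vabs_integrable:
  assumes "\<And>j T. (\<lambda>t. \<bar>u t $ j\<bar>) integrable_on {0..T}"
  shows "(\<lambda>t. (M *v vabs (u t)) $ i) integrable_on {0..T}" "(\<lambda>t. a \<bullet> vabs (u t)) integrable_on {0..T}"
  unfolding matrix_vector_mult_def vec_lambda_beta inner_vec_def inner_real_def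
  using assms by (auto intro!: integrable_sum integrable_on_mult_right)

text \<open>Adding the balance of \<open>l \<bullet> v\<close> to the integrated output gives the
  state integral the negative coefficient \<open>l v* Ab + 1 v* Cb\<close>; dropping it leaves the
  input alone.\<close>

lemma L1_estimate:
  assumes dl: "admissible dl" and sol: "solves dl u x"
    and z: "starts_at_0 x" and ui: "\<And>j T. (\<lambda>t. \<bar>u t $ j\<bar>) integrable_on {0..T}"
    and l: "\<forall>j. 0 < l$j" and l1: "\<forall>j. (l v* Ab + 1 v* Cb) $ j < 0"
    and l2: "\<forall>j. (l v* Eu + 1 v* Fu) $ j \<le> g" and T: "0 \<le> T"
  shows "integral {0..T} (\<lambda>t. 1 \<bullet> output_bound (modulus x) u t) \<le> g * integral {0..T} (\<lambda>t. 1 \<bullet> vabs (u t))"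
proof -
  let ?v = "modulus x"
  have v: "cts ?v" by (rule modulus_continuous[OF dl sol])
  note vi = vabs_integrable[OF ui]
  have z0: "?v 0 = 0" by (rule modulus_zero[OF z]) simp
  have sub: "subsolution (\<lambda>t. Eu *v vabs (u t)) ?v" by (rule modulus_subsolution[OF dl sol vi(1)])
  have Cn: "\<forall>i\<in>{1..N}. nonneg_mat (C i)" using C by auto
  have "0 \<le> l \<bullet> ?v T" using l modulus_nonneg by (auto simp: inner_vec_def less_imp_le intro!: sum_nonneg)
  also have "\<dots> \<le> integral {0..T} (\<lambda>t. l \<bullet> drift A ?v t) + integral {0..T} (\<lambda>t. l \<bullet> (Eu *v vabs (u t)))"
    using subsolution_inner[OF sub v vi(1) _ T, of l] l by (simp add: z0 less_imp_le)
  also have "integral {0..T} (\<lambda>t. l \<bullet> drift A ?v t) \<le> (l v* Ab) \<bullet> integral {0..T} ?v"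
    using inner_drift_integral_le[OF v modulus_nonneg A _ T, of l] l by (simp add: modulus_init_integral[OF z] less_imp_le)
  finally have 1: "0 \<le> (l v* Ab) \<bullet> integral {0..T} ?v + integral {0..T} (\<lambda>t. (l v* Eu) \<bullet> vabs (u t))"
    by (simp add: dot_lmul_matrix)
  have "integral {0..T} (\<lambda>t. 1 \<bullet> output_bound ?v u t)
      = integral {0..T} (\<lambda>t. 1 \<bullet> drift C ?v t) + integral {0..T} (\<lambda>t. (1 v* Fu) \<bullet> vabs (u t))"
    unfolding output_bound_def inner_add_right dot_lmul_matrix[symmetric]
    by (intro integral_add vi cts_intros drift_continuous v)
  also have "integral {0..T} (\<lambda>t. 1 \<bullet> drift C ?v t) \<le> (1 v* Cb) \<bullet> integral {0..T} ?v"
    using inner_drift_integral_le[OF v modulus_nonneg Cn _ T, of 1] by (simp add: modulus_init_integral[OF z])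
  finally have "integral {0..T} (\<lambda>t. 1 \<bullet> output_bound ?v u t)
      \<le> (l v* Ab + 1 v* Cb) \<bullet> integral {0..T} ?v + integral {0..T} (\<lambda>t. (l v* Eu + 1 v* Fu) \<bullet> vabs (u t))"
    using 1 integral_add[OF vi(2)[of "l v* Eu" T] vi(2)[of "1 v* Fu" T]] by (simp add: inner_add_left)
  also have "(l v* Ab + 1 v* Cb) \<bullet> integral {0..T} ?v \<le> 0"
    unfolding inner_vec_def inner_real_def using l1 integral_modulus_nonneg[OF v]
    by (intro sum_nonpos mult_nonpos_nonneg) (auto simp: less_imp_le)
  also have "integral {0..T} (\<lambda>t. (l v* Eu + 1 v* Fu) \<bullet> vabs (u t)) \<le> integral {0..T} (\<lambda>t. (g *\<^sub>R 1) \<bullet> vabs (u t))"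
    using l2 by (intro integral_le vi) (auto simp: inner_vec_def intro!: sum_mono mult_right_mono)
  finally show ?thesis by simp
qed

lemma output_bound_nonneg: "cts (modulus x) \<Longrightarrow> 0 \<le> output_bound (modulus x) u t $ k"
  unfolding output_bound_def drift_def vector_add_component sum_component
  using C F by (intro add_nonneg_nonneg sum_nonneg nonneg_mat_mv) (auto simp: modulus_nonneg integral_modulus_nonneg)

lemma output_bound_measurable:
  assumes v: "cts v" and u: "u \<in> borel_measurable lborel"
  shows "(\<lambda>t. output_bound v u t $ k) \<in> borel_measurable borel"
proof -
  have "(\<lambda>t. (Fu *v vabs (u t)) $ k) \<in> borel_measurable borel"
    using borel_measurable_nth[OF u] unfolding matrix_vector_mult_def vec_lambda_beta by simp
  moreover have "(\<lambda>t. drift C v t $ k) \<in> borel_measurable borel"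
    by (intro borel_measurable_continuous_onI continuous_intros drift_continuous v)
  ultimately show ?thesis by (simp add: output_bound_def)
qed

theorem L1_gain:
  assumes dl: "admissible dl"
    and l: "\<forall>j. 0 < l$j" and l1: "\<forall>j. (l v* Ab + 1 v* Cb) $ j < 0"
    and l2: "\<forall>j. (l v* Eu + 1 v* Fu) $ j < \<gamma>"
  shows "L1_gain_lt N hbar A Eu C Fu dl \<gamma>"
proof -
  \<comment> \<open>The largest of finitely many column values is attained, hence still below
    \<open>\<gamma>\<close>.\<close>
  define g where "g = Max (range (\<lambda>j. (l v* Eu + 1 v* Fu) $ j))"
  have gj: "\<forall>j. (l v* Eu + 1 v* Fu) $ j \<le> g" by (simp add: g_def)
  have "g \<in> range (\<lambda>j. (l v* Eu + 1 v* Fu) $ j)" unfolding g_def by (intro Max_in) auto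
  then have gg: "g < \<gamma>" using l2 by auto
  \<comment> \<open>Any column shows that \<open>g\<close> is nonnegative; \<open>undefined\<close>
    is just some index.\<close>
  have "0 \<le> (l v* Eu + 1 v* Fu) $ undefined"
    using l E F by (auto intro!: add_nonneg_nonneg nonneg_mat_vm simp: less_imp_le)
  then have g0: "0 \<le> g" using gj by (meson order_trans)
  show ?thesis unfolding L1_gain_lt_def
  proof (intro exI[of _ g] conjI allI impI g0 gg; elim conjE)
    fix u x assume u: "u \<in> borel_measurable lborel"
      and fin: "ray_integral (\<lambda>t. vnorm1 (u t)) < \<infinity>"
      and sol: "solves dl u x" and z: "starts_at_0 x"
    let ?v = "modulus x"
    have v: "cts ?v" by (rule modulus_continuous[OF dl sol])
    have vn: "vnorm1 (u t) = 1 \<bullet> vabs (u t)" for t by (simp add: vnorm1_def inner_vec_def)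
    have um: "(\<lambda>t. vnorm1 (u t)) \<in> borel_measurable borel"
      using borel_measurable_nth[OF u] unfolding vnorm1_def by simp
    have u0: "0 \<le> vnorm1 (u t)" for t by (auto simp: vnorm1_def intro!: sum_nonneg)
    note ufin = nn_integral_Ici_finite[OF um u0 fin]
    have ui: "(\<lambda>t. \<bar>u t $ j\<bar>) integrable_on {0..T}" for j T
    proof (rule borel_bounded_integrable[OF _ ufin(1)])
      show "(\<lambda>t. \<bar>u t $ j\<bar>) \<in> borel_measurable borel" using borel_measurable_nth[OF u] by simp
      show "\<bar>\<bar>u t $ j\<bar>\<bar> \<le> vnorm1 (u t)" for t unfolding vnorm1_def by (auto intro: member_le_sum)
    qed
    show "ray_integral (\<lambda>t. vnorm1 (output dl x u t)) \<le> ennreal g * ray_integral (\<lambda>t. vnorm1 (u t))"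
    proof (rule ray_integral_gain_le[OF _ _ um u0 fin g0])
      let ?y = "\<lambda>t. 1 \<bullet> output_bound ?v u t"
      show "?y \<in> borel_measurable borel"
        unfolding inner_vec_def using output_bound_measurable[OF v u] by simp
      show "0 \<le> ?y t" for t using output_bound_nonneg[OF v] by (auto simp: inner_vec_def intro!: sum_nonneg)
      show "vnorm1 (output dl x u t) \<le> ?y t" if "0 \<le> t" for t
        using output_le[OF dl sol that] by (auto simp: vnorm1_def inner_vec_def intro!: sum_mono)
      fix T :: real assume T: "0 \<le> T"
      show "?y integrable_on {0..T}"
        unfolding output_bound_def inner_add_right dot_lmul_matrix[symmetric]
        by (intro integrable_add vabs_integrable ui cts_intros drift_continuous v)
      show "integral {0..T} ?y \<le> g * integral {0..T} (\<lambda>t. vnorm1 (u t))"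
        unfolding vn by (rule L1_estimate[OF dl sol z ui l l1 gj T])
    qed
  qed
qed

section \<open>Asymptotic stability\<close>

text \<open>One bound, proportional to the size \<open>S\<close> of the history, controls the
  current state and the integral of its modulus: the first yields stability, the second feeds the
  convergence argument.\<close>

lemma zero_input_estimate:
  assumes dl: "admissible dl" and sol: "solves dl (\<lambda>_. 0) x"
    and l: "\<forall>j. 0 < l$j" and m: "\<forall>j. m \<le> - (l v* Ab) $ j" and m0: "0 \<le> m"
    and S: "\<And>s j. s \<le> 0 \<Longrightarrow> modulus x s $ j \<le> S" and T: "0 \<le> T"
  shows "l \<bullet> modulus x T + m * (\<Sum>j\<in>UNIV. integral {0..T} (modulus x) $ j)
    \<le> S * (l \<bullet> 1 + (\<Sum>i\<in>{1..N}. hbar i * (hbar i * ((l v* A i) \<bullet> 1))))"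
proof -
  let ?v = "modulus x"
  have v: "cts ?v" by (rule modulus_continuous[OF dl sol])
  have v0: "vabs (0::real^'u) = 0" by (simp add: vec_eq_iff)
  have sub: "subsolution (\<lambda>t. Eu *v vabs 0) ?v"
    by (rule modulus_subsolution[OF dl sol]) (simp add: v0 integrable_0)
  have l0: "\<forall>j. 0 \<le> l $ j" using l by (simp add: less_imp_le)
  have "l \<bullet> ?v T - l \<bullet> ?v 0 \<le> integral {0..T} (\<lambda>t. l \<bullet> drift A ?v t)"
    using subsolution_inner[OF sub v _ l0 T] by (simp add: v0 integrable_0)
  also have "\<dots> \<le> (l v* Ab) \<bullet> integral {0..T} ?v + (\<Sum>i\<in>{1..N}. hbar i * ((l v* A i) \<bullet> integral {- hbar i..0} ?v))"
    by (rule inner_drift_integral_le[OF v modulus_nonneg A l0 T])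
  also have "(l v* Ab) \<bullet> integral {0..T} ?v \<le> (\<Sum>j\<in>UNIV. - m * integral {0..T} ?v $ j)"
    unfolding inner_vec_def inner_real_def using m integral_modulus_nonneg[OF v]
    by (intro sum_mono mult_right_mono) (auto simp: le_minus_iff)
  also have "(\<Sum>i\<in>{1..N}. hbar i * ((l v* A i) \<bullet> integral {- hbar i..0} ?v)) \<le> (\<Sum>i\<in>{1..N}. hbar i * ((l v* A i) \<bullet> ((hbar i * S) *\<^sub>R 1)))"
  proof (intro sum_mono mult_left_mono)
    fix i assume i: "i \<in> {1..N}"
    then show "0 \<le> hbar i" using h by blast
    show "(l v* A i) \<bullet> integral {- hbar i..0} ?v \<le> (l v* A i) \<bullet> ((hbar i * S) *\<^sub>R 1)"
      unfolding inner_vec_def inner_real_def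
    proof (intro sum_mono mult_left_mono)
      fix j
      show "0 \<le> (l v* A i) $ j" using i A l0 by (intro nonneg_mat_vm) auto
      show "integral {- hbar i..0} ?v $ j \<le> ((hbar i * S) *\<^sub>R 1) $ j"
        using window_le_const[OF v, of "hbar i" 0 j "S *\<^sub>R 1"] S h i by auto
    qed
  qed
  finally have *: "l \<bullet> ?v T - l \<bullet> ?v 0 \<le> (\<Sum>j\<in>UNIV. - m * integral {0..T} ?v $ j) + (\<Sum>i\<in>{1..N}. hbar i * ((l v* A i) \<bullet> ((hbar i * S) *\<^sub>R 1)))"
    by simp
  have "l \<bullet> ?v 0 \<le> l \<bullet> (S *\<^sub>R 1)"
    unfolding inner_vec_def inner_real_def using S l0 by (intro sum_mono mult_left_mono) auto
  with * show ?thesis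
    by (simp add: sum_negf sum_distrib_left algebra_simps)
qed

theorem asymptotic_stability:
  assumes dl: "admissible dl"
    and l: "\<forall>j. 0 < l$j" and l1: "\<forall>j. (l v* Ab) $ j < 0"
  shows "stable_for dl"
proof -
  define m where "m = Min (range (\<lambda>j. - (l v* Ab) $ j))"
  have mj: "\<forall>j. m \<le> - (l v* Ab) $ j" by (simp add: m_def)
  have "m \<in> range (\<lambda>j. - (l v* Ab) $ j)" unfolding m_def by (intro Min_in) auto
  then have m0: "0 < m" using l1 by auto
  define q where "q = Min (range (\<lambda>j. l $ j))"
  have qj: "q \<le> l $ j" for j by (simp add: q_def)
  have "q \<in> range (\<lambda>j. l $ j)" unfolding q_def by (intro Min_in) auto
  then have q0: "0 < q" using l by auto
  define \<kappa> where "\<kappa> = l \<bullet> 1 + (\<Sum>i\<in>{1..N}. hbar i * (hbar i * ((l v* A i) \<bullet> 1)))"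
  have k0: "0 \<le> \<kappa>"
    unfolding \<kappa>_def inner_vec_def inner_real_def using l A h
    by (intro add_nonneg_nonneg sum_nonneg mult_nonneg_nonneg nonneg_mat_vm) (auto simp: less_imp_le)
  have est: "q * norm (x T) \<le> S * \<kappa>" "m * integral {0..T} (\<lambda>t. modulus x t $ j) \<le> S * \<kappa>"
    if sol: "solves dl (\<lambda>_. 0) x" and S: "\<And>s j. s \<le> 0 \<Longrightarrow> modulus x s $ j \<le> S" and T: "0 \<le> T" for x S T j
  proof -
    have v: "cts (modulus x)" by (rule modulus_continuous[OF dl sol])
    have e: "l \<bullet> modulus x T + m * (\<Sum>j\<in>UNIV. integral {0..T} (modulus x) $ j) \<le> S * \<kappa>"
      unfolding \<kappa>_def by (rule zero_input_estimate[OF dl sol l mj less_imp_le[OF m0] S T])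
    have s: "integral {0..T} (modulus x) $ j \<le> (\<Sum>j\<in>UNIV. integral {0..T} (modulus x) $ j)"
      using integral_modulus_nonneg[OF v] by (intro member_le_sum) auto
    have i0: "0 \<le> integral {0..T} (modulus x) $ j" by (rule integral_modulus_nonneg[OF v])
    have "q * norm (x T) \<le> q * (\<Sum>j\<in>UNIV. \<bar>x T $ j\<bar>)"
      using q0 by (intro mult_left_mono norm_le_l1_cart) auto
    also have "\<dots> \<le> l \<bullet> modulus x T"
      unfolding inner_vec_def inner_real_def sum_distrib_left using T hmax_nonneg qj
      by (intro sum_mono mult_mono) (auto simp: modulus_def extend_eq l less_imp_le)
    finally have n: "q * norm (x T) \<le> l \<bullet> modulus x T" .
    have "0 \<le> m * (\<Sum>j\<in>UNIV. integral {0..T} (modulus x) $ j)" using m0 i0 s by simp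
    then show "q * norm (x T) \<le> S * \<kappa>" using n e by linarith
    have "m * integral {0..T} (modulus x) $ j \<le> m * (\<Sum>j\<in>UNIV. integral {0..T} (modulus x) $ j)"
      using m0 s by simp
    moreover have "0 \<le> l \<bullet> modulus x T" using n q0 by (meson order_trans mult_nonneg_nonneg less_imp_le norm_ge_zero)
    ultimately show "m * integral {0..T} (\<lambda>t. modulus x t $ j) \<le> S * \<kappa>"
      using e by (simp add: integral_nth[OF v])
  qed
  show ?thesis unfolding asymp_stable_def
  proof (intro conjI allI impI)
    fix \<epsilon> :: real assume eps: "0 < \<epsilon>"
    \<comment> \<open>The denominator \<open>\<kappa> + 1\<close> avoids division by
      \<open>\<kappa>\<close>, known only to be nonnegative, and makes
      \<open>\<delta> * \<kappa> < q * \<epsilon>\<close> strict.\<close>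
    define \<delta> where "\<delta> = q * \<epsilon> / (\<kappa> + 1)"
    have d: "0 < \<delta>" using q0 eps k0 by (simp add: \<delta>_def)
    have "\<delta> * \<kappa> < \<delta> * (\<kappa> + 1)" using d by simp
    also have "\<dots> = q * \<epsilon>" using k0 by (simp add: \<delta>_def)
    finally have dk: "\<delta> * \<kappa> < q * \<epsilon>" .
    show "\<exists>\<delta>>0. \<forall>x. solves dl (\<lambda>_. 0) x \<and> (\<forall>s\<in>{- hm..0}. norm (x s) < \<delta>) \<longrightarrow> (\<forall>t\<ge>0. norm (x t) < \<epsilon>)"
    proof (intro exI[of _ \<delta>] conjI d allI impI; elim conjE)
      fix x t assume sol: "solves dl (\<lambda>_. 0) x" and init: "\<forall>s\<in>{- hm..0}. norm (x s) < \<delta>" and t: "0 \<le> (t::real)"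
      have "modulus x s $ j \<le> \<delta>" if "s \<le> 0" for s j
      proof -
        have "norm (extend x s) < \<delta>" unfolding extend_def using init that hmax_nonneg by auto
        then show ?thesis using component_le_norm_cart[of "extend x s" j] by (simp add: modulus_def)
      qed
      from est(1)[OF sol this t] dk have "q * norm (x t) < q * \<epsilon>" by simp
      then show "norm (x t) < \<epsilon>" using q0 by simp
    qed
  next
    fix x assume sol: "solves dl (\<lambda>_. 0) x"
    have v: "cts (modulus x)" by (rule modulus_continuous[OF dl sol])
    have "continuous_on {- hm..0} x" using sol by (auto simp: is_solution_def intro: continuous_on_subset)
    then have "bounded (x ` {- hm..0})" by (intro compact_imp_bounded compact_continuous_image) auto
    then obtain S where "\<forall>y\<in>x ` {- hm..0}. norm y \<le> S" unfolding bounded_iff by blast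
    then have S: "\<And>s. s \<in> {- hm..0} \<Longrightarrow> norm (x s) \<le> S" by blast
    have S0: "0 \<le> S" using order_trans[OF norm_ge_zero S[of 0]] hmax_nonneg by simp
    have Sm: "modulus x s $ j \<le> S" if "s \<le> 0" for s j
    proof -
      have "norm (extend x s) \<le> S" unfolding extend_def using that hmax_nonneg by (intro S) auto
      then show ?thesis using component_le_norm_cart[of "extend x s" j] by (simp add: modulus_def)
    qed
    define b where "b = S + S * \<kappa> / q"
    have b: "modulus x t $ j \<le> b" for t j
    proof (cases "t \<le> 0")
      case True
      then show ?thesis using Sm[OF True, of j] S0 k0 q0 unfolding b_def by (smt (verit) divide_nonneg_pos mult_nonneg_nonneg)
    next
      case False
      have "norm (x t) \<le> S * \<kappa> / q" using est(1)[OF sol Sm, of t] False q0 by (simp add: field_simps)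
      moreover have "modulus x t $ j \<le> norm (x t)"
        using component_le_norm_cart[of "x t" j] False hmax_nonneg by (simp add: modulus_def extend_eq)
      ultimately show ?thesis using S0 by (simp add: b_def)
    qed
    have b0: "0 \<le> b" using b[of 0] modulus_nonneg[of x 0] by (meson order_trans)
    have vz: "vabs (0::real^'u) = 0" by (simp add: vec_eq_iff)
    have sub: "subsolution (\<lambda>t. Eu *v vabs 0) (modulus x)"
      by (rule modulus_subsolution[OF dl sol]) (simp add: vz integrable_0)
    have "((\<lambda>t. modulus x t $ i) \<longlongrightarrow> 0) at_top" for i
    proof -
      \<comment> \<open>The bound \<open>b\<close> on the modulus bounds its drift from above, hence
        its upward speed; the final \<open>1\<close> makes \<open>M\<close> positive.\<close>
      define M where "M = (\<Sum>j\<in>UNIV. \<bar>A 0 $ i $ j\<bar> * b) + (\<Sum>k\<in>{1..N}. (A k *v ((hbar k * b) *\<^sub>R 1)) $ i) + 1"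
      have dr: "drift A (modulus x) t $ i \<le> M" for t
      proof -
        have "(A 0 *v modulus x t) $ i \<le> (\<Sum>j\<in>UNIV. \<bar>A 0 $ i $ j\<bar> * b)"
          unfolding matrix_vector_mult_def vec_lambda_beta
          using b modulus_nonneg by (intro sum_mono mult_mono) auto
        moreover have "(\<Sum>k\<in>{1..N}. (A k *v integral {t - hbar k..t} (modulus x)) $ i) \<le> (\<Sum>k\<in>{1..N}. (A k *v ((hbar k * b) *\<^sub>R 1)) $ i)"
        proof (intro sum_mono mv_mono)
          fix k j assume k: "k \<in> {1..N}"
          show "nonneg_mat (A k)" using A k by auto
          show "integral {t - hbar k..t} (modulus x) $ j \<le> ((hbar k * b) *\<^sub>R 1) $ j"
            using window_le_const[OF v, of "hbar k" t j "b *\<^sub>R 1"] b h k by auto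
        qed
        ultimately show ?thesis by (simp add: drift_def M_def)
      qed
      have M0: "0 < M" unfolding M_def
        using b0 A h by (intro add_nonneg_pos add_nonneg_nonneg sum_nonneg nonneg_mat_mv) auto
      show ?thesis
      proof (rule barbalat_onesided[OF _ modulus_nonneg M0])
        show "continuous_on {0..} (\<lambda>t. modulus x t $ i)"
          by (intro continuous_intros continuous_on_subset[OF v]) auto
        show "integral {0..T} (\<lambda>t. modulus x t $ i) \<le> S * \<kappa> / m" if "0 \<le> T" for T
          using est(2)[OF sol Sm that] m0 by (simp add: field_simps)
        fix s t :: real assume st: "0 \<le> s" "s \<le> t"
        have "modulus x t $ i - modulus x s $ i \<le> integral {s..t} (\<lambda>t. drift A (modulus x) t $ i)"
          using sub st by (simp add: subsolution_def vz)
        also have "\<dots> \<le> integral {s..t} (\<lambda>_. M)"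
          using dr by (intro integral_le cts_intros drift_continuous v) auto
        finally show "modulus x t $ i - modulus x s $ i \<le> M * (t - s)" using st by (simp add: mult.commute)
      qed
    qed
    then have "((\<lambda>t. extend x t $ i) \<longlongrightarrow> 0) at_top" for i
      by (simp add: modulus_def tendsto_rabs_zero_iff)
    then have "(extend x \<longlongrightarrow> 0) at_top" by (intro vec_tendstoI) simp
    moreover have "\<forall>\<^sub>F t in at_top. extend x t = x t"
      using eventually_ge_at_top[of "- hm"] by eventually_elim (rule extend_eq)
    ultimately show "(x \<longlongrightarrow> 0) at_top" by (rule Lim_transform_eventually)
  qed
qed

section \<open>The L_infinity gain\<close>

lemma drift_diff_const:
  assumes v: "cts v"
  shows "drift M (\<lambda>t. v t - w) t = drift M v t - Abar N hbar M *v (w::real^'n)"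
proof -
  have "integral {t - hbar i..t} (\<lambda>t. v t - w) = integral {t - hbar i..t} v - hbar i *\<^sub>R w" if "i \<in> {1..N}" for i
    using h that integral_diff[OF cts_integrable[OF v] cts_integrable[of "\<lambda>_. w"]] by simp
  then show ?thesis
    by (simp add: drift_def Abar_mv matrix_vector_mult_diff_distrib matrix_vector_mult_scaleR sum_subtractf)
qed

text \<open>On constants the drift is multiplication by \<open>Ab\<close>, so the difference from
  the constant supersolution \<open>w\<close> is a subsolution without forcing and with nonpositive
  history.\<close>

lemma subsolution_const_bound:
  assumes v: "cts v" and sub: "subsolution r v"
    and ri: "\<And>i T. (\<lambda>t. r t $ i) integrable_on {0..T}"
    and w: "\<And>t i. 0 \<le> t \<Longrightarrow> (Ab *v w) $ i + r t $ i \<le> 0"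
    and init: "\<And>t j. t \<le> 0 \<Longrightarrow> v t $ j \<le> w $ j" and T: "0 \<le> T"
  shows "v T $ j \<le> w $ j"
proof -
  let ?d = "\<lambda>t. v t - w"
  have d: "cts ?d" using v by (intro continuous_intros)
  have "subsolution (\<lambda>_. 0) ?d" unfolding subsolution_def
  proof (intro allI impI)
    fix i and s t :: real assume st: "0 \<le> s" "s \<le> t"
    have "?d t $ i - ?d s $ i \<le> integral {s..t} (\<lambda>\<tau>. drift A v \<tau> $ i + r \<tau> $ i)"
      using sub st by (simp add: subsolution_def)
    also have "\<dots> \<le> integral {s..t} (\<lambda>\<tau>. drift A ?d \<tau> $ i + (0::real^'n) $ i)"
    proof (rule integral_le)
      show "(\<lambda>\<tau>. drift A v \<tau> $ i + r \<tau> $ i) integrable_on {s..t}"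
        using integrable_subinterval_Icc[OF ri[of i t] st(1) order_refl] v
        by (intro integrable_add) (auto intro!: cts_intros drift_continuous)
      show "(\<lambda>\<tau>. drift A ?d \<tau> $ i + (0::real^'n) $ i) integrable_on {s..t}"
        by (intro cts_intros drift_continuous v)
      fix x assume "x \<in> {s..t}"
      then show "drift A v x $ i + r x $ i \<le> drift A ?d x $ i + (0::real^'n) $ i"
        using w[of x i] st by (simp add: drift_diff_const[OF v])
    qed
    finally show "?d t $ i - ?d s $ i \<le> integral {s..t} (\<lambda>\<tau>. drift A ?d \<tau> $ i + (0::real^'n) $ i)" .
  qed
  from subsolution_nonpos[OF d this _ T] init show ?thesis by simp
qed

lemma Linf_pointwise:
  assumes dl: "admissible dl" and sol: "solves dl u x"
    and z: "starts_at_0 x" and u: "u \<in> borel_measurable lborel" and uc: "\<And>t j. \<bar>u t $ j\<bar> \<le> c"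
    and l: "\<forall>j. 0 < l$j" and l1: "\<forall>j. (Ab *v l + Eu *v 1) $ j < 0" and T: "0 \<le> T"
  shows "\<bar>output dl x u T $ k\<bar> \<le> c * (Cb *v l + Fu *v 1) $ k"
proof -
  let ?v = "modulus x"
  have v: "cts ?v" by (rule modulus_continuous[OF dl sol])
  have c0: "0 \<le> c" using uc abs_ge_zero by (meson order_trans)
  have ui: "(\<lambda>t. \<bar>u t $ j\<bar>) integrable_on {0..T}" for j T
  proof (rule borel_bounded_integrable[where g = "\<lambda>_. c"])
    show "(\<lambda>t. \<bar>u t $ j\<bar>) \<in> borel_measurable borel" using borel_measurable_nth[OF u] by simp
  qed (use uc in auto)
  note vi = vabs_integrable[OF ui]
  have Eb: "(Eu *v vabs (u t)) $ i \<le> (Eu *v (c *\<^sub>R 1)) $ i" for t i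
    using uc by (intro mv_mono E) simp
  have vl: "?v t $ j \<le> (c *\<^sub>R l) $ j" for t j
  proof (cases "t \<le> 0")
    case True
    then show ?thesis using modulus_zero[OF z True] c0 l by (simp add: less_imp_le)
  next
    case False
    show ?thesis
    proof (rule subsolution_const_bound[OF v modulus_subsolution[OF dl sol vi(1)] vi(1)])
      fix t i
      have "c * (Ab *v l + Eu *v 1) $ i \<le> 0" using c0 l1 by (simp add: mult_nonneg_nonpos less_imp_le)
      then show "(Ab *v (c *\<^sub>R l)) $ i + (Eu *v vabs (u t)) $ i \<le> 0"
        using Eb[of t i]
        by (simp add: matrix_vector_mult_scaleR distrib_left)
    next
      fix t j assume "t \<le> (0::real)"
      then show "?v t $ j \<le> (c *\<^sub>R l) $ j" using modulus_zero[OF z] c0 l by (simp add: less_imp_le)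
    qed (use False in simp)
  qed
  have "drift C ?v T $ k \<le> (C 0 *v (c *\<^sub>R l)) $ k + (\<Sum>i\<in>{1..N}. (C i *v (hbar i *\<^sub>R (c *\<^sub>R l))) $ k)"
    unfolding drift_def vector_add_component sum_component
  proof (intro add_mono sum_mono mv_mono vl)
    show "nonneg_mat (C 0)" using C by auto
    fix i j assume i: "i \<in> {1..N}"
    then show "nonneg_mat (C i)" using C by auto
    show "integral {T - hbar i..T} ?v $ j \<le> (hbar i *\<^sub>R (c *\<^sub>R l)) $ j"
      using h i vl by (intro window_le_const v) auto
  qed
  also have "\<dots> = c * (Cb *v l) $ k"
    by (simp add: Abar_mv matrix_vector_mult_scaleR distrib_left sum_distrib_left mult_ac)
  finally have 1: "drift C ?v T $ k \<le> c * (Cb *v l) $ k" .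
  have 2: "(Fu *v vabs (u T)) $ k \<le> c * (Fu *v 1) $ k"
    using mv_mono[OF F, of "vabs (u T)" "c *\<^sub>R 1" k] uc by (simp add: matrix_vector_mult_scaleR)
  show ?thesis using output_le[OF dl sol T, of k] 1 2 by (simp add: output_bound_def distrib_left)
qed

lemma vnorm_inf_le_iff: "vnorm_inf (x::real^'k) \<le> c \<longleftrightarrow> (\<forall>j. \<bar>x $ j\<bar> \<le> c)"
  by (simp add: vnorm_inf_def)

theorem Linf_gain:
  assumes dl: "admissible dl"
    and l: "\<forall>j. 0 < l$j" and l1: "\<forall>j. (Ab *v l + Eu *v 1) $ j < 0"
    and l2: "\<forall>j. (Cb *v l + Fu *v 1) $ j < \<gamma>"
  shows "Linf_gain_lt N hbar A Eu C Fu dl \<gamma>"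
proof -
  define g where "g = Max (range (\<lambda>j. (Cb *v l + Fu *v 1) $ j))"
  have gj: "(Cb *v l + Fu *v 1) $ j \<le> g" for j by (simp add: g_def)
  have "g \<in> range (\<lambda>j. (Cb *v l + Fu *v 1) $ j)" unfolding g_def by (intro Max_in) auto
  then have gg: "g < \<gamma>" using l2 by auto
  have "0 \<le> (Cb *v l + Fu *v 1) $ undefined"
    using l F Cb_nonneg by (auto intro!: add_nonneg_nonneg nonneg_mat_mv simp: less_imp_le)
  then have g0: "0 \<le> g" using gj by (meson order_trans)
  show ?thesis unfolding Linf_gain_lt_def
  proof (intro exI[of _ g] conjI allI impI g0 gg; elim conjE)
    fix u x c assume u: "u \<in> borel_measurable lborel"
      and ae: "AE t in lborel. 0 \<le> t \<longrightarrow> vnorm_inf (u t) \<le> c"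
      and sol: "solves dl u x" and z: "starts_at_0 x"
    obtain Z where Z: "Z \<in> null_sets lborel" "\<And>t. 0 \<le> t \<Longrightarrow> t \<notin> Z \<Longrightarrow> vnorm_inf (u t) \<le> c"
      using ae unfolding eventually_ae_filter by auto
    have nZ: "negligible Z" using Z(1) by (simp add: negligible_iff_null_sets null_sets_completionI)
    \<comment> \<open>At such a time \<open>c\<close> dominates an actual norm, which gives
      \<open>0 \<le> c\<close>.\<close>
    have "\<exists>t. 0 \<le> t \<and> t \<notin> Z"
    proof (rule ccontr)
      assume "\<not> (\<exists>t. 0 \<le> t \<and> t \<notin> Z)"
      then have "negligible {0..1::real}" by (intro negligible_subset[OF nZ]) auto
      then show False using negligible_interval(1)[of 0 "1::real"] by simp
    qed
    then have c0: "0 \<le> c" using Z(2) by (metis vnorm_inf_le_iff abs_ge_zero order_trans)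
    \<comment> \<open>Changing the input on a null set and at negative times preserves the integral
      equation and makes the essential bound hold everywhere.\<close>
    define u' where "u' = (\<lambda>t. if t \<in> {0..} - Z then u t else 0)"
    have u'm: "u' \<in> borel_measurable lborel"
      unfolding u'_def using u Z(1) by (intro measurable_If_set) auto
    have u'c: "\<bar>u' t $ j\<bar> \<le> c" for t j using c0 Z(2) by (auto simp: u'_def vnorm_inf_le_iff)
    have "solves dl u' x"
      using sol unfolding is_solution_def
    proof (elim conjE, intro conjI allI impI)
      fix t :: real assume t: "0 \<le> t" and *: "\<forall>t\<ge>0. (sys_rhs N A Eu dl x u has_integral x t - x 0) {0..t}"
      show "(sys_rhs N A Eu dl x u' has_integral x t - x 0) {0..t}"
      proof (rule has_integral_spike[OF nZ])
        show "(sys_rhs N A Eu dl x u has_integral x t - x 0) {0..t}" using * t by blast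
        fix s assume "s \<in> {0..t} - Z"
        then show "sys_rhs N A Eu dl x u' s = sys_rhs N A Eu dl x u s" by (simp add: sys_rhs_def u'_def)
      qed
    qed
    note P = Linf_pointwise[OF dl this z u'm u'c l l1]
    show "AE t in lborel. 0 \<le> t \<longrightarrow> vnorm_inf (output dl x u t) \<le> g * c"
      using AE_not_in[OF Z(1)]
    proof eventually_elim
      case (elim t)
      show ?case
      proof
        assume t: "0 \<le> t"
        then have "u' t = u t" using elim by (simp add: u'_def)
        then have eq: "output dl x u' t = output dl x u t" by (simp add: sys_out_def)
        show "vnorm_inf (output dl x u t) \<le> g * c"
          unfolding vnorm_inf_le_iff
        proof
          fix j
          have "\<bar>output dl x u t $ j\<bar> \<le> c * (Cb *v l + Fu *v 1) $ j"
            using P[OF t, of j] by (simp add: eq)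
          also have "\<dots> \<le> c * g" using c0 gj by (intro mult_left_mono)
          finally show "\<bar>output dl x u t $ j\<bar> \<le> g * c" by (simp add: mult.commute)
        qed
      qed
    qed
  qed
qed

section \<open>The L_2 gain\<close>

text \<open>Averaging over a window contracts the L_2 norm for zero history: Jensen's inequality,
  then the double integral bound. For \<open>H = 0\<close> the average is 0 because
  \<open>inverse 0 = 0\<close>.\<close>

lemma window_average:
  fixes v :: "real \<Rightarrow> real^'n"
  assumes v: "cts v" and z: "\<And>t j. t \<le> 0 \<Longrightarrow> v t $ j = 0" and H: "0 \<le> H" and T: "0 \<le> T"
  shows "cts (\<lambda>t. inverse H *\<^sub>R integral {t - H..t} v)"
    "integral {0..T} (\<lambda>t. ((inverse H *\<^sub>R integral {t - H..t} v) $ j)\<^sup>2) \<le> integral {0..T} (\<lambda>t. (v t $ j)\<^sup>2)"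
proof -
  show c: "cts (\<lambda>t. inverse H *\<^sub>R integral {t - H..t} v)"
    by (intro continuous_on_scaleR continuous_on_const window_integral_continuous v)
  have vj: "cts (\<lambda>t. v t $ j)" using v by (intro continuous_intros)
  have vj2: "cts (\<lambda>t. (v t $ j)\<^sup>2)" by (intro continuous_on_power vj)
  show "integral {0..T} (\<lambda>t. ((inverse H *\<^sub>R integral {t - H..t} v) $ j)\<^sup>2) \<le> integral {0..T} (\<lambda>t. (v t $ j)\<^sup>2)"
  proof (cases "H = 0")
    case True
    then show ?thesis by (auto intro!: integral_nonneg cts_integrable vj2)
  next
    case False
    then have Hp: "0 < H" using H by simp
    have "integral {0..T} (\<lambda>t. ((inverse H *\<^sub>R integral {t - H..t} v) $ j)\<^sup>2)
       \<le> integral {0..T} (\<lambda>t. inverse H * integral {t - H..t} (\<lambda>s. (v s $ j)\<^sup>2))"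
    proof (rule integral_le)
      show "(\<lambda>t. ((inverse H *\<^sub>R integral {t - H..t} v) $ j)\<^sup>2) integrable_on {0..T}"
        by (intro cts_integrable continuous_on_power continuous_on_component c)
      show "(\<lambda>t. inverse H * integral {t - H..t} (\<lambda>s. (v s $ j)\<^sup>2)) integrable_on {0..T}"
        by (intro cts_integrable continuous_on_mult_left window_integral_continuous vj2)
      show "((inverse H *\<^sub>R integral {t - H..t} v) $ j)\<^sup>2 \<le> inverse H * integral {t - H..t} (\<lambda>s. (v s $ j)\<^sup>2)" for t
        using window_jensen[OF vj Hp, of t] by (simp add: integral_nth[OF v] field_simps)
    qed
    also have "\<dots> = inverse H * integral {0..T} (\<lambda>t. integral {t - H..t} (\<lambda>s. (v s $ j)\<^sup>2))" by simp
    also have "\<dots> \<le> inverse H * (H * (integral {-H..0} (\<lambda>s. (v s $ j)\<^sup>2) + integral {0..T} (\<lambda>s. (v s $ j)\<^sup>2)))"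
      using Hp T by (intro mult_left_mono window_double_integral_le vj2) auto
    also have "integral {-H..0} (\<lambda>s. (v s $ j)\<^sup>2) = integral {-H..0} (\<lambda>_. 0)"
      using z by (intro integral_cong) auto
    finally show ?thesis using Hp by (simp add: mult.assoc[symmetric])
  qed
qed

text \<open>The block form is nonpositive at the modulus, its window averages, the input modulus and
  the scaled output bound. After integration the storage part \<open>S\<close> is nonnegative
  because the modulus starts at 0, and \<open>Wt\<close> is nonnegative because averaging contracts;
  what remains is the gain inequality.\<close>

lemma L2_estimate:
  assumes dl: "admissible dl" and sol: "solves dl u x"
    and z: "starts_at_0 x" and u: "u \<in> borel_measurable lborel"
    and ui: "\<And>j T. (\<lambda>t. \<bar>u t $ j\<bar>) integrable_on {0..T}" and u2: "\<And>T. (\<lambda>t. u t \<bullet> u t) integrable_on {0..T}"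
    and P: "diag_pd P" and Q: "\<forall>i\<in>{1..N}. diag_pd (Q i)" and L: "lmi2 P Q \<gamma>"
    and g: "0 < \<gamma>" and T: "0 \<le> T"
  shows "(\<lambda>t. output_bound (modulus x) u t \<bullet> output_bound (modulus x) u t) integrable_on {0..T}"
    "integral {0..T} (\<lambda>t. output_bound (modulus x) u t \<bullet> output_bound (modulus x) u t) \<le> \<gamma>\<^sup>2 * integral {0..T} (\<lambda>t. u t \<bullet> u t)"
proof -
  let ?v = "modulus x"
  let ?y = "\<lambda>t. output_bound ?v u t"
  have v: "cts ?v" by (rule modulus_continuous[OF dl sol])
  note vi = vabs_integrable[OF ui]
  have sub: "subsolution (\<lambda>t. Eu *v vabs (u t)) ?v" by (rule modulus_subsolution[OF dl sol vi(1)])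
  have vz: "?v t $ j = 0" if "t \<le> 0" for t j using modulus_zero[OF z that] by simp
  define D where "D = (\<lambda>t. drift A ?v t + Eu *v vabs (u t))"
  define w where "w = (\<lambda>i t. inverse (hbar i) *\<^sub>R integral {t - hbar i..t} ?v)"
  have h0: "0 \<le> hbar i" if "i \<in> {1..N}" for i using h that by blast
  have wa1: "cts (\<lambda>t. inverse (hbar i) *\<^sub>R integral {t - hbar i..t} ?v)" if "i \<in> {1..N}" for i
    by (rule window_average(1)[OF v vz h0[OF that] T])
  have wa2: "integral {0..T} (\<lambda>t. ((inverse (hbar i) *\<^sub>R integral {t - hbar i..t} ?v) $ j)\<^sup>2) \<le> integral {0..T} (\<lambda>t. (?v t $ j)\<^sup>2)"
    if "i \<in> {1..N}" for i j
    by (rule window_average(2)[OF v vz h0[OF that] T])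
  have Nu: "vabs (u t) \<bullet> vabs (u t) = u t \<bullet> u t" for t by (simp add: inner_vec_def)
  \<comment> \<open>Multiplying the average by \<open>hbar i\<close> recovers the window integral,
    also for \<open>hbar i = 0\<close>, where both vanish.\<close>
  have hw: "(\<Sum>i\<in>{1..N}. hbar i *\<^sub>R (M i *v w i t)) = (\<Sum>i\<in>{1..N}. M i *v integral {t - hbar i..t} ?v)" for M :: "nat \<Rightarrow> real^'n^'k" and t
  proof (intro sum.cong refl)
    fix i assume "i \<in> {1..N}"
    then have "hbar i *\<^sub>R w i t = integral {t - hbar i..t} ?v" by (cases "hbar i = 0") (auto simp: w_def)
    then show "hbar i *\<^sub>R (M i *v w i t) = M i *v integral {t - hbar i..t} ?v"
      by (simp flip: matrix_vector_mult_scaleR)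
  qed
  define Wt where "Wt = (\<lambda>t. \<Sum>i\<in>{1..N}. ?v t \<bullet> (Q i *v ?v t) - w i t \<bullet> (Q i *v w i t))"
  \<comment> \<open>Stands in for the derivative of \<open>?v t \<bullet> (P *v ?v t)\<close>: its
    integral dominates the increment of that form, since \<open>P\<close> is diagonal and
    positive.\<close>
  define S where "S = (\<lambda>t. 2 * ((P *v ?v t) \<bullet> D t))"
  have pw: "?y t \<bullet> ?y t \<le> \<gamma> * (\<gamma> * (u t \<bullet> u t) - S t - Wt t)" for t
  proof -
    have "form2 P Q \<gamma> (?v t) (\<lambda>i. w i t) (vabs (u t)) ((1/\<gamma>) *\<^sub>R ?y t) \<le> 0"
    proof (cases "?v t = 0 \<and> (\<forall>i\<in>{1..N}. w i t = 0) \<and> vabs (u t) = 0 \<and> (1/\<gamma>) *\<^sub>R ?y t = 0")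
      case True
      then show ?thesis using g by (simp add: lmi2_form_def)
    next
      case False
      then have "?v t \<noteq> 0 \<or> (\<exists>i\<in>{1..N}. w i t \<noteq> 0) \<or> vabs (u t) \<noteq> 0 \<or> (1/\<gamma>) *\<^sub>R ?y t \<noteq> 0"
        by (simp only: de_Morgan_conj bex_simps ball_simps not_not simp_thms)
      from L[unfolded lmi2_neg_def_def, rule_format, OF this]
      show ?thesis by (rule less_imp_le)
    qed
    also have "form2 P Q \<gamma> (?v t) (\<lambda>i. w i t) (vabs (u t)) ((1/\<gamma>) *\<^sub>R ?y t) =
       S t + Wt t + 2 * (((1/\<gamma>) *\<^sub>R ?y t) \<bullet> ?y t) - \<gamma> * (u t \<bullet> u t) - \<gamma> * (((1/\<gamma>) *\<^sub>R ?y t) \<bullet> ((1/\<gamma>) *\<^sub>R ?y t))"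
      unfolding lmi2_form_eq[OF diag_pd_transpose[OF P]] hw S_def Wt_def D_def
      by (simp add: drift_def output_bound_def Nu add.assoc)
    also have "\<dots> = S t + Wt t + (?y t \<bullet> ?y t) / \<gamma> - \<gamma> * (u t \<bullet> u t)"
      using g by (simp add: field_simps)
    finally have "(?y t \<bullet> ?y t) / \<gamma> \<le> \<gamma> * (u t \<bullet> u t) - S t - Wt t" by simp
    then show ?thesis using g by (simp add: pos_divide_le_eq mult.commute)
  qed
  have sq: "(\<lambda>t. 2 * ?v t $ i * D t $ i) integrable_on {0..T}"
    "0 \<le> integral {0..T} (\<lambda>t. 2 * ?v t $ i * D t $ i)" for i
  proof -
    have vi': "cts (\<lambda>t. ?v t $ i)" using v by (intro continuous_intros)
    have d': "cts (\<lambda>t. drift A ?v t $ i)" using v by (intro continuous_intros drift_continuous)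
    have "(\<lambda>t. (Eu *v vabs (u t)) $ i) absolutely_integrable_on {0..T}"
      by (intro nonnegative_absolutely_integrable_1 vi nonneg_mat_mv E) simp
    moreover have "(\<lambda>t. drift A ?v t $ i) absolutely_integrable_on {0..T}"
      by (intro absolutely_integrable_continuous_real continuous_on_subset[OF d']) simp
    ultimately have G: "(\<lambda>t. D t $ i) absolutely_integrable_on {0..T}"
      unfolding D_def by (simp add: set_integral_add)
    have "?v t $ i - ?v s $ i \<le> integral {s..t} (\<lambda>t. D t $ i)" if "0 \<le> s" "s \<le> t" for s t
      using sub that by (simp add: subsolution_def D_def)
    note s = square_differential_inequality[OF T continuous_on_subset[OF vi' subset_UNIV] modulus_nonneg G this]
    show "(\<lambda>t. 2 * ?v t $ i * D t $ i) integrable_on {0..T}" by (rule s(1))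
    have "0 \<le> (?v T $ i)\<^sup>2 - (?v 0 $ i)\<^sup>2" by (simp add: vz)
    also note s(2)
    finally show "0 \<le> integral {0..T} (\<lambda>t. 2 * ?v t $ i * D t $ i)" .
  qed
  have Seq: "S = (\<lambda>t. \<Sum>i\<in>UNIV. P$i$i * (2 * ?v t $ i * D t $ i))"
    by (simp add: S_def inner_vec_def diag_pd_mv[OF P] sum_distrib_left mult_ac)
  have Si: "S integrable_on {0..T}"
    unfolding Seq by (intro integrable_sum integrable_on_mult_right sq) simp
  have "integral {0..T} S = (\<Sum>i\<in>UNIV. P$i$i * integral {0..T} (\<lambda>t. 2 * ?v t $ i * D t $ i))"
    unfolding Seq by (intro integral_unique has_integral_sum has_integral_mult_right integrable_integral sq) simp
  also have "\<dots> \<ge> 0" using diag_pd_pos[OF P] sq(2) by (intro sum_nonneg mult_nonneg_nonneg) (auto simp: less_imp_le)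
  finally have S0: "0 \<le> integral {0..T} S" .
  have wc: "cts (\<lambda>t. (w i t $ j)\<^sup>2)" if "i \<in> {1..N}" for i j
    unfolding w_def by (intro continuous_on_power continuous_on_component wa1 that)
  have vc: "cts (\<lambda>t. (?v t $ j)\<^sup>2)" for j using v by (intro continuous_intros)
  have Weq: "Wt = (\<lambda>t. \<Sum>i\<in>{1..N}. \<Sum>j\<in>UNIV. Q i $ j $ j * ((?v t $ j)\<^sup>2 - (w i t $ j)\<^sup>2))"
    unfolding Wt_def using Q
    by (intro ext sum.cong refl)
       (auto simp: inner_vec_def diag_pd_mv power2_eq_square right_diff_distrib mult_ac simp flip: sum_subtractf)
  have whas: "(Wt has_integral (\<Sum>i\<in>{1..N}. \<Sum>j\<in>UNIV. Q i $ j $ j * (integral {0..T} (\<lambda>t. (?v t $ j)\<^sup>2) - integral {0..T} (\<lambda>t. (w i t $ j)\<^sup>2)))) {0..T}"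
    unfolding Weq
    by (intro has_integral_sum has_integral_mult_right has_integral_diff integrable_integral cts_integrable wc vc) auto
  have W0: "0 \<le> integral {0..T} Wt"
    unfolding integral_unique[OF whas]
  proof (intro sum_nonneg mult_nonneg_nonneg)
    fix i j assume i: "i \<in> {1..N}"
    show "0 \<le> Q i $ j $ j" using Q i diag_pd_pos[of "Q i" j] by (simp add: less_imp_le)
    show "0 \<le> integral {0..T} (\<lambda>t. (?v t $ j)\<^sup>2) - integral {0..T} (\<lambda>t. (w i t $ j)\<^sup>2)"
      using wa2[OF i] by (simp add: w_def)
  qed
  have Wi: "Wt integrable_on {0..T}" using whas by blast
  have R: "((\<lambda>t. \<gamma> * (\<gamma> * (u t \<bullet> u t) - S t - Wt t)) has_integral \<gamma> * (\<gamma> * integral {0..T} (\<lambda>t. u t \<bullet> u t) - integral {0..T} S - integral {0..T} Wt)) {0..T}"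
    by (intro has_integral_mult_right has_integral_diff integrable_integral Si Wi u2)
  show yi: "(\<lambda>t. ?y t \<bullet> ?y t) integrable_on {0..T}"
  proof (rule borel_bounded_integrable)
    show "(\<lambda>t. ?y t \<bullet> ?y t) \<in> borel_measurable borel"
      unfolding inner_vec_def using output_bound_measurable[OF v u] by simp
    show "(\<lambda>t. \<gamma> * (\<gamma> * (u t \<bullet> u t) - S t - Wt t)) integrable_on {0..T}" using R by blast
  qed (use pw in simp)
  have "integral {0..T} (\<lambda>t. ?y t \<bullet> ?y t) \<le> \<gamma> * (\<gamma> * integral {0..T} (\<lambda>t. u t \<bullet> u t) - integral {0..T} S - integral {0..T} Wt)"
    using pw by (intro has_integral_le[OF integrable_integral[OF yi] R]) auto
  also have "\<dots> \<le> \<gamma> * (\<gamma> * integral {0..T} (\<lambda>t. u t \<bullet> u t))"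
    using S0 W0 g by (intro mult_left_mono) auto
  finally show "integral {0..T} (\<lambda>t. ?y t \<bullet> ?y t) \<le> \<gamma>\<^sup>2 * integral {0..T} (\<lambda>t. u t \<bullet> u t)"
    by (simp add: power2_eq_square mult.assoc)
qed

theorem L2_gain:
  assumes dl: "admissible dl"
    and P: "diag_pd P" and Q: "\<forall>i\<in>{1..N}. diag_pd (Q i)" and L: "lmi2 P Q g"
    and g: "0 < g" and gg: "g < \<gamma>"
  shows "L2_gain_lt N hbar A Eu C Fu dl \<gamma>"
  unfolding L2_gain_lt_def
proof (intro exI[of _ g] conjI allI impI less_imp_le[OF g] gg; elim conjE)
  fix u x assume u: "u \<in> borel_measurable lborel"
    and fin: "ray_integral (\<lambda>t. (norm (u t))\<^sup>2) < \<infinity>"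
    and sol: "solves dl u x" and z: "starts_at_0 x"
  let ?y = "output_bound (modulus x) u"
  have v: "cts (modulus x)" by (rule modulus_continuous[OF dl sol])
  have un: "(norm v)\<^sup>2 = v \<bullet> v" for v :: "real^'k" by (simp add: power2_norm_eq_inner)
  have um: "(\<lambda>t. u t \<bullet> u t) \<in> borel_measurable borel"
    using borel_measurable_nth[OF u] unfolding inner_vec_def by simp
  note ufin = nn_integral_Ici_finite[OF um inner_ge_zero fin[unfolded un]]
  have ui: "(\<lambda>t. \<bar>u t $ j\<bar>) integrable_on {0..T}" for j T
  proof (rule borel_bounded_integrable)
    show "(\<lambda>t. \<bar>u t $ j\<bar>) \<in> borel_measurable borel" using borel_measurable_nth[OF u] by simp
    \<comment> \<open>Square integrability implies local integrability, as
      \<open>1 + (norm (u t))\<^sup>2\<close> dominates \<open>norm (u t)\<close>.\<close>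
    show "(\<lambda>t. 1 + u t \<bullet> u t) integrable_on {0..T}" by (intro integrable_add ufin) auto
    fix t
    have "\<bar>u t $ j\<bar> \<le> norm (u t)" by (rule component_le_norm_cart)
    also have "\<dots> \<le> 1 + (norm (u t))\<^sup>2" using zero_le_power2[of "norm (u t) - 1/2"] by (simp add: power2_eq_square algebra_simps)
    finally show "\<bar>\<bar>u t $ j\<bar>\<bar> \<le> 1 + u t \<bullet> u t" by (simp add: un)
  qed
  note est = L2_estimate[OF dl sol z u ui ufin(1) P Q L g]
  show "ray_integral (\<lambda>t. (norm (output dl x u t))\<^sup>2) \<le> ennreal (g\<^sup>2) * ray_integral (\<lambda>t. (norm (u t))\<^sup>2)"
    unfolding un
  proof (rule ray_integral_gain_le[OF _ inner_ge_zero um inner_ge_zero fin[unfolded un]])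
    show "(\<lambda>t. ?y t \<bullet> ?y t) \<in> borel_measurable borel"
      unfolding inner_vec_def using output_bound_measurable[OF v u] by simp
    show "output dl x u t \<bullet> output dl x u t \<le> ?y t \<bullet> ?y t" if "0 \<le> t" for t
    proof -
      have "norm (output dl x u t) \<le> norm (?y t)"
      proof (rule norm_le_componentwise_cart)
        show "norm (output dl x u t $ i) \<le> norm (?y t $ i)" for i
          using output_le[OF dl sol that, of i] by simp
      qed
      then show ?thesis by (simp add: norm_le)
    qed
  qed (use est in auto)
qed

section \<open>Constant delays: solvability and necessity\<close>

lemma drift_diff:
  assumes "cts x" "cts y"
  shows "drift M (\<lambda>t. x t - y t) t = drift M x t - drift M y t"
  using assms
  by (simp add: drift_def matrix_vector_mult_diff_distrib sum_subtractf integral_diff cts_integrable)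

text \<open>Windows reach only into the past, where the exponential weight is no larger, so the
  delay terms cost a constant factor independent of \<open>\<kappa>\<close>.\<close>

lemma drift_exp_growth_bound:
  fixes M :: "nat \<Rightarrow> real^'n^'m"
  assumes k: "0 < \<kappa>" and x: "cts x"
    and d: "\<And>t. norm (x t) \<le> d * exp (\<kappa> * max t 0)" and d0: "0 \<le> d" and t: "0 \<le> t"
  shows "norm (drift M x t) \<le> (onorm ((*v) (M 0)) + (\<Sum>i\<in>{1..N}. onorm ((*v) (M i)) * hbar i)) * (d * exp (\<kappa> * t))"
proof -
  have on: "norm (B *v y) \<le> onorm ((*v) B) * norm y" for B :: "real^'n^'m" and y
    by (intro onorm matrix_vector_mul_bounded_linear)
  have o0: "0 \<le> onorm ((*v) B)" for B :: "real^'n^'m"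
    by (intro onorm_pos_le matrix_vector_mul_bounded_linear)
  have "norm (drift M x t) \<le> norm (M 0 *v x t) + (\<Sum>i\<in>{1..N}. norm (M i *v integral {t - hbar i..t} x))"
    unfolding drift_def by (intro order_trans[OF norm_triangle_ineq] add_mono order_refl norm_sum)
  also have "\<dots> \<le> onorm ((*v) (M 0)) * (d * exp (\<kappa> * t)) + (\<Sum>i\<in>{1..N}. onorm ((*v) (M i)) * (hbar i * (d * exp (\<kappa> * t))))"
  proof (intro add_mono sum_mono order_trans[OF on] mult_left_mono o0)
    show "norm (x t) \<le> d * exp (\<kappa> * t)" using d[of t] t by simp
    fix i assume i: "i \<in> {1..N}"
    have "norm (integral {t - hbar i..t} x) \<le> integral {t - hbar i..t} (\<lambda>_. d * exp (\<kappa> * t))"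
    proof (intro integral_norm_bound_integral cts_integrable x)
      fix s assume "s \<in> {t - hbar i..t}"
      then have "exp (\<kappa> * max s 0) \<le> exp (\<kappa> * t)" using k t by simp
      then have "d * exp (\<kappa> * max s 0) \<le> d * exp (\<kappa> * t)" using d0 by (rule mult_left_mono)
      then show "norm (x s) \<le> d * exp (\<kappa> * t)" using d[of s] by linarith
    qed (intro continuous_intros)
    then show "norm (integral {t - hbar i..t} x) \<le> hbar i * (d * exp (\<kappa> * t))" using h i by (simp add: mult_ac)
  qed
  finally show ?thesis by (simp add: distrib_right sum_distrib_right mult.assoc)
qed

text \<open>Picard iteration in the weighted sup norm with weight \<open>exp (- \<kappa> t)\<close>, a contraction once
  \<open>\<kappa>\<close> exceeds the norm of the delay operator.\<close>

lemma delay_equation_solvable: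
  fixes M :: "nat \<Rightarrow> real^'n^'n"
  assumes \<phi>: "cts \<phi>" "bounded (range \<phi>)"
  shows "\<exists>x. cts x \<and> (\<forall>t. x t = \<phi> t + integral {0..max t 0} (drift M x))"
proof -
  define c where "c = onorm ((*v) (M 0)) + (\<Sum>i\<in>{1..N}. onorm ((*v) (M i)) * hbar i)"
  have c0: "0 \<le> c" unfolding c_def using h
    by (intro add_nonneg_nonneg sum_nonneg mult_nonneg_nonneg onorm_pos_le matrix_vector_mul_bounded_linear) auto
  \<comment> \<open>Makes \<open>c / \<kappa>\<close> less than 1 and keeps \<open>\<kappa>\<close>
    positive even when \<open>c = 0\<close>.\<close>
  define \<kappa> where "\<kappa> = 2 * c + 1"
  have k: "0 < \<kappa>" using c0 by (simp add: \<kappa>_def)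
  \<comment> \<open>The unknown is stored divided by its weight, so that it is a bounded continuous
    function; \<open>X\<close> restores it. The weight is 1 at negative times.\<close>
  define X where "X = (\<lambda>(z::real \<Rightarrow>\<^sub>C (real^'n)) t. exp (\<kappa> * max t 0) *\<^sub>R z t)"
  have Xc: "cts (X z)" for z unfolding X_def by (intro continuous_intros continuous_on_apply_bcontfun)
  note dc = drift_continuous[OF Xc]
  define I where "I = (\<lambda>z t. integral {0..max t 0} (drift M (X z)))"
  have Ic: "cts (I z)" for z
  proof -
    have *: "continuous_on {a..b} (I z)" for a b
    proof -
      have "continuous_on {0..max b 0} (\<lambda>t. integral {0..t} (drift M (X z)))"
        by (intro indefinite_integral_continuous_1 cts_integrable dc)
      then show ?thesis unfolding I_def
        by (rule continuous_on_compose2) (auto intro!: continuous_intros)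
    qed
    have "isCont (I z) t" for t
      using continuous_on_interior[OF *[of "t-1" "t+1"], of t] by simp
    then show ?thesis by (simp add: continuous_at_imp_continuous_on)
  qed
  have Xdiff: "norm (X z t - X w t) \<le> dist z w * exp (\<kappa> * max t 0)" for z w t
  proof -
    have "norm (X z t - X w t) = exp (\<kappa> * max t 0) * dist (z t) (w t)"
      by (simp add: X_def dist_norm flip: scaleR_diff_right)
    also have "\<dots> \<le> exp (\<kappa> * max t 0) * dist z w" by (intro mult_left_mono dist_bounded) auto
    finally show ?thesis by (simp add: mult.commute)
  qed
  have Idiff: "norm (I z t - I w t) \<le> c / \<kappa> * dist z w * exp (\<kappa> * max t 0)" for z w t
  proof -
    have "I z t - I w t = integral {0..max t 0} (\<lambda>s. drift M (X z) s - drift M (X w) s)"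
      unfolding I_def by (intro integral_diff[symmetric] cts_integrable dc)
    also have "norm \<dots> \<le> (c * dist z w) / \<kappa> * exp (\<kappa> * max t 0)"
    proof (rule integral_exp_growth_bound[OF k])
      fix s :: real assume s: "0 \<le> s"
      have "norm (drift M (\<lambda>t. X z t - X w t) s) \<le> c * (dist z w * exp (\<kappa> * s))"
        unfolding c_def by (intro drift_exp_growth_bound[OF k] continuous_on_diff Xc Xdiff zero_le_dist s)
      then show "norm (drift M (X z) s - drift M (X w) s) \<le> c * dist z w * exp (\<kappa> * s)"
        by (simp add: drift_diff[OF Xc Xc] mult.assoc)
    qed (use c0 in \<open>auto intro!: continuous_on_diff dc\<close>)
    finally show ?thesis by simp
  qed
  define K where "K = (\<lambda>z t. exp (- \<kappa> * max t 0) *\<^sub>R (\<phi> t + I z t))"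
  have Kdiff: "norm (K z t - K w t) \<le> c / \<kappa> * dist z w" for z w t
  proof -
    have "norm (K z t - K w t) = exp (- \<kappa> * max t 0) * norm (I z t - I w t)"
      by (simp add: K_def flip: scaleR_diff_right)
    also have "\<dots> \<le> exp (- \<kappa> * max t 0) * (c / \<kappa> * dist z w * exp (\<kappa> * max t 0))"
      by (intro mult_left_mono Idiff) auto
    also have "\<dots> = c / \<kappa> * dist z w" by (simp add: exp_minus field_simps)
    finally show ?thesis .
  qed
  \<comment> \<open>\<open>K 0\<close> is bounded because \<open>I 0\<close> vanishes, and the
    Lipschitz bound transfers this to every \<open>z\<close>.\<close>
  have Kb: "K z \<in> bcontfun" for z
  proof -
    obtain b where b: "\<And>t. norm (\<phi> t) \<le> b" using \<phi>(2) by (auto simp: bounded_iff)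
    have "I 0 t = 0" for t
      by (simp add: I_def X_def drift_def[abs_def])
    then have K0: "norm (K 0 t) \<le> b" for t
    proof -
      have "norm (K 0 t) = exp (- \<kappa> * max t 0) * norm (\<phi> t)" using \<open>\<And>t. I 0 t = 0\<close> by (simp add: K_def)
      also have "\<dots> \<le> 1 * b" using k b by (intro mult_mono) auto
      finally show ?thesis by simp
    qed
    have "norm (K z t) \<le> b + c / \<kappa> * dist z 0" for t
      using norm_triangle_ineq[of "K 0 t" "K z t - K 0 t"] K0[of t] Kdiff[of z t 0] by simp
    moreover have "cts (K z)" unfolding K_def by (intro continuous_intros \<phi>(1) Ic)
    ultimately show ?thesis by (intro bcontfun_normI)
  qed
  have "\<exists>!z. Bcontfun (K z) = z"
  proof (rule banach_fix_type)
    show "0 \<le> c / \<kappa>" "c / \<kappa> < 1" using c0 by (auto simp: \<kappa>_def)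
    show "\<forall>z w. dist (Bcontfun (K z)) (Bcontfun (K w)) \<le> c / \<kappa> * dist z w"
      by (intro allI dist_bound) (unfold Bcontfun_inverse[OF Kb] dist_norm[of "K _ _"], rule Kdiff)
  qed
  then obtain z where "Bcontfun (K z) = z" by blast
  then have z: "z t = K z t" for t by (metis Bcontfun_inverse[OF Kb])
  have "X z t = \<phi> t + I z t" for t
  proof -
    have "X z t = exp (\<kappa> * max t 0) *\<^sub>R K z t" unfolding X_def by (subst z) simp
    then show ?thesis by (simp add: K_def exp_minus)
  qed
  then show ?thesis using Xc[of z] unfolding I_def by blast
qed

section \<open>Responses to step inputs\<close>

abbreviation step_input :: "real \<Rightarrow> real^'u \<Rightarrow> real \<Rightarrow> real^'u" where
  "step_input T0 u0 t \<equiv> (if t \<in> {0..T0} then u0 else 0)"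

lemma admissible_hbar: "admissible hconst"
  using h by (simp add: admissible_delays_def)

lemma sys_rhs_drift: "sys_rhs N A Eu hconst x u t = drift A x t + Eu *v u t"
  and sys_out_drift: "output hconst x u t = drift C x t + Fu *v u t"
  by (simp_all add: sys_rhs_def sys_out_def drift_def)

text \<open>The input integrates to the bounded continuous ramp in \<open>\<phi>\<close>, so its
  jumps do not enter the fixed point problem.\<close>

lemma step_solution:
  assumes T0: "0 \<le> T0"
  obtains x where "cts x" "\<And>t. t \<le> 0 \<Longrightarrow> x t = p"
    "solves hconst (step_input T0 u0) x"
    "x T0 = p + T0 *\<^sub>R (Eu *v u0) + integral {0..T0} (drift A x)"
proof -
  define \<phi> where "\<phi> = (\<lambda>t. p + min (max t 0) T0 *\<^sub>R (Eu *v u0))"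
  have pc: "cts \<phi>" unfolding \<phi>_def by (intro continuous_intros)
  have "norm (\<phi> t) \<le> norm p + T0 * norm (Eu *v u0)" for t
  proof -
    have "norm (\<phi> t) \<le> norm p + norm (min (max t 0) T0 *\<^sub>R (Eu *v u0))" unfolding \<phi>_def by (rule norm_triangle_ineq)
    also have "norm (min (max t 0) T0 *\<^sub>R (Eu *v u0)) \<le> T0 * norm (Eu *v u0)"
      using T0 by (auto intro!: mult_right_mono)
    finally show ?thesis by simp
  qed
  then have pb: "bounded (range \<phi>)" by (auto simp: bounded_iff)
  from delay_equation_solvable[OF pc pb, of A] obtain x where x: "cts x"
    and e: "\<And>t. x t = \<phi> t + integral {0..max t 0} (drift A x)" by blast
  have init: "x t = p" if "t \<le> 0" for t
    using e[of t] that T0 by (simp add: \<phi>_def max_def)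
  have "solves hconst (step_input T0 u0) x"
    unfolding is_solution_def
  proof (intro conjI allI impI)
    show "continuous_on {- hm..} x" by (rule continuous_on_subset[OF x]) simp
    fix t :: real assume t: "0 \<le> t"
    have "((\<lambda>s. if s \<in> {0..min t T0} then Eu *v u0 else 0) has_integral (min t T0) *\<^sub>R (Eu *v u0)) {0..t}"
      using t T0 has_integral_const_real[of "Eu *v u0" 0 "min t T0"] by (subst has_integral_restrict) auto
    then have "((\<lambda>s. Eu *v step_input T0 u0 s) has_integral (min t T0) *\<^sub>R (Eu *v u0)) {0..t}"
      by (rule has_integral_eq[rotated]) auto
    then have "((\<lambda>s. drift A x s + Eu *v step_input T0 u0 s) has_integral
        integral {0..t} (drift A x) + (min t T0) *\<^sub>R (Eu *v u0)) {0..t}"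
      by (intro has_integral_add integrable_integral cts_integrable drift_continuous x)
    moreover have "x t - x 0 = integral {0..t} (drift A x) + (min t T0) *\<^sub>R (Eu *v u0)"
      using e[of t] init[of 0] t by (simp add: \<phi>_def)
    ultimately show "(sys_rhs N A Eu hconst x (step_input T0 u0) has_integral x t - x 0) {0..t}"
      by (simp add: sys_rhs_drift[abs_def])
  qed
  moreover have "x T0 = p + T0 *\<^sub>R (Eu *v u0) + integral {0..T0} (drift A x)"
    using e[of T0] T0 by (simp add: \<phi>_def)
  ultimately show ?thesis using x init by (intro that)
qed

lemma step_solution_increment:
  assumes x: "cts x"
    and sol: "solves hconst u x" and st: "0 \<le> s" "s \<le> t"
  shows "((\<lambda>\<tau>. drift A x \<tau> $ i + (Eu *v u \<tau>) $ i) has_integral x t $ i - x s $ i) {s..t}"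
  using has_integral_linear[OF rhs_integral[OF admissible_hbar sol st] bounded_linear_vec_nth[of i]]
  by (simp add: o_def sys_rhs_drift)

lemma step_input_integrable:
  "(\<lambda>t. ((M::real^'u^'k) *v step_input T0 u0 t) $ i) integrable_on {0..T}"
proof -
  have "(\<lambda>t. if t \<in> {0..T0} then (M *v u0) $ i else 0) integrable_on {0..T}"
    by (subst integrable_restrict_Int) (auto simp: Int_atLeastAtMost)
  then show ?thesis by (rule integrable_eq) auto
qed

text \<open>\<open>p\<close> lies below the solution as a constant at which the right-hand side is
  nonnegative; the upper comparison is applied to \<open>- x\<close> and \<open>- p\<close>.\<close>

lemma step_solution_ge:
  assumes x: "cts x" and init: "\<And>t. t \<le> 0 \<Longrightarrow> x t = p"
    and sol: "solves hconst (step_input T0 u0) x"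
    and p: "\<And>i t. 0 \<le> (Ab *v p) $ i + (Eu *v step_input T0 u0 t) $ i" and t: "0 \<le> t"
  shows "p $ j \<le> x t $ j"
proof -
  have neg: "drift A (\<lambda>t. - x t) t = - drift A x t" for t
    using drift_diff[of "\<lambda>_. 0" x A t] x by (simp add: drift_def)
  have mneg: "M *v (- y) = - (M *v y)" for M :: "real^'n^'n" and y
    by (simp add: matrix_vector_mult_def vec_eq_iff sum_negf)
  have "(- x t) $ j \<le> (- p) $ j"
  proof (rule subsolution_const_bound[of "\<lambda>t. - x t" "\<lambda>t. - (Eu *v step_input T0 u0 t)" "- p" t j])
    show "cts (\<lambda>t. - x t)" using x by (intro continuous_intros)
    show "subsolution (\<lambda>t. - (Eu *v step_input T0 u0 t)) (\<lambda>t. - x t)"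
      unfolding subsolution_def
    proof (intro allI impI)
      fix i and s t :: real assume st: "0 \<le> s" "s \<le> t"
      have "((\<lambda>\<tau>. - (drift A x \<tau> $ i + (Eu *v step_input T0 u0 \<tau>) $ i)) has_integral - (x t $ i - x s $ i)) {s..t}"
        by (intro has_integral_neg step_solution_increment x sol st)
      from integral_unique[OF this]
      show "(- x t) $ i - (- x s) $ i \<le> integral {s..t} (\<lambda>\<tau>. drift A (\<lambda>t. - x t) \<tau> $ i + (- (Eu *v step_input T0 u0 \<tau>)) $ i)"
        by (simp add: neg)
    qed
    show "(\<lambda>t. (- (Eu *v step_input T0 u0 t)) $ i) integrable_on {0..T}" for i T
      unfolding vector_uminus_component by (intro integrable_neg step_input_integrable)
    show "(Ab *v - p) $ i + (- (Eu *v step_input T0 u0 t)) $ i \<le> 0" for t i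
      using p[of i t] by (simp only: mneg vector_uminus_component)
  qed (use init t in auto)
  then show ?thesis by simp
qed

lemma not_stable_if_nonneg_direction:
  assumes p: "p \<noteq> 0" "\<forall>i. 0 \<le> p$i" "\<forall>j. 0 \<le> (Ab *v p)$j"
  shows "\<not> stable_for hconst"
proof
  assume st: "stable_for hconst"
  \<comment> \<open>A step of height 0 is the zero input, so this is an unforced solution with
    constant history \<open>p\<close>.\<close>
  obtain x where x: "cts x" "\<And>t. t \<le> 0 \<Longrightarrow> x t = p"
    and sol: "solves hconst (step_input 0 0) x"
    using step_solution[of 0 p 0] by auto
  have zero: "step_input 0 0 t = 0" for t by simp
  have "p $ j \<le> x t $ j" if "0 \<le> t" for t j
  proof (rule step_solution_ge[OF x sol _ that])
    fix i t
    have "(Eu *v step_input 0 0 t) $ i = 0" by (cases "t \<in> {0..0}") simp_all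
    then show "0 \<le> (Ab *v p) $ i + (Eu *v step_input 0 0 t) $ i" using p(3) by (simp only: add_0_right)
  qed
  moreover have "(x \<longlongrightarrow> 0) at_top" using st sol unfolding asymp_stable_def zero by blast
  then have "((\<lambda>t. x t $ j) \<longlongrightarrow> 0 $ j) at_top" for j by (intro tendsto_vec_nth)
  ultimately have "p $ j \<le> 0 $ j" for j
    by (intro tendsto_lowerbound[of "\<lambda>t. x t $ j" "0 $ j" at_top "p $ j"])
       (auto simp: eventually_at_top_linorder)
  then show False using p(1,2) by (auto simp: vec_eq_iff intro: antisym)
qed

text \<open>For zero history and a bounded state the replacement of windows by factors
  \<open>hbar i\<close> is exact up to a loss independent of \<open>T\<close>.\<close>

lemma inner_drift_integral_ge:
  fixes v :: "real \<Rightarrow> real^'c" and M :: "nat \<Rightarrow> real^'c^'r"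
  assumes v: "cts v" and v0: "\<And>t j. 0 \<le> v t $ j" and z: "\<And>t. t \<le> 0 \<Longrightarrow> v t = 0"
    and vm: "\<And>t j. 0 \<le> t \<Longrightarrow> v t $ j \<le> m $ j"
    and M: "\<forall>i\<in>{1..N}. nonneg_mat (M i)" and l: "\<forall>j. 0 \<le> l$j" and T: "0 \<le> T"
  shows "(l v* Abar N hbar M) \<bullet> integral {0..T} v - (\<Sum>i\<in>{1..N}. hbar i * (hbar i * ((l v* M i) \<bullet> m)))
     \<le> integral {0..T} (\<lambda>t. l \<bullet> drift M v t)"
proof -
  have vj: "cts (\<lambda>t. v t $ j)" for j using v by (intro continuous_intros)
  have w: "cts (\<lambda>t. integral {t - k..t} v)" for k by (rule window_integral_continuous[OF v])
  have m0: "0 \<le> m $ j" for j using v0[of 0 j] vm[of 0 j] by simp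
  have "(l v* Abar N hbar M) \<bullet> integral {0..T} v - (\<Sum>i\<in>{1..N}. hbar i * (hbar i * ((l v* M i) \<bullet> m)))
    = (l v* M 0) \<bullet> integral {0..T} v + (\<Sum>i\<in>{1..N}. (l v* M i) \<bullet> (hbar i *\<^sub>R integral {0..T} v - hbar i *\<^sub>R (hbar i *\<^sub>R m)))"
    by (simp add: Abar_vm inner_add_left inner_sum_left inner_diff_right sum_subtractf mult.assoc)
  also have "\<dots> \<le> (l v* M 0) \<bullet> integral {0..T} v + (\<Sum>i\<in>{1..N}. (l v* M i) \<bullet> integral {0..T} (\<lambda>t. integral {t - hbar i..t} v))"
  proof (intro add_mono order_refl inner_sum_mono M l)
    fix i j assume i: "i \<in> {1..N}"
    have "hbar i * integral {0..T} (\<lambda>s. v s $ j) - hbar i * (hbar i * m $ j) \<le> integral {0..T} (\<lambda>t. integral {t - hbar i..t} (\<lambda>s. v s $ j))"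
      using h i v0 T z vm m0 by (intro window_double_integral_ge vj) auto
    then show "(hbar i *\<^sub>R integral {0..T} v - hbar i *\<^sub>R (hbar i *\<^sub>R m)) $ j \<le> integral {0..T} (\<lambda>t. integral {t - hbar i..t} v) $ j"
      by (simp add: integral_nth[OF w] integral_nth[OF v])
  qed
  also have "\<dots> = integral {0..T} (\<lambda>t. l \<bullet> drift M v t)"
    by (rule inner_drift_integral[OF v, symmetric])
  finally show ?thesis .
qed

text \<open>The output loses its feedthrough term when the input is switched off after
  \<open>T\<close>; a \<open>Y\<close> continuous on the whole line represents it on
  \<open>{0..T}\<close>.\<close>

definition step_response :: "real \<Rightarrow> real^'u \<Rightarrow> (real \<Rightarrow> real^'n) \<Rightarrow> (real \<Rightarrow> real^'y) \<Rightarrow> bool" where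
  "step_response T u0 x Y \<longleftrightarrow> solves hconst (step_input T u0) x \<and>
     (starts_at_0 x) \<and> cts Y \<and> (\<forall>t k. 0 \<le> Y t $ k) \<and>
     (\<forall>t\<in>{0..T}. output hconst x (step_input T u0) t = Y t)"

lemma step_responseD:
  assumes "step_response T u0 x Y"
  shows "solves hconst (step_input T u0) x" "starts_at_0 x"
    "cts Y" "0 \<le> Y t $ k" "\<forall>t\<in>{0..T}. output hconst x (step_input T u0) t = Y t"
  using assms by (auto simp: step_response_def)

text \<open>Over a long horizon the constant input \<open>u0\<close> produces the average output \<open>G u0\<close> with
  \<open>G\<close> the static gain, up to an error that does not grow with the horizon.\<close>

lemma static_response:
  assumes B: "neg_inverse Ab B" and u0: "\<forall>j. 0 \<le> u0 $ j" and w: "\<forall>k. 0 \<le> w $ k"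
  obtains K where "\<And>T. 0 \<le> T \<Longrightarrow>
    \<exists>x Y. step_response T u0 x Y \<and> T * (w \<bullet> (static_gain B *v u0)) - K \<le> integral {0..T} (\<lambda>t. w \<bullet> Y t)"
proof -
  \<comment> \<open>The equilibrium \<open>\<xi>\<close> bounds the state from above. The adjoint
    vector \<open>\<pi>\<close> is chosen so that \<open>\<pi> v* Ab\<close> cancels
    \<open>w v* Cb\<close>.\<close>
  define \<xi> where "\<xi> = B *v (Eu *v u0)"
  define \<pi> where "\<pi> = (w v* Cb) v* B"
  have Bn: "nonneg_mat B" using B by (simp add: neg_inverse_def)
  have Cn: "nonneg_mat Cb" by (rule Cb_nonneg)
  have Ci: "\<forall>i\<in>{1..N}. nonneg_mat (C i)" using C by auto
  have xi0: "\<forall>j. 0 \<le> \<xi> $ j" unfolding \<xi>_def using u0 Bn E by (intro allI nonneg_mat_mv) auto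
  have pi0: "\<forall>j. 0 \<le> \<pi> $ j" unfolding \<pi>_def using w Bn Cn by (intro allI nonneg_mat_vm) auto
  have Axi: "Ab *v \<xi> = - (Eu *v u0)" unfolding \<xi>_def by (rule neg_inverse_mv[OF B])
  have piA: "\<pi> v* Ab = - (w v* Cb)" unfolding \<pi>_def by (rule neg_inverse_vm[OF B])
  define KA where "KA = (\<Sum>i\<in>{1..N}. hbar i * (hbar i * ((\<pi> v* A i) \<bullet> \<xi>)))"
  define KC where "KC = (\<Sum>i\<in>{1..N}. hbar i * (hbar i * ((w v* C i) \<bullet> \<xi>)))"
  show ?thesis
  proof (rule that[of "\<pi> \<bullet> \<xi> + KA + KC"])
    fix T :: real assume T: "0 \<le> T"
    obtain x where x: "cts x" "\<And>t. t \<le> 0 \<Longrightarrow> x t = 0"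
      and sol: "solves hconst (step_input T u0) x"
      and xT: "x T = T *\<^sub>R (Eu *v u0) + integral {0..T} (drift A x)"
      using step_solution[OF T, of 0 u0] by auto
    have Es: "(Eu *v step_input T u0 t) $ i \<in> {0..(Eu *v u0) $ i}" for t i
      using nonneg_mat_mv[OF E u0] by (cases "t \<in> {0..T}") simp_all
    have xnn: "0 \<le> x t $ j" for t j
    proof (cases "0 \<le> t")
      case True
      have "(0::real^'n) $ j \<le> x t $ j"
      proof (rule step_solution_ge[OF x sol _ True])
        fix i t
        show "0 \<le> (Ab *v 0) $ i + (Eu *v step_input T u0 t) $ i"
          using Es[of t i] by (simp only: matrix_vector_mult_0_right zero_index add_0_left atLeastAtMost_iff)
      qed
      then show ?thesis by simp
    qed (simp add: x(2))
    have xle: "x t $ j \<le> \<xi> $ j" if "0 \<le> t" for t j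
    proof (rule subsolution_const_bound[OF x(1) _ step_input_integrable _ _ that])
      show "subsolution (\<lambda>t. Eu *v step_input T u0 t) x"
        unfolding subsolution_def
        using integral_unique[OF step_solution_increment[OF x(1) sol]] by simp
      show "(Ab *v \<xi>) $ i + (Eu *v step_input T u0 t) $ i \<le> 0" for t i
        using Es[of t i] by (simp add: Axi)
      show "x t $ j \<le> \<xi> $ j" if "t \<le> 0" for t j using xi0 x(2)[OF that] by simp
    qed
    define V where "V = integral {0..T} x"
    \<comment> \<open>Weighting the integrated dynamics by \<open>\<pi>\<close> eliminates the
      unknown state integral \<open>V\<close> from the integrated output.\<close>
    have "\<pi> \<bullet> x T = integral {0..T} (\<lambda>t. \<pi> \<bullet> drift A x t) + T * (\<pi> \<bullet> (Eu *v u0))"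
      using integral_linear[OF cts_integrable[OF drift_continuous[OF x(1)]] bounded_linear_inner_right[of \<pi>], of 0 T A]
      by (simp add: xT o_def inner_add_right)
    moreover have "\<pi> \<bullet> x T \<le> \<pi> \<bullet> \<xi>"
      unfolding inner_vec_def inner_real_def using xle[OF T] pi0 by (intro sum_mono mult_left_mono) auto
    moreover have "- (w v* Cb) \<bullet> V - KA \<le> integral {0..T} (\<lambda>t. \<pi> \<bullet> drift A x t)"
      using inner_drift_integral_ge[OF x(1) xnn x(2) xle A pi0 T] by (simp add: V_def KA_def piA)
    moreover have "(w v* Cb) \<bullet> V - KC \<le> integral {0..T} (\<lambda>t. w \<bullet> drift C x t)"
      using inner_drift_integral_ge[OF x(1) xnn x(2) xle Ci w T] by (simp add: V_def KC_def)
    ultimately have key: "T * (\<pi> \<bullet> (Eu *v u0)) - (\<pi> \<bullet> \<xi> + KA + KC) \<le> integral {0..T} (\<lambda>t. w \<bullet> drift C x t)"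
      by simp
    define Y where "Y = (\<lambda>t. drift C x t + Fu *v u0)"
    have Yc: "cts Y" unfolding Y_def by (intro continuous_intros drift_continuous x(1))
    have Y0: "0 \<le> Y t $ k" for t k
      unfolding Y_def drift_def vector_add_component sum_component
      using C F u0 xnn
      by (intro add_nonneg_nonneg sum_nonneg nonneg_mat_mv)
         (auto simp: integral_nth[OF x(1)] intro!: integral_nonneg cts_intros x(1))
    have "integral {0..T} (\<lambda>t. w \<bullet> Y t) = integral {0..T} (\<lambda>t. w \<bullet> drift C x t) + T * (w \<bullet> (Fu *v u0))"
      unfolding Y_def inner_add_right using T
      by (subst integral_add) (auto intro!: cts_intros drift_continuous x(1))
    moreover have "w \<bullet> (static_gain B *v u0) = \<pi> \<bullet> (Eu *v u0) + w \<bullet> (Fu *v u0)"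
      by (simp add: static_gain_def \<pi>_def matrix_vector_mult_add_rdistrib inner_add_right dot_lmul_matrix
          matrix_vector_mul_assoc matrix_mul_assoc)
    ultimately have "T * (w \<bullet> (static_gain B *v u0)) - (\<pi> \<bullet> \<xi> + KA + KC) \<le> integral {0..T} (\<lambda>t. w \<bullet> Y t)"
      using key by (simp add: algebra_simps)
    moreover have "output hconst x (step_input T u0) t = Y t" if "t \<in> {0..T}" for t
      using that by (simp add: sys_out_drift Y_def)
    ultimately show "\<exists>x Y. step_response T u0 x Y \<and>
        T * (w \<bullet> (static_gain B *v u0)) - (\<pi> \<bullet> \<xi> + KA + KC) \<le> integral {0..T} (\<lambda>t. w \<bullet> Y t)"
      unfolding step_response_def using sol x(2) Yc Y0 by (intro exI[of _ x] exI[of _ Y]) auto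
  qed
qed

lemma step_input_measurable: "step_input T u0 \<in> borel_measurable lborel"
  by measurable

lemma nn_integral_step_input:
  fixes f :: "real^'u \<Rightarrow> real"
  assumes "f 0 = 0" "0 \<le> f u0" "0 \<le> T"
  shows "ray_integral (\<lambda>t. f (step_input T u0 t)) = ennreal (f u0 * T)"
proof -
  have "ray_integral (\<lambda>t. f (step_input T u0 t)) = (\<integral>\<^sup>+t\<in>{0..T}. ennreal (f u0) \<partial>lborel)"
    using assms(1) by (intro nn_integral_cong) (auto simp: indicator_def)
  also have "\<dots> = ennreal (f u0) * ennreal T" using assms(3) by (simp add: nn_integral_cmult)
  finally show ?thesis using assms by (simp add: ennreal_mult)
qed

lemma output_integral_le:
  fixes f :: "real^'y \<Rightarrow> real" and Y y :: "real \<Rightarrow> real^'y"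
  assumes Y: "cts Y" "\<forall>t\<in>{0..T}. y t = Y t" and f: "cts f" "\<And>v. 0 \<le> f v" and T: "0 \<le> T"
  shows "ennreal (integral {0..T} (\<lambda>t. f (Y t))) \<le> ray_integral (\<lambda>t. f (y t))"
proof -
  have c: "cts (\<lambda>t. f (Y t))" by (rule continuous_on_compose2[OF f(1) Y(1)]) auto
  have "ennreal (integral {0..T} (\<lambda>t. f (Y t))) = (\<integral>\<^sup>+t\<in>{0..T}. ennreal (f (Y t)) \<partial>lborel)"
    by (intro nn_integral_Icc[where f = "\<lambda>t. f (Y t)", symmetric] borel_measurable_continuous_onI c
        cts_integrable f(2))
  also have "\<dots> \<le> ray_integral (\<lambda>t. f (y t))"
    using Y(2) by (intro nn_integral_mono) (auto simp: indicator_def)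
  finally show ?thesis .
qed

text \<open>Division by a growing \<open>T\<close> removes the error \<open>K\<close>.\<close>

lemma slope_le:
  fixes a b K :: real
  assumes "\<And>T. 0 < T \<Longrightarrow> T * a - K \<le> b * T" shows "a \<le> b"
proof -
  have "0 \<le> b - a"
  proof (rule nonneg_if_affine_bounded_below)
    fix T :: real assume "0 < T"
    from assms[OF this] show "- K \<le> T * (b - a) + 0" by (simp add: algebra_simps)
  qed
  then show ?thesis by simp
qed

text \<open>Inputs along coordinate axes test the column sums, the largest of which is the 1-norm of
  a nonnegative matrix.\<close>

lemma L1_gain_static:
  assumes B: "neg_inverse Ab B" and G: "L1_gain_lt N hbar A Eu C Fu hconst \<gamma>"
  shows "\<exists>g<\<gamma>. \<forall>j. (1 v* static_gain B) $ j \<le> g"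
  using G unfolding L1_gain_lt_def
proof (elim exE conjE, goal_cases)
  case (1 g)
  note g = 1(1,2)
  note gain = 1(3)[rule_format, OF conjI[OF step_input_measurable conjI[OF _ conjI]]]
  have "(1 v* static_gain B) $ j \<le> g" for j
  proof -
    let ?u = "axis j 1 :: real^'u"
    have u0: "\<forall>k. 0 \<le> ?u $ k" by (simp add: axis_def)
    have vu: "vnorm1 ?u = 1" by (simp add: vnorm1_def axis_def if_distrib cong: if_cong)
    have v0: "vnorm1 (0::real^'u) = 0" by (simp add: vnorm1_def)
    obtain K where K: "\<And>T. 0 \<le> T \<Longrightarrow> \<exists>x Y. step_response T ?u x Y \<and> T * (1 \<bullet> (static_gain B *v ?u)) - K \<le> integral {0..T} (\<lambda>t. 1 \<bullet> Y t)"
      using static_response[OF B u0, of 1] by auto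
    have "1 \<bullet> (static_gain B *v ?u) \<le> g"
    proof (rule slope_le)
      fix T :: real assume "0 < T"
      then have T: "0 \<le> T" by simp
      from K[OF T] obtain x Y where r: "step_response T ?u x Y"
        and le: "T * (1 \<bullet> (static_gain B *v ?u)) - K \<le> integral {0..T} (\<lambda>t. 1 \<bullet> Y t)" by blast
      note x = step_responseD(1,2)[OF r] and Y = step_responseD(3-5)[OF r]
      have I: "ray_integral (\<lambda>t. vnorm1 (step_input T ?u t)) = ennreal T"
        using nn_integral_step_input[of vnorm1 ?u T] T by (simp add: vu v0)
      have "cts (vnorm1 :: real^'y \<Rightarrow> real)" unfolding vnorm1_def by (intro continuous_intros)
      then have "ennreal (integral {0..T} (\<lambda>t. vnorm1 (Y t))) \<le> ray_integral (\<lambda>t. vnorm1 (output hconst x (step_input T ?u) t))"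
        using T by (intro output_integral_le[OF Y(1,3)]) (auto simp: vnorm1_def intro!: sum_nonneg)
      also have "\<dots> \<le> ennreal g * ennreal T"
        using gain[OF _ x] unfolding I by simp
      also have "\<dots> = ennreal (g * T)" using g(1) by (simp add: ennreal_mult')
      finally have "integral {0..T} (\<lambda>t. vnorm1 (Y t)) \<le> g * T" using g T by (simp add: ennreal_le_iff)
      moreover have "vnorm1 (Y t) = 1 \<bullet> Y t" for t using Y(2) by (simp add: vnorm1_def inner_vec_def)
      ultimately show "T * (1 \<bullet> (static_gain B *v ?u)) - K \<le> g * T" using le by simp
    qed
    then show ?thesis by (simp add: dot_lmul_matrix[symmetric] inner_axis)
  qed
  then show ?case using g by blast
qed

text \<open>For a nonnegative input the response is weighted by its own limit \<open>w\<close>, and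
  \<open>2 * (w \<bullet> Y t) \<le> (norm (Y t))\<^sup>2 + w \<bullet> w\<close> turns the averaged
  response into a norm bound. Other signs follow since taking moduli of \<open>u\<close> can only
  enlarge the image under a nonnegative matrix.\<close>

lemma L2_gain_static:
  assumes B: "neg_inverse Ab B" and G: "L2_gain_lt N hbar A Eu C Fu hconst \<gamma>"
  shows "\<exists>g. 0 \<le> g \<and> g < \<gamma> \<and> (\<forall>u. norm (static_gain B *v u) \<le> g * norm u)"
  using G unfolding L2_gain_lt_def
proof (elim exE conjE, goal_cases)
  case (1 g)
  note g = 1(1,2)
  note gain = 1(3)[rule_format, OF conjI[OF step_input_measurable conjI[OF _ conjI]]]
  have pos: "norm (static_gain B *v u) \<le> g * norm u" if u: "\<forall>j. 0 \<le> u $ j" for u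
  proof -
    define w where "w = static_gain B *v u"
    have w0: "\<forall>k. 0 \<le> w $ k" unfolding w_def using nonneg_mat_mv[OF static_gain_nonneg[OF B] u] by blast
    obtain K where K: "\<And>T. 0 \<le> T \<Longrightarrow> \<exists>x Y. step_response T u x Y \<and> T * (w \<bullet> w) - K \<le> integral {0..T} (\<lambda>t. w \<bullet> Y t)"
      by (rule static_response[OF B u w0, folded w_def]) (rule that)
    have "2 * (w \<bullet> w) \<le> g\<^sup>2 * (norm u)\<^sup>2 + w \<bullet> w"
    proof (rule slope_le)
      fix T :: real assume "0 < T"
      then have T: "0 \<le> T" by simp
      from K[OF T] obtain x Y where r: "step_response T u x Y"
        and le: "T * (w \<bullet> w) - K \<le> integral {0..T} (\<lambda>t. w \<bullet> Y t)" by blast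
      note x = step_responseD(1,2)[OF r] and Y = step_responseD(3-5)[OF r]
      have I: "ray_integral (\<lambda>t. (norm (step_input T u t))\<^sup>2) = ennreal ((norm u)\<^sup>2 * T)"
        using T by (intro nn_integral_step_input[where f = "\<lambda>v. (norm v)\<^sup>2"]) auto
      have "ennreal (integral {0..T} (\<lambda>t. (norm (Y t))\<^sup>2)) \<le> ray_integral (\<lambda>t. (norm (output hconst x (step_input T u) t))\<^sup>2)"
        using T by (intro output_integral_le[OF Y(1,3), where f = "\<lambda>v. (norm v)\<^sup>2"] continuous_intros) auto
      also have "\<dots> \<le> ennreal (g\<^sup>2) * ennreal ((norm u)\<^sup>2 * T)"
        using gain[OF _ x] unfolding I by simp
      also have "\<dots> = ennreal (g\<^sup>2 * ((norm u)\<^sup>2 * T))" by (simp add: ennreal_mult')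
      finally have Y2: "integral {0..T} (\<lambda>t. (norm (Y t))\<^sup>2) \<le> g\<^sup>2 * ((norm u)\<^sup>2 * T)" using g T by (simp add: ennreal_le_iff)
      have c2: "cts (\<lambda>t. (norm (Y t))\<^sup>2)" by (intro continuous_intros Y(1))
      have "2 * integral {0..T} (\<lambda>t. w \<bullet> Y t) = integral {0..T} (\<lambda>t. 2 * (w \<bullet> Y t))" by simp
      also have "\<dots> \<le> integral {0..T} (\<lambda>t. (norm (Y t))\<^sup>2 + w \<bullet> w)"
      proof (rule integral_le)
        fix t
        have "0 \<le> (norm (Y t - w))\<^sup>2" by simp
        then show "2 * (w \<bullet> Y t) \<le> (norm (Y t))\<^sup>2 + w \<bullet> w"
          by (simp add: power2_norm_eq_inner inner_diff_left inner_diff_right inner_commute)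
      qed (auto intro!: cts_intros Y(1))
      also have "\<dots> = integral {0..T} (\<lambda>t. (norm (Y t))\<^sup>2) + (w \<bullet> w) * T"
        using T by (subst integral_add) (auto intro!: cts_integrable c2)
      finally show "T * (2 * (w \<bullet> w)) - 2 * K \<le> (g\<^sup>2 * (norm u)\<^sup>2 + w \<bullet> w) * T"
        using Y2 le by (simp add: algebra_simps)
    qed
    then have "(norm w)\<^sup>2 \<le> (g * norm u)\<^sup>2" by (simp add: power2_norm_eq_inner power_mult_distrib)
    then have "norm w \<le> g * norm u" by (rule power2_le_imp_le) (use g(1) in simp)
    then show ?thesis by (simp add: w_def)
  qed
  have "norm (static_gain B *v u) \<le> g * norm u" for u
  proof -
    have "norm (static_gain B *v u) \<le> norm (static_gain B *v vabs u)"
    proof (rule norm_le_componentwise_cart)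
      fix i
      have "\<bar>(static_gain B *v u) $ i\<bar> \<le> (static_gain B *v vabs u) $ i"
        by (intro abs_mv_le static_gain_nonneg B) simp
      then show "norm ((static_gain B *v u) $ i) \<le> norm ((static_gain B *v vabs u) $ i)" by simp
    qed
    also have "\<dots> \<le> g * norm (vabs u)" by (rule pos) simp
    also have "norm (vabs u) = norm u" by (simp add: norm_vec_def)
    finally show ?thesis .
  qed
  then show ?case using g by blast
qed

text \<open>The input \<open>1\<close> attains every row sum, and an output component that is at
  most \<open>g\<close> almost everywhere has average at most \<open>g\<close>.\<close>

lemma Linf_gain_static:
  assumes B: "neg_inverse Ab B" and G: "Linf_gain_lt N hbar A Eu C Fu hconst \<gamma>"
  shows "\<exists>g<\<gamma>. \<forall>k. (static_gain B *v 1) $ k \<le> g"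
  using G unfolding Linf_gain_lt_def
proof (elim exE conjE, goal_cases)
  case (1 g)
  note g = 1(1,2)
  note gain = 1(3)[rule_format, OF conjI[OF step_input_measurable conjI[OF _ conjI]]]
  have "(static_gain B *v 1) $ k \<le> g" for k
  proof -
    let ?w = "axis k 1 :: real^'y"
    have w0: "\<forall>k. 0 \<le> ?w $ k" by (simp add: axis_def)
    have wv: "?w \<bullet> v = v $ k" for v by (simp add: inner_axis')
    obtain K where K: "\<And>T. 0 \<le> T \<Longrightarrow> \<exists>x Y. step_response T 1 x Y \<and> T * (static_gain B *v 1) $ k - K \<le> integral {0..T} (\<lambda>t. Y t $ k)"
      using static_response[OF B _ w0, of 1] unfolding wv by auto
    show ?thesis
    proof (rule slope_le)
      fix T :: real assume "0 < T"
      then have T: "0 \<le> T" by simp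
      from K[OF T] obtain x Y where r: "step_response T 1 x Y"
        and le: "T * (static_gain B *v 1) $ k - K \<le> integral {0..T} (\<lambda>t. Y t $ k)" by blast
      note x = step_responseD(1,2)[OF r] and Y = step_responseD(3-5)[OF r]
      have c: "cts (\<lambda>t. Y t $ k)" by (intro continuous_intros Y(1))
      have "AE t in lborel. t \<ge> 0 \<longrightarrow> vnorm_inf (output hconst x (step_input T 1) t) \<le> g * 1"
        by (rule gain[OF _ x]) (auto simp: vnorm_inf_le_iff)
      then have ae: "AE t in lborel. t \<in> {0..T} \<longrightarrow> Y t $ k \<le> g"
      proof eventually_elim
        case (elim t)
        show ?case
        proof
          assume t: "t \<in> {0..T}"
          then have "\<bar>Y t $ k\<bar> \<le> g" using elim Y(3) by (auto simp: vnorm_inf_le_iff)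
          then show "Y t $ k \<le> g" by simp
        qed
      qed
      have "ennreal (integral {0..T} (\<lambda>t. Y t $ k)) = (\<integral>\<^sup>+t\<in>{0..T}. ennreal (Y t $ k) \<partial>lborel)"
        by (intro nn_integral_Icc[where f = "\<lambda>t. Y t $ k", symmetric] borel_measurable_continuous_onI c
            cts_integrable Y(2))
      also have "\<dots> \<le> (\<integral>\<^sup>+t\<in>{0..T}. ennreal g \<partial>lborel)"
        using ae by (intro nn_integral_mono_AE) (auto elim!: eventually_mono simp: indicator_def intro: ennreal_leI)
      also have "\<dots> = ennreal (g * T)" using T g by (simp add: nn_integral_cmult ennreal_mult)
      finally have "integral {0..T} (\<lambda>t. Y t $ k) \<le> g * T" using g T by (simp add: ennreal_le_iff)
      then show "T * (static_gain B *v 1) $ k - K \<le> g * T" using le by simp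
    qed
  qed
  then show ?case using g by blast
qed

lemma stable_imp_neg_inverse:
  assumes "stable_for hconst"
  shows "\<exists>B. neg_inverse Ab B"
  using ville_alternative_left[of Ab] not_stable_if_nonneg_direction assms
    metzler_neg_inverse[OF Ab_metzler] by blast

section \<open>The three equivalences\<close>

theorem L1_characterization:
  "(\<forall>dl. admissible dl \<longrightarrow> stable_for dl \<and> L1_gain_lt N hbar A Eu C Fu dl \<gamma>)
   \<longleftrightarrow> (\<exists>l::real^'n. (\<forall>j. 0 < l$j) \<and>
        (\<forall>j. (l v* Ab + 1 v* Cb) $ j < 0) \<and> (\<forall>j. (l v* Eu + 1 v* Fu) $ j < \<gamma>))" (is "?L \<longleftrightarrow> ?R")
proof (intro iffI allI impI)
  assume *: ?L
  then obtain B where B: "neg_inverse Ab B" using admissible_hbar stable_imp_neg_inverse by blast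
  with * L1_gain_static obtain g where "g < \<gamma>" "\<forall>j. (1 v* static_gain B) $ j \<le> g" using admissible_hbar by blast
  then show ?R
    by (intro left_lp_exists[OF B])
next
  fix dl assume dl: "admissible dl"
  assume ?R
  then obtain l :: "real^'n" where l: "\<forall>j. 0 < l$j" "\<forall>j. (l v* Ab + 1 v* Cb) $ j < 0"
    "\<forall>j. (l v* Eu + 1 v* Fu) $ j < \<gamma>" by blast
  \<comment> \<open>Dropping the nonnegative term \<open>1 v* Cb\<close> leaves the stability
    certificate.\<close>
  have "0 \<le> (1 v* Cb) $ j" for j by (intro nonneg_mat_vm Cb_nonneg) simp
  moreover have "(l v* Ab) $ j + (1 v* Cb) $ j < 0" for j using l(2) by simp
  ultimately have "\<forall>j. (l v* Ab) $ j < 0" by (smt (verit))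
  then show "stable_for dl \<and> L1_gain_lt N hbar A Eu C Fu dl \<gamma>"
    using asymptotic_stability[OF dl l(1)] L1_gain[OF dl l] by blast
qed

theorem L2_characterization:
  "(\<forall>dl. admissible dl \<longrightarrow> stable_for dl \<and> L2_gain_lt N hbar A Eu C Fu dl \<gamma>)
   \<longleftrightarrow> (\<exists>P Q. diag_pd P \<and> (\<forall>i\<in>{1..N}. diag_pd (Q i)) \<and> lmi2 P Q \<gamma>)" (is "?L \<longleftrightarrow> ?R")
proof (intro iffI allI impI)
  assume *: ?L
  then obtain B where B: "neg_inverse Ab B" using admissible_hbar stable_imp_neg_inverse by blast
  with * L2_gain_static obtain g where "0 \<le> g" "g < \<gamma>" "\<forall>u. norm (static_gain B *v u) \<le> g * norm u"
    using admissible_hbar by blast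
  then show ?R
    by (intro lmi2_exists[OF B])
next
  fix dl assume dl: "admissible dl"
  assume ?R
  then obtain P Q where P: "diag_pd P" and L: "lmi2 P Q \<gamma>" by blast
  \<comment> \<open>The input block \<open>- \<gamma> I\<close> alone forces
    \<open>0 < \<gamma>\<close>.\<close>
  have "form2 P Q \<gamma> 0 (\<lambda>_. 0) 1 0 < 0"
    using L unfolding lmi2_neg_def_def by (metis zero_neq_one)
  then have "0 < \<gamma> * ((1::real^'u) \<bullet> 1)" by (simp add: lmi2_form_def)
  then have g: "0 < \<gamma>" by (rule zero_less_mult_pos2) (simp add: inner_gt_zero_iff)
  obtain l where l: "\<forall>j. 0 < l$j" "\<forall>i. (l v* Ab)$i < 0" using lmi2_imp_stable[OF P L] by blast
  then obtain B where B: "neg_inverse Ab B"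
    using metzler_neg_inverse[OF Ab_metzler] by blast
  from strict_norm_bound_uniform[OF lmi2_imp_static_gain[OF P L B _ g]] obtain g' where g': "0 \<le> g'" "g' < \<gamma>"
    "\<forall>u. norm (static_gain B *v u) \<le> g' * norm u" by blast
  \<comment> \<open>Above \<open>g'\<close>, so that a block inequality at level
    \<open>\<beta>\<close> can be built; below \<open>\<gamma>\<close>, so that the resulting gain
    is strict.\<close>
  define \<beta> where "\<beta> = (g' + \<gamma>) / 2"
  have b: "0 < \<beta>" "g' < \<beta>" "\<beta> < \<gamma>" using g'(1,2) by (simp_all add: \<beta>_def)
  obtain P' Q' where "diag_pd P'" "\<forall>i\<in>{1..N}. diag_pd (Q' i)" "lmi2 P' Q' \<beta>"
    using lmi2_exists[OF B g'(1) b(2) g'(3)] by blast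
  then show "stable_for dl \<and> L2_gain_lt N hbar A Eu C Fu dl \<gamma>"
    using asymptotic_stability[OF dl l] L2_gain[OF dl _ _ _ b(1,3)] by blast
qed

theorem Linf_characterization:
  "(\<forall>dl. admissible dl \<longrightarrow> stable_for dl \<and> Linf_gain_lt N hbar A Eu C Fu dl \<gamma>)
   \<longleftrightarrow> (\<exists>l::real^'n. (\<forall>j. 0 < l$j) \<and>
        (\<forall>j. (Ab *v l + Eu *v 1) $ j < 0) \<and> (\<forall>j. (Cb *v l + Fu *v 1) $ j < \<gamma>))" (is "?L \<longleftrightarrow> ?R")
proof (intro iffI allI impI)
  assume *: ?L
  then obtain B where B: "neg_inverse Ab B" using admissible_hbar stable_imp_neg_inverse by blast
  with * Linf_gain_static obtain g where "g < \<gamma>" "\<forall>j. (static_gain B *v 1) $ j \<le> g" using admissible_hbar by blast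
  then show ?R
    by (intro right_lp_exists[OF B])
next
  fix dl assume dl: "admissible dl"
  assume ?R
  then obtain l :: "real^'n" where l: "\<forall>j. 0 < l$j" "\<forall>j. (Ab *v l + Eu *v 1) $ j < 0"
    "\<forall>j. (Cb *v l + Fu *v 1) $ j < \<gamma>" by blast
  have "0 \<le> (Eu *v 1) $ j" for j by (intro nonneg_mat_mv E) simp
  moreover have "(Ab *v l) $ j + (Eu *v 1) $ j < 0" for j using l(2) by simp
  ultimately have "\<forall>j. (Ab *v l) $ j < 0" by (smt (verit))
  \<comment> \<open>Stability is available from a left certificate only. The right certificate gives
    an inverse for the transpose, hence for \<open>Ab\<close>, and \<open>1 v* transpose B'\<close>
    is a left certificate.\<close>
  then have Al: "\<forall>j. (l v* transpose Ab) $ j < 0" by simp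
  have "metzler (transpose Ab)" using Ab_metzler by (auto simp: metzler_def transpose_def)
  then obtain B' where "neg_inverse (transpose Ab) B'" using metzler_neg_inverse l(1) Al by blast
  from neg_inverse_transpose[OF this] have B: "neg_inverse Ab (transpose B')"
    by (simp add: transpose_transpose)
  have "\<forall>j. 0 < (1 v* transpose B') $ j" using neg_inverse_vm_pos[OF B] by simp
  moreover have "\<forall>j. ((1 v* transpose B') v* Ab) $ j < 0" by (simp only: neg_inverse_vm[OF B]) simp
  ultimately show "stable_for dl \<and> Linf_gain_lt N hbar A Eu C Fu dl \<gamma>"
    using asymptotic_stability[OF dl] Linf_gain[OF dl l] by blast
qed

end

theorem theorem16:
  fixes N :: nat and hbar :: "nat \<Rightarrow> real"
    and A :: "nat \<Rightarrow> real^'n^'n" and C :: "nat \<Rightarrow> real^'n^'y"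
    and Eu :: "real^'u^'n" and Fu :: "real^'u^'y"
    and \<gamma>1 \<gamma>2 \<gamma>inf :: real
  assumes "metzler (A 0)"
    and "\<forall>i\<in>{1..N}. nonneg_mat (A i)"
    and "\<forall>i\<in>{0..N}. nonneg_mat (C i)"
    and "nonneg_mat Eu" and "nonneg_mat Fu"
    and "\<forall>i\<in>{1..N}. 0 \<le> hbar i"
  shows
   "((\<forall>h. admissible_delays N hbar h \<longrightarrow>
        asymp_stable N hbar A Eu h \<and> L1_gain_lt N hbar A Eu C Fu h \<gamma>1)
     \<longleftrightarrow> (\<exists>lam::real^'n. (\<forall>j. 0 < lam$j) \<and>
            (\<forall>j. (lam v* Abar N hbar A + (\<chi> k. (1::real)) v* Abar N hbar C) $ j < 0) \<and>
            (\<forall>j. (lam v* Eu + (\<chi> k. (1::real)) v* Fu) $ j < \<gamma>1)))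
    \<and> ((\<forall>h. admissible_delays N hbar h \<longrightarrow>
        asymp_stable N hbar A Eu h \<and> L2_gain_lt N hbar A Eu C Fu h \<gamma>2)
     \<longleftrightarrow> (\<exists>P Q. diag_pd P \<and> (\<forall>i\<in>{1..N}. diag_pd (Q i)) \<and>
            lmi2_neg_def N hbar A Eu C Fu P Q \<gamma>2))
    \<and> ((\<forall>h. admissible_delays N hbar h \<longrightarrow>
        asymp_stable N hbar A Eu h \<and> Linf_gain_lt N hbar A Eu C Fu h \<gamma>inf)
     \<longleftrightarrow> (\<exists>lam::real^'n. (\<forall>j. 0 < lam$j) \<and>
            (\<forall>j. (Abar N hbar A *v lam + Eu *v (\<chi> k. (1::real))) $ j < 0) \<and>
            (\<forall>j. (Abar N hbar C *v lam + Fu *v (\<chi> k. (1::real))) $ j < \<gamma>inf)))"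
proof -
  interpret positive_delay_system N hbar A C Eu Fu
    using assms by unfold_locales
  have one: "(\<chi> k. (1::real)) = (1 :: real^'k)" by (simp add: vec_eq_iff)
  show ?thesis
    unfolding one by (intro conjI L1_characterization L2_characterization Linf_characterization)
qed

end
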